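(* Let $p\in[0,1)$ and $\rho<2/3$. There exist constants $c_7\in(0,1)$ and $c_8>0$ such that whenever $\alpha=m/n>c_7$ and $n$ is sufficiently large the following holds. Fix $T\subseteq\{1,\dots,n\}$ with $|T|\le\rho m$ and a sign pattern $\sigma\in\{-1,+1\}^T$. Then with probability at least $1-e^{-c_8n}$ an $m\times n$ matrix $A$ with i.i.d. $\mathcal N(0,1)$ entries has the property: every $\mathbf x\in\mathbb R^n$ with support $T$ and $\operatorname{sgn}(x_i)=\sigma_i$ for $i\in T$ is the unique solution of $\min\{\|\mathbf v\|_p^p:A\mathbf v=A\mathbf x\}$ (for $p=0$, of $\min\{\|\mathbf v\|_0:A\mathbf v=A\mathbf x\}$).
   Context: $\|\mathbf v\|_p^p=\sum_i|v_i|^p$ for $p>0$; $\|\mathbf v\|_0=|\{i:v_i\ne0\}|$. *)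

theory Defs
  imports "HOL-Probability.Probability"
begin

text \<open>Vectors in R^n are functions nat => real vanishing outside {0..<n}
  (coordinates 0..n-1 instead of 1..n). An m x n matrix is a function on
  nat x nat; only entries in {0..<m} x {0..<n} matter.\<close>

definition is_vec :: "nat \<Rightarrow> (nat \<Rightarrow> real) \<Rightarrow> bool" where
  "is_vec n v \<longleftrightarrow> (\<forall>i\<ge>n. v i = 0)"

definition mat_vec :: "nat \<Rightarrow> (nat \<times> nat \<Rightarrow> real) \<Rightarrow> (nat \<Rightarrow> real) \<Rightarrow> nat \<Rightarrow> real" where
  "mat_vec n A v i = (\<Sum>j<n. A (i, j) * v j)"

definition lp_obj :: "real \<Rightarrow> nat \<Rightarrow> (nat \<Rightarrow> real) \<Rightarrow> real" where
  "lp_obj p n v = (if p = 0 then real (card {i \<in> {..<n}. v i \<noteq> 0})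
                   else (\<Sum>i<n. \<bar>v i\<bar> powr p))"

definition unique_min :: "real \<Rightarrow> nat \<Rightarrow> nat \<Rightarrow> (nat \<times> nat \<Rightarrow> real) \<Rightarrow> (nat \<Rightarrow> real) \<Rightarrow> bool" where
  "unique_min p m n A x \<longleftrightarrow>
     (\<forall>v. is_vec n v \<and> (\<forall>i<m. mat_vec n A v i = mat_vec n A x i) \<and> v \<noteq> x
          \<longrightarrow> lp_obj p n x < lp_obj p n v)"

definition gauss_mat :: "nat \<Rightarrow> nat \<Rightarrow> (nat \<times> nat \<Rightarrow> real) measure" where
  "gauss_mat m n = PiM ({..<m} \<times> {..<n}) (\<lambda>_. density lborel std_normal_density)"

end

theory Submission
  imports Defs
begin

text \<open>
  Recovery can fail for some signal with support \<open>T\<close> and signs \<open>\<sigma>\<close> only if the null space of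
  \<open>A\<close> contains a \<open>w \<noteq> 0\<close> for which the sum of \<open>\<bar>w i\<bar> powr p\<close> over \<open>i \<notin> T\<close> is at most the sum over those
  \<open>i \<in> T\<close> with \<open>\<sigma> i * w i < 0\<close>. Such \<open>w\<close> form a cone, and since \<open>\<rho> / 2 < 1 - \<rho>\<close>, a Chernoff bound shows
  that a Gaussian vector \<open>h\<close> is close to this cone only with exponentially small probability.

  To pass from \<open>h\<close> to the null space, of dimension \<open>d = n - m\<close>, let \<open>u\<close> be the projection of an independent
  Gaussian vector \<open>g\<close> onto it. If the null space meets the cone in \<open>w\<close>, then shifting \<open>g\<close> along \<open>w\<close> shows that
  \<open>u\<close> points nearly in the direction of \<open>w\<close> with probability at least \<open>exp (- \<kappa> * d)\<close>, up to a constant.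
  On the other hand the laws of \<open>u\<close> and \<open>h\<close> are rotation invariant; integrating the
  indicator of a small angle between \<open>u\<close> and \<open>h\<close> in both orders compares the two directions without
  any uniqueness theorem for Haar measure. Hence the failure probability is at most a constant times
  \<open>exp (\<kappa> * d)\<close> times the probability that \<open>h\<close> is close to the cone, and \<open>d\<close> is a small
  fraction of \<open>n\<close>. No net and no bound on singular values is needed.
\<close>

section \<open>Gram--Schmidt projections and plane rotations\<close>

text \<open>For one fixed \<open>A\<close> the null space has no rotation invariance; invariance
  appears only after averaging over \<open>A\<close> as well. A bad null vector must therefore force
  an average over \<open>g\<close> and \<open>h\<close> to be large, so that Markov's inequality
  over \<open>A\<close> applies. Steering \<open>g\<close> towards the bad vector is cheap because
  only the part of \<open>g\<close> in the null space matters, whose squared length is about d;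
  hence d and not n appears in the exponent. The mass of a cap of nearby directions may be tiny, but
  it occurs both in the lower bound for a bad matrix and in the upper bound for the average and
  cancels, so only its positivity is needed.

  Closeness to the cone is tested by a sum of coordinate functions that is not homogeneous. Its
  stability estimate is useful only while the squared length of \<open>h\<close> is of order n,
  which is why \<open>h\<close> is truncated to a ball. The constants are fixed in this order: the
  gap \<tau> between means, the closeness \<eta>, the Chernoff parameter \<theta>, and last the
  aspect ratio. As \<eta> and \<theta> do not depend on m and n, taking m/n near 1 makes the loss
  \<kappa> * d smaller than the Chernoff gain.\<close>

definition ip :: "nat \<Rightarrow> (nat \<Rightarrow> real) \<Rightarrow> (nat \<Rightarrow> real) \<Rightarrow> real" where
  "ip n x y = (\<Sum>i<n. x i * y i)"

definition unit_vec :: "nat \<Rightarrow> nat \<Rightarrow> real" where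
  "unit_vec i = (\<lambda>l. if l = i then 1 else 0)"

text \<open>Gram-Schmidt without normalisation: on the first \<open>n\<close> coordinates this is
  the orthogonal projection onto the complement of the first \<open>k\<close> vectors. A vector
  dependent on its predecessors has residue zero, and division by zero then cancels the correction,
  so no independence has to be assumed.\<close>

primrec oproj :: "nat \<Rightarrow> (nat \<Rightarrow> nat \<Rightarrow> real) \<Rightarrow> nat \<Rightarrow> (nat \<Rightarrow> real) \<Rightarrow> nat \<Rightarrow> real" where
  "oproj n a 0 x = x"
| "oproj n a (Suc k) x = (\<lambda>i. oproj n a k x i
     - ip n (oproj n a k x) (oproj n a k (a k)) / ip n (oproj n a k (a k)) (oproj n a k (a k))
       * oproj n a k (a k) i)"

lemma ip_commute: "ip n x y = ip n y x"
  by (simp add: ip_def mult.commute)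

lemma ip_diff_scale_left: "ip n (\<lambda>i. x i - c * y i) z = ip n x z - c * ip n y z"
  by (simp add: ip_def sum_distrib_left sum_subtractf algebra_simps)

lemma ip_diff_scale_right: "ip n z (\<lambda>i. x i - c * y i) = ip n z x - c * ip n z y"
  by (simp add: ip_def sum_distrib_left sum_subtractf algebra_simps)

lemma ip_scale_left: "ip n (\<lambda>i. c * x i) y = c * ip n x y"
  by (simp add: ip_def sum_distrib_left algebra_simps)

lemma ip_scale_right: "ip n y (\<lambda>i. c * x i) = c * ip n y x"
  by (simp add: ip_def sum_distrib_left algebra_simps)

lemma ip_self_nonneg [simp]: "0 \<le> ip n x x"
  by (simp add: ip_def sum_nonneg)

lemma ip_self_eq_0_iff: "ip n x x = 0 \<longleftrightarrow> (\<forall>i<n. x i = 0)"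
  by (auto simp: ip_def sum_nonneg_eq_0_iff)

lemma ip_self_pos_iff: "0 < ip n x x \<longleftrightarrow> ip n x x \<noteq> 0"
  by (simp add: less_le)

lemma ip_eq_0_if_left: "ip n x x = 0 \<Longrightarrow> ip n x y = 0"
  using ip_self_eq_0_iff[of n x] by (simp add: ip_def)

lemma ip_eq_0_if_right: "ip n y y = 0 \<Longrightarrow> ip n x y = 0"
  using ip_eq_0_if_left ip_commute by metis

lemma ip_cong: "(\<And>i. i < n \<Longrightarrow> x i = x' i) \<Longrightarrow> (\<And>i. i < n \<Longrightarrow> y i = y' i) \<Longrightarrow> ip n x y = ip n x' y'"
  by (simp add: ip_def)

lemma ip_unit_vec_right: "i < n \<Longrightarrow> ip n x (unit_vec i) = x i"
  by (simp add: ip_def unit_vec_def if_distrib sum.If_cases cong: if_cong)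

text \<open>Linearity in the shape that one Gram-Schmidt step produces; a negative scalar turns it
  into additivity.\<close>

lemma oproj_diff_scale:
  "oproj n a k (\<lambda>i. x i - c * y i) = (\<lambda>i. oproj n a k x i - c * oproj n a k y i)"
proof (induction k)
  case 0 then show ?case by simp
next
  case (Suc k)
  then show ?case
    by (simp only: oproj.simps Suc ip_diff_scale_left diff_divide_distrib) (simp add: fun_eq_iff algebra_simps)
qed

lemma oproj_idem: "oproj n a k (oproj n a k x) = oproj n a k x"
proof (induction k arbitrary: x)
  case 0 then show ?case by simp
next
  case (Suc k)
  let ?b = "oproj n a k (a k)"
  show ?case
    by (cases "ip n ?b ?b = 0")
       (simp_all add: oproj_diff_scale Suc ip_diff_scale_left del: times_divide_eq_left)
qed

text \<open>Earlier steps fix the residue \<open>oproj n a k (a k)\<close>, so the induction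
  hypothesis moves them across each inner product with it, and the rank-one term becomes symmetric
  in \<open>x\<close> and \<open>y\<close>. Both vectors are generalised because the hypothesis is
  also applied to the residue.\<close>

lemma oproj_self_adjoint: "ip n (oproj n a k x) y = ip n x (oproj n a k y)"
proof (induction k arbitrary: x y)
  case 0 then show ?case by simp
next
  case (Suc k)
  let ?b = "oproj n a k (a k)"
  have "ip n (oproj n a (Suc k) x) y = ip n (oproj n a k x) y - ip n (oproj n a k x) ?b / ip n ?b ?b * ip n ?b y"
    unfolding oproj.simps by (rule ip_diff_scale_left)
  also have "ip n (oproj n a k x) ?b = ip n x (oproj n a k ?b)" by (rule Suc)
  also have "ip n ?b y = ip n (oproj n a k y) (a k)" using Suc ip_commute by metis
  also have "ip n x (oproj n a k ?b) = ip n x ?b" by (simp only: oproj_idem)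
  also have "ip n (oproj n a k y) (a k) = ip n (oproj n a k y) ?b"
    by (metis Suc oproj_idem)
  also have "ip n (oproj n a k x) y = ip n x (oproj n a k y)" by (rule Suc)
  also have "ip n x (oproj n a k y) - ip n x ?b / ip n ?b ?b * ip n (oproj n a k y) ?b
     = ip n x (oproj n a (Suc k) y)"
    unfolding oproj.simps ip_diff_scale_right by (simp only: times_divide_eq_left) (simp only: ip_commute mult.commute)
  finally show ?case .
qed

lemma ip_oproj_oproj: "ip n (oproj n a k x) (oproj n a k y) = ip n (oproj n a k x) y"
  by (metis oproj_idem oproj_self_adjoint)

text \<open>With the rows of the matrix as \<open>a\<close>, null vectors are fixed points of the
  projection.\<close>

lemma oproj_fix:
  assumes "\<And>j. j < k \<Longrightarrow> ip n (a j) x = 0"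
  shows "oproj n a k x = x"
  using assms
proof (induction k)
  case 0 then show ?case by simp
next
  case (Suc k)
  then have "oproj n a k x = x" by simp
  moreover have "ip n x (oproj n a k (a k)) = 0"
    by (subst oproj_self_adjoint[symmetric], subst calculation, subst ip_commute) (simp add: Suc.prems)
  ultimately show ?case by simp
qed

lemma oproj_cong:
  assumes "\<And>j. j < k \<Longrightarrow> a j = a' j"
  shows "oproj n a k x = oproj n a' k x"
  using assms
proof (induction k arbitrary: x)
  case 0 then show ?case by simp
next
  case (Suc k)
  then show ?case by simp
qed

lemma oproj_cong_lt:
  assumes "\<And>j i. j < k \<Longrightarrow> i < n \<Longrightarrow> a j i = a' j i" "\<And>i. i < n \<Longrightarrow> x i = x' i" "i < n"
  shows "oproj n a k x i = oproj n a' k x' i"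
  using assms
proof (induction k arbitrary: x x' i)
  case 0 then show ?case by simp
next
  case (Suc k)
  have 1: "oproj n a k x l = oproj n a' k x' l" if "l < n" for l
    by (rule Suc.IH) (use Suc.prems that in auto)
  have 2: "oproj n a k (a k) l = oproj n a' k (a' k) l" if "l < n" for l
    by (rule Suc.IH) (use Suc.prems that in auto)
  show ?case
    using 1 2 Suc.prems(3) by (simp cong: ip_cong)
qed

lemma oproj_nth: "i < n \<Longrightarrow> oproj n a k x i = ip n x (oproj n a k (unit_vec i))"
  by (metis ip_unit_vec_right oproj_self_adjoint)

lemma ip_oproj_unit_vec:
  "i < n \<Longrightarrow> ip n (oproj n a k (unit_vec i)) (oproj n a k (unit_vec i)) = oproj n a k (unit_vec i) i"
  by (simp add: ip_oproj_oproj ip_unit_vec_right)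

text \<open>The trace of an orthogonal projection is its rank; this replaces every dimension count.\<close>

lemma trace_oproj:
  "(\<Sum>i<n. oproj n a k (unit_vec i) i) =
    real n - real (card {j. j < k \<and> ip n (oproj n a j (a j)) (oproj n a j (a j)) \<noteq> 0})"
proof (induction k)
  case 0 then show ?case by (simp add: unit_vec_def)
next
  case (Suc k)
  let ?b = "oproj n a k (a k)"
  have eq: "{j. j < Suc k \<and> ip n (oproj n a j (a j)) (oproj n a j (a j)) \<noteq> 0} =
     {j. j < k \<and> ip n (oproj n a j (a j)) (oproj n a j (a j)) \<noteq> 0} \<union> (if ip n ?b ?b \<noteq> 0 then {k} else {})"
    by (auto simp: less_Suc_eq)
  have 1: "ip n (oproj n a k (unit_vec i)) ?b = ?b i" if "i < n" for i
    using that by (metis ip_commute ip_oproj_oproj ip_unit_vec_right)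
  \<comment> \<open>One step subtracts a rank-one operator of trace 1, or nothing if the residue
    vanishes, since a quotient by zero is zero.\<close>
  have "(\<Sum>i<n. oproj n a (Suc k) (unit_vec i) i) =
     (\<Sum>i<n. oproj n a k (unit_vec i) i) - (\<Sum>i<n. ?b i * ?b i) / ip n ?b ?b"
    by (simp add: sum_subtractf 1 sum_divide_distrib)
  also have "(\<Sum>i<n. ?b i * ?b i) / ip n ?b ?b = (if ip n ?b ?b \<noteq> 0 then 1 else 0)"
    by (simp add: ip_def)
  finally show ?case
    unfolding eq Suc by (subst card_Un_disjoint) auto
qed

section \<open>Plane rotations and reduction to the first axis\<close>

text \<open>The index type is polymorphic because the same rotation acts on vectors and, with pairs
  as indices, on a row of a matrix. Coefficients with \<open>c\<^sup>2 + s\<^sup>2 = 1\<close>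
  replace an angle.\<close>

definition givens :: "'a \<Rightarrow> 'a \<Rightarrow> real \<Rightarrow> real \<Rightarrow> ('a \<Rightarrow> real) \<Rightarrow> 'a \<Rightarrow> real" where
  "givens j k c s x = x(j := c * x j - s * x k, k := s * x j + c * x k)"

lemma givens_diff_scale:
  "givens j k c s (\<lambda>i. x i - t * y i) = (\<lambda>i. givens j k c s x i - t * givens j k c s y i)"
  by (auto simp: givens_def fun_eq_iff algebra_simps)

lemma ip_givens:
  assumes "j \<noteq> k" "j < n" "k < n" "c\<^sup>2 + s\<^sup>2 = 1"
  shows "ip n (givens j k c s x) (givens j k c s y) = ip n x y"
proof -
  have split: "ip n u v = (\<Sum>i\<in>{..<n} - {j,k}. u i * v i) + (u j * v j + u k * v k)" for u v
    unfolding ip_def using assms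
    by (subst sum.subset_diff[of "{j,k}"]) auto
  have "(c * x j - s * x k) * (c * y j - s * y k) + (s * x j + c * x k) * (s * y j + c * y k)
      = (c\<^sup>2 + s\<^sup>2) * (x j * y j + x k * y k)"
    by (simp add: algebra_simps power2_eq_square)
  then show ?thesis
    unfolding split using assms by (simp add: givens_def)
qed

text \<open>The recursion uses only inner products, which a rotation preserves, and linear
  combinations, with which it commutes.\<close>

lemma oproj_givens:
  assumes "j \<noteq> k" "j < n" "k < n" "c\<^sup>2 + s\<^sup>2 = 1"
  shows "oproj n (\<lambda>i. givens j k c s (a i)) l (givens j k c s x) = givens j k c s (oproj n a l x)"
proof (induction l arbitrary: x)
  case 0 then show ?case by simp
next
  case (Suc l)
  show ?case
    by (simp only: oproj.simps Suc ip_givens[OF assms] givens_diff_scale)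
qed

text \<open>Rotations in coordinate planes through axis 0 clear the other coordinates one at a time,
  which replaces transitivity of the orthogonal group on spheres. With \<open>2 \<le> n\<close> at
  least one rotation takes place, and it also makes coordinate 0 nonnegative.\<close>

lemma givens_invariant_imp:
  fixes \<Psi> :: "(nat \<Rightarrow> real) \<Rightarrow> 'b"
  assumes "2 \<le> n"
    and inv: "\<And>j k c s y. j \<noteq> k \<Longrightarrow> j < n \<Longrightarrow> k < n \<Longrightarrow> c\<^sup>2 + s\<^sup>2 = 1 \<Longrightarrow> \<Psi> (givens j k c s y) = \<Psi> y"
    and cong: "\<And>y y'. (\<And>i. i < n \<Longrightarrow> y i = y' i) \<Longrightarrow> \<Psi> y = \<Psi> y'"
  shows "\<Psi> y = \<Psi> (\<lambda>i. sqrt (ip n y y) * unit_vec 0 i)"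
proof -
  have "\<exists>z. \<Psi> z = \<Psi> y \<and> ip n z z = ip n y y \<and> (\<forall>l. 1 \<le> l \<and> l < r \<longrightarrow> z l = 0) \<and> (2 \<le> r \<longrightarrow> 0 \<le> z 0)"
    if "r \<le> n" for r
    using that
  proof (induction r)
    case 0 then show ?case by auto
  next
    case (Suc r)
    then obtain z where z: "\<Psi> z = \<Psi> y" "ip n z z = ip n y y" "\<And>l. 1 \<le> l \<Longrightarrow> l < r \<Longrightarrow> z l = 0"
      by auto
    show ?case
    proof (cases "r = 0")
      case True then show ?thesis using z by auto
    next
      case False
      \<comment> \<open>The rotation that moves the vector (z 0, z r) onto the nonnegative first
        axis of its plane; if both entries vanish, the identity is used.\<close>
      define h where "h = sqrt ((z 0)\<^sup>2 + (z r)\<^sup>2)"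
      have h: "h\<^sup>2 = (z 0)\<^sup>2 + (z r)\<^sup>2" by (simp add: h_def)
      define c where "c = (if h = 0 then 1 else z 0 / h)"
      define s where "s = (if h = 0 then 0 else - z r / h)"
      have cs: "c\<^sup>2 + s\<^sup>2 = 1"
        by (auto simp: c_def s_def power_divide h[symmetric] add_divide_distrib[symmetric])
      have zero: "s * z 0 + c * z r = 0"
        using h by (auto simp: c_def s_def)
      have pos: "c * z 0 - s * z r \<ge> 0"
      proof (cases "h = 0")
        case True then show ?thesis using h by (auto simp: c_def s_def)
      next
        case False
        then have "c * z 0 - s * z r = h\<^sup>2 / h"
          unfolding h by (simp add: c_def s_def power2_eq_square add_divide_distrib)
        then show ?thesis by (simp add: h_def power2_eq_square)
      qed
      let ?z = "givens 0 r c s z"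
      have "\<Psi> ?z = \<Psi> y" "ip n ?z ?z = ip n y y"
        using False Suc.prems cs z inv[of 0 r c s z] ip_givens[of 0 r n c s z z] by auto
      moreover have "?z l = 0" if "1 \<le> l" "l < Suc r" for l
        using that z(3)[of l] zero by (auto simp: givens_def)
      moreover have "0 \<le> ?z 0" using pos False by (simp add: givens_def)
      ultimately show ?thesis by blast
    qed
  qed
  from this[of n] obtain z where z: "\<Psi> z = \<Psi> y" "ip n z z = ip n y y"
      "\<And>l. 1 \<le> l \<Longrightarrow> l < n \<Longrightarrow> z l = 0" "0 \<le> z 0"
    using assms(1) by auto
  have "ip n z z = (\<Sum>i<n. if i = 0 then (z 0)\<^sup>2 else 0)"
    unfolding ip_def using z(3) by (intro sum.cong) (auto simp: power2_eq_square)
  also have "\<dots> = (z 0)\<^sup>2"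
    using assms(1) by simp
  finally have z0: "z 0 = sqrt (ip n y y)"
    using z by (metis abs_of_nonneg real_sqrt_abs)
  have "z i = sqrt (ip n y y) * unit_vec 0 i" if "i < n" for i
    using z(3)[of i] z0 that by (cases "i = 0") (auto simp: unit_vec_def)
  then show ?thesis
    using cong[of z "\<lambda>i. sqrt (ip n y y) * unit_vec 0 i"] z(1) by simp
qed

lemma sqrt_ip_triangle:
  "sqrt (ip n (\<lambda>i. x i + y i) (\<lambda>i. x i + y i)) \<le> sqrt (ip n x x) + sqrt (ip n y y)"
  using L2_set_triangle_ineq[of x y "{..<n}"] by (simp add: L2_set_def ip_def power2_eq_square)

lemma ip_le_sqrt: "\<bar>ip n x y\<bar> \<le> sqrt (ip n x x) * sqrt (ip n y y)"
proof -
  have "\<bar>ip n x y\<bar> \<le> (\<Sum>i<n. \<bar>x i\<bar> * \<bar>y i\<bar>)"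
    unfolding ip_def by (intro order.trans[OF sum_abs]) (simp add: abs_mult)
  also have "\<dots> \<le> L2_set x {..<n} * L2_set y {..<n}"
    by (rule L2_set_mult_ineq)
  finally show ?thesis by (simp add: L2_set_def ip_def power2_eq_square)
qed

lemma sqrt_ip_scale: "sqrt (ip n (\<lambda>i. c * x i) (\<lambda>i. c * x i)) = \<bar>c\<bar> * sqrt (ip n x x)"
proof -
  have "ip n (\<lambda>i. c * x i) (\<lambda>i. c * x i) = c\<^sup>2 * ip n x x"
    by (simp add: ip_scale_left ip_scale_right power2_eq_square)
  then show ?thesis by (simp add: real_sqrt_mult)
qed

section \<open>Standard Gaussian product measures\<close>

abbreviation stdN :: "real measure" where
  "stdN \<equiv> density lborel std_normal_density"

definition gauss :: "'a set \<Rightarrow> ('a \<Rightarrow> real) measure" where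
  "gauss I = PiM I (\<lambda>_. stdN)"

lemma prob_space_stdN: "prob_space stdN"
  by (rule prob_space_normal_density) simp

interpretation stdN: product_sigma_finite "\<lambda>_. stdN"
  unfolding product_sigma_finite_def
  using prob_space_stdN prob_space_imp_sigma_finite by blast

lemma prob_space_gauss: "prob_space (gauss I)"
  unfolding gauss_def by (intro prob_space_PiM prob_space_stdN)

lemma sigma_finite_gauss: "sigma_finite_measure (gauss I)"
  using prob_space_gauss prob_space_imp_sigma_finite by blast

lemma pair_sigma_finite_gauss: "pair_sigma_finite (gauss I) (gauss J)"
  by (intro pair_sigma_finite.intro sigma_finite_gauss)

lemma sets_gauss [measurable_cong]: "sets (gauss I) = sets (PiM I (\<lambda>_. borel))"
  unfolding gauss_def by (intro sets_PiM_cong) simp_all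

lemma space_gauss: "space (gauss I) = PiE I (\<lambda>_. UNIV)"
  by (simp add: gauss_def space_PiM)

lemma gauss_mat_eq: "gauss_mat m n = gauss ({..<m} \<times> {..<n})"
  by (simp add: gauss_mat_def gauss_def)

lemma measurable_gauss_component [measurable]: "i \<in> I \<Longrightarrow> (\<lambda>x. x i) \<in> borel_measurable (gauss I)"
  by measurable

lemma emeasure_space_gauss [simp]: "emeasure (gauss I) (space (gauss I)) = 1"
  by (rule prob_space.emeasure_space_1[OF prob_space_gauss])

lemma nn_integral_const_gauss [simp]: "(\<integral>\<^sup>+x. c \<partial>gauss I) = c"
  by simp

lemma nn_integral_gauss_insert:
  assumes "finite I" "i \<notin> I" "f \<in> borel_measurable (gauss (insert i I))"
  shows "(\<integral>\<^sup>+x. f x \<partial>gauss (insert i I)) = (\<integral>\<^sup>+x. \<integral>\<^sup>+y. f (x(i := y)) \<partial>stdN \<partial>gauss I)"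
  using stdN.product_nn_integral_insert[OF assms(1,2)] assms(3) unfolding gauss_def by simp

lemma nn_integral_gauss_insert_rev:
  assumes "finite I" "i \<notin> I" "f \<in> borel_measurable (gauss (insert i I))"
  shows "(\<integral>\<^sup>+x. f x \<partial>gauss (insert i I)) = (\<integral>\<^sup>+y. \<integral>\<^sup>+x. f (x(i := y)) \<partial>gauss I \<partial>stdN)"
  using stdN.product_nn_integral_insert_rev[OF assms(1,2)] assms(3) unfolding gauss_def by simp

lemma measurable_gauss_upd:
  "(\<lambda>z. (fst z)(i := snd z)) \<in> measurable (gauss I \<Otimes>\<^sub>M borel) (gauss (insert i I))"
  unfolding measurable_cong_sets[OF refl sets_gauss] by measurable

lemma borel_measurable_nn_integral_gauss_upd:
  assumes "f \<in> borel_measurable (gauss (insert i I))"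
  shows "(\<lambda>x. \<integral>\<^sup>+y. f (x(i := y)) \<partial>stdN) \<in> borel_measurable (gauss I)"
proof -
  have s: "sets (gauss I \<Otimes>\<^sub>M stdN) = sets (gauss I \<Otimes>\<^sub>M borel)"
    by (intro sets_pair_measure_cong) simp_all
  have "(\<lambda>z. f ((fst z)(i := snd z))) \<in> borel_measurable (gauss I \<Otimes>\<^sub>M stdN)"
    using measurable_compose[OF measurable_gauss_upd assms] measurable_cong_sets[OF s refl] by blast
  from sigma_finite_measure.borel_measurable_nn_integral_fst[OF
      prob_space_imp_sigma_finite[OF prob_space_stdN] this]
  show ?thesis by simp
qed

lemma nn_integral_gauss_component:
  assumes "finite I" "i \<in> I" "f \<in> borel_measurable borel"
  shows "(\<integral>\<^sup>+x. f (x i) \<partial>gauss I) = (\<integral>\<^sup>+y. f y \<partial>stdN)"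
proof -
  have I: "insert i (I - {i}) = I" using assms by auto
  have "(\<integral>\<^sup>+x. f (x i) \<partial>gauss I) = (\<integral>\<^sup>+y. \<integral>\<^sup>+x. f ((x(i := y)) i) \<partial>gauss (I - {i}) \<partial>stdN)"
    using assms by (subst nn_integral_gauss_insert_rev[of "I - {i}" i, unfolded I]) auto
  then show ?thesis by simp
qed

section \<open>Rotation invariance\<close>

text \<open>Two one-dimensional affine substitutions: for fixed b put t = c * a - s * b, which makes
  the second argument (s * t + b) / c; then, after Fubini, substitute for b with t fixed. The
  Jacobians \<bar>c\<bar> and \<bar>1 / c\<bar> cancel, and both steps need
  \<open>c \<noteq> 0\<close>.\<close>

lemma nn_integral_lborel_rotate:
  fixes H :: "real \<Rightarrow> real \<Rightarrow> ennreal"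
  assumes [measurable]: "case_prod H \<in> borel_measurable (borel \<Otimes>\<^sub>M borel)"
    and cs: "c\<^sup>2 + s\<^sup>2 = 1" and c: "c \<noteq> 0"
  shows "(\<integral>\<^sup>+b. \<integral>\<^sup>+a. H (c * a - s * b) (s * a + c * b) \<partial>lborel \<partial>lborel) =
    (\<integral>\<^sup>+x. \<integral>\<^sup>+y. H x y \<partial>lborel \<partial>lborel)"
proof -
  have A: "(\<integral>\<^sup>+t. H t ((s * t + b) / c) \<partial>lborel) = \<bar>c\<bar> * (\<integral>\<^sup>+a. H (c * a - s * b) (s * a + c * b) \<partial>lborel)" for b
  proof -
    have 1: "(s * (- s * b + c * a) + b) / c = s * a + c * b" for a
    proof -
      have "s * (- s * b + c * a) + b = c * (s * a) + (1 - s\<^sup>2) * b"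
        by (simp add: algebra_simps power2_eq_square)
      also have "1 - s\<^sup>2 = c\<^sup>2" using cs by simp
      finally show ?thesis using c by (simp add: field_simps power2_eq_square)
    qed
    have "(\<integral>\<^sup>+t. H t ((s * t + b) / c) \<partial>lborel) =
      \<bar>c\<bar> * (\<integral>\<^sup>+a. H (- s * b + c * a) ((s * (- s * b + c * a) + b) / c) \<partial>lborel)"
      by (rule nn_integral_real_affine[OF _ c]) measurable
    then show ?thesis unfolding 1 by (simp add: algebra_simps)
  qed
  have B: "(\<integral>\<^sup>+y. H t y \<partial>lborel) = \<bar>1 / c\<bar> * (\<integral>\<^sup>+b. H t ((s * t + b) / c) \<partial>lborel)" for t
  proof -
    have "(\<integral>\<^sup>+y. H t y \<partial>lborel) = \<bar>1 / c\<bar> * (\<integral>\<^sup>+b. H t (s * t / c + 1 / c * b) \<partial>lborel)"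
    proof (rule nn_integral_real_affine)
      show "H t \<in> borel_measurable borel" by measurable
    qed (use c in simp)
    then show ?thesis by (simp add: add_divide_distrib)
  qed
  have "(\<integral>\<^sup>+x. \<integral>\<^sup>+y. H x y \<partial>lborel \<partial>lborel) =
      \<bar>1 / c\<bar> * (\<integral>\<^sup>+t. \<integral>\<^sup>+b. H t ((s * t + b) / c) \<partial>lborel \<partial>lborel)"
    unfolding B by (rule nn_integral_cmult) measurable
  also have "(\<integral>\<^sup>+t. \<integral>\<^sup>+b. H t ((s * t + b) / c) \<partial>lborel \<partial>lborel) =
      (\<integral>\<^sup>+b. \<integral>\<^sup>+t. H t ((s * t + b) / c) \<partial>lborel \<partial>lborel)"
    by (rule lborel_pair.Fubini') measurable
  also have "\<dots> = \<bar>c\<bar> * (\<integral>\<^sup>+b. \<integral>\<^sup>+a. H (c * a - s * b) (s * a + c * b) \<partial>lborel \<partial>lborel)"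
    unfolding A by (rule nn_integral_cmult) measurable
  finally show ?thesis
    using c by (simp add: mult.assoc[symmetric] ennreal_mult''[symmetric])
qed

text \<open>The product density depends on the sum of squares only, so it is constant along the
  rotation.\<close>

lemma nn_integral_stdN_rotate:
  fixes f :: "real \<Rightarrow> real \<Rightarrow> ennreal"
  assumes f[measurable]: "case_prod f \<in> borel_measurable (borel \<Otimes>\<^sub>M borel)"
    and cs: "c\<^sup>2 + s\<^sup>2 = 1"
  shows "(\<integral>\<^sup>+b. \<integral>\<^sup>+a. f (c * a - s * b) (s * a + c * b) \<partial>stdN \<partial>stdN) =
    (\<integral>\<^sup>+b. \<integral>\<^sup>+a. f a b \<partial>stdN \<partial>stdN)"
proof -
  let ?\<rho> = "std_normal_density"
  have main: "(\<integral>\<^sup>+b. \<integral>\<^sup>+a. f (c * a - s * b) (s * a + c * b) \<partial>stdN \<partial>stdN) =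
    (\<integral>\<^sup>+b. \<integral>\<^sup>+a. f a b \<partial>stdN \<partial>stdN)"
    if [measurable]: "case_prod f \<in> borel_measurable (borel \<Otimes>\<^sub>M borel)" and cs: "c\<^sup>2 + s\<^sup>2 = 1" and c: "c \<noteq> 0"
    for f and c s :: real
  proof -
    have unf: "(\<integral>\<^sup>+b. \<integral>\<^sup>+a. g a b \<partial>stdN \<partial>stdN) = (\<integral>\<^sup>+b. \<integral>\<^sup>+a. ennreal (?\<rho> a * ?\<rho> b) * g a b \<partial>lborel \<partial>lborel)"
      if [measurable]: "case_prod g \<in> borel_measurable (borel \<Otimes>\<^sub>M borel)" for g :: "real \<Rightarrow> real \<Rightarrow> ennreal"
      by (simp add: nn_integral_density nn_integral_cmult[symmetric] ennreal_mult mult_ac)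
    have dens: "?\<rho> (c * a - s * b) * ?\<rho> (s * a + c * b) = ?\<rho> a * ?\<rho> b" for a b
    proof -
      have "(c * a - s * b)\<^sup>2 + (s * a + c * b)\<^sup>2 = (c\<^sup>2 + s\<^sup>2) * (a\<^sup>2 + b\<^sup>2)"
        by (simp add: algebra_simps power2_eq_square)
      then have "(c * a - s * b)\<^sup>2 + (s * a + c * b)\<^sup>2 = a\<^sup>2 + b\<^sup>2" by (simp add: cs)
      then have "exp (- (c * a - s * b)\<^sup>2 / 2) * exp (- (s * a + c * b)\<^sup>2 / 2) = exp (- a\<^sup>2 / 2) * exp (- b\<^sup>2 / 2)"
        by (simp add: exp_add[symmetric] field_simps)
      then show ?thesis by (simp add: std_normal_density_def)
    qed
    have "(\<integral>\<^sup>+b. \<integral>\<^sup>+a. f (c * a - s * b) (s * a + c * b) \<partial>stdN \<partial>stdN) =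
      (\<integral>\<^sup>+b. \<integral>\<^sup>+a. ennreal (?\<rho> (c * a - s * b) * ?\<rho> (s * a + c * b)) * f (c * a - s * b) (s * a + c * b) \<partial>lborel \<partial>lborel)"
      unfolding dens by (rule unf) measurable
    also have "\<dots> = (\<integral>\<^sup>+x. \<integral>\<^sup>+y. ennreal (?\<rho> x * ?\<rho> y) * f x y \<partial>lborel \<partial>lborel)"
      by (rule nn_integral_lborel_rotate[OF _ cs c]) measurable
    also have "\<dots> = (\<integral>\<^sup>+y. \<integral>\<^sup>+x. ennreal (?\<rho> x * ?\<rho> y) * f x y \<partial>lborel \<partial>lborel)"
      by (rule lborel_pair.Fubini'[symmetric]) measurable
    also have "\<dots> = (\<integral>\<^sup>+b. \<integral>\<^sup>+a. f a b \<partial>stdN \<partial>stdN)"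
      by (rule unf[symmetric]) measurable
    finally show ?thesis .
  qed
  show ?thesis
  proof (cases "c = 0")
    case False then show ?thesis using main[OF f cs] by simp
  next
    case True
    text \<open>A quarter turn is the square of an eighth turn.\<close>
    then have s: "s * s = 1" using cs by (simp add: power2_eq_square)
    define c' where "c' = 1 / sqrt (2::real)"
    have c': "c' * c' = 1 / 2" "c' \<noteq> 0" by (simp_all add: c'_def)
    have cs': "c'\<^sup>2 + (s * c')\<^sup>2 = 1"
      using s c' by (simp add: power_mult_distrib) (simp add: power2_eq_square)
    define f' where "f' x y = f (c' * x - s * c' * y) (s * c' * x + c' * y)" for x y
    have [measurable]: "case_prod f' \<in> borel_measurable (borel \<Otimes>\<^sub>M borel)"
      unfolding f'_def by measurable
    have e1: "c' * (c' * a - s * c' * b) - s * c' * (s * c' * a + c' * b) = - s * b" for a b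
    proof -
      have "c' * (c' * a - s * c' * b) - s * c' * (s * c' * a + c' * b) = (c' * c') * ((1 - s * s) * a - 2 * s * b)"
        by (simp add: algebra_simps)
      then show ?thesis using s c' by simp
    qed
    have e2: "s * c' * (c' * a - s * c' * b) + c' * (s * c' * a + c' * b) = s * a" for a b
    proof -
      have "s * c' * (c' * a - s * c' * b) + c' * (s * c' * a + c' * b) = (c' * c') * ((1 - s * s) * b + 2 * s * a)"
        by (simp add: algebra_simps)
      then show ?thesis using s c' by simp
    qed
    have "(\<integral>\<^sup>+b. \<integral>\<^sup>+a. f (c * a - s * b) (s * a + c * b) \<partial>stdN \<partial>stdN) =
      (\<integral>\<^sup>+b. \<integral>\<^sup>+a. f' (c' * a - s * c' * b) (s * c' * a + c' * b) \<partial>stdN \<partial>stdN)"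
      unfolding f'_def e1 e2 by (simp add: True)
    also have "\<dots> = (\<integral>\<^sup>+b. \<integral>\<^sup>+a. f' a b \<partial>stdN \<partial>stdN)"
      by (rule main[OF _ cs' c'(2)]) measurable
    also have "\<dots> = (\<integral>\<^sup>+b. \<integral>\<^sup>+a. f a b \<partial>stdN \<partial>stdN)"
      unfolding f'_def by (rule main[OF _ cs' c'(2)]) measurable
    finally show ?thesis .
  qed
qed

lemma measurable_givens [measurable]:
  assumes "j \<in> I" "k \<in> I"
  shows "givens j k c s \<in> measurable (gauss I) (gauss I)"
proof -
  have "givens j k c s \<in> measurable (gauss I) (PiM I (\<lambda>_. borel))"
  proof (rule measurable_PiM_single')
    fix i assume "i \<in> I"
    show "(\<lambda>\<omega>. givens j k c s \<omega> i) \<in> borel_measurable (gauss I)"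
    proof -
      have "(\<lambda>\<omega>. \<omega> i) \<in> borel_measurable (gauss I)" by (rule measurable_gauss_component) fact
      moreover have "(\<lambda>\<omega>. givens j k c s \<omega> i) =
        (if i = k then (\<lambda>\<omega>. s * \<omega> j + c * \<omega> k) else if i = j then (\<lambda>\<omega>. c * \<omega> j - s * \<omega> k) else (\<lambda>\<omega>. \<omega> i))"
        by (auto simp: givens_def)
      moreover have "(\<lambda>\<omega>. s * \<omega> j + c * \<omega> k) \<in> borel_measurable (gauss I)" "(\<lambda>\<omega>. c * \<omega> j - s * \<omega> k) \<in> borel_measurable (gauss I)"
        using assms by measurable
      ultimately show ?thesis by presburger
    qed
  next
    show "givens j k c s \<in> space (gauss I) \<rightarrow> I \<rightarrow>\<^sub>E space borel"
      unfolding givens_def space_gauss using assms by (auto simp: PiE_iff extensional_def)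
  qed
  then show ?thesis by (simp add: measurable_cong_sets[OF refl sets_gauss])
qed

lemma nn_integral_gauss_givens:
  assumes "finite I" "j \<in> I" "k \<in> I" "j \<noteq> k" and cs: "c\<^sup>2 + s\<^sup>2 = 1"
    and f[measurable]: "f \<in> borel_measurable (gauss I)"
  shows "(\<integral>\<^sup>+x. f (givens j k c s x) \<partial>gauss I) = (\<integral>\<^sup>+x. f x \<partial>gauss I)"
proof -
  define J where "J = I - {j,k}"
  have I: "I = insert j (insert k J)" "j \<notin> insert k J" "k \<notin> J" "finite J"
    using assms by (auto simp: J_def)
  have [measurable]: "j \<in> I" "k \<in> I" by fact+
  have ins: "(\<integral>\<^sup>+x. g x \<partial>gauss I) = (\<integral>\<^sup>+x. \<integral>\<^sup>+b. \<integral>\<^sup>+a. g (x(k := b, j := a)) \<partial>stdN \<partial>stdN \<partial>gauss J)"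
    if g[measurable]: "g \<in> borel_measurable (gauss I)" for g
  proof -
    have m: "(\<lambda>x. \<integral>\<^sup>+a. g (x(j := a)) \<partial>stdN) \<in> borel_measurable (gauss (insert k J))"
      using g unfolding I(1) by (rule borel_measurable_nn_integral_gauss_upd)
    show ?thesis
      using g I m
      by (simp add: nn_integral_gauss_insert)
  qed
  have giv: "givens j k c s (x(k := b, j := a)) = x(k := s * a + c * b, j := c * a - s * b)" for x a b
    using assms(4) by (auto simp: givens_def)
  have m2: "(\<lambda>(a, b). f (x(k := b, j := a))) \<in> borel_measurable (borel \<Otimes>\<^sub>M borel)" if "x \<in> space (gauss J)" for x
  proof -
    have "(\<lambda>p. x(k := snd p, j := fst p)) \<in> measurable (borel \<Otimes>\<^sub>M borel) (PiM I (\<lambda>_. borel))"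
    proof (rule measurable_PiM_single')
      fix i assume "i \<in> I"
      show "(\<lambda>p. (x(k := snd p, j := fst p)) i) \<in> borel_measurable (borel \<Otimes>\<^sub>M borel)"
        by (cases "i = j"; cases "i = k") auto
    next
      show "(\<lambda>p. x(k := snd p, j := fst p)) \<in> space (borel \<Otimes>\<^sub>M borel) \<rightarrow> I \<rightarrow>\<^sub>E space borel"
        using that by (auto simp: I space_gauss PiE_iff extensional_def)
    qed
    then have "(\<lambda>p. x(k := snd p, j := fst p)) \<in> measurable (borel \<Otimes>\<^sub>M borel) (gauss I)"
      by (simp add: measurable_cong_sets[OF refl sets_gauss])
    from measurable_compose[OF this f] show ?thesis by (simp add: case_prod_unfold)
  qed
  have "(\<integral>\<^sup>+x. f (givens j k c s x) \<partial>gauss I) =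
     (\<integral>\<^sup>+x. \<integral>\<^sup>+b. \<integral>\<^sup>+a. f (x(k := s * a + c * b, j := c * a - s * b)) \<partial>stdN \<partial>stdN \<partial>gauss J)"
    by (subst ins) (simp_all add: giv)
  also have "\<dots> = (\<integral>\<^sup>+x. \<integral>\<^sup>+b. \<integral>\<^sup>+a. f (x(k := b, j := a)) \<partial>stdN \<partial>stdN \<partial>gauss J)"
    by (intro nn_integral_cong nn_integral_stdN_rotate[OF m2 cs])
  also have "\<dots> = (\<integral>\<^sup>+x. f x \<partial>gauss I)"
    by (rule ins[symmetric, OF f])
  finally show ?thesis .
qed

section \<open>Translation of Gaussian measures\<close>

lemma nn_integral_stdN_shift:
  assumes [measurable]: "f \<in> borel_measurable borel"
  shows "(\<integral>\<^sup>+x. f x \<partial>stdN) = (\<integral>\<^sup>+x. f (x + a) * ennreal (exp (- a * x - a\<^sup>2 / 2)) \<partial>stdN)"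
proof -
  have d: "std_normal_density (a + x) = std_normal_density x * exp (- a * x - a\<^sup>2 / 2)" for x
    by (simp add: std_normal_density_def exp_add[symmetric] power2_sum field_simps)
  have "(\<integral>\<^sup>+x. f x \<partial>stdN) = (\<integral>\<^sup>+x. ennreal (std_normal_density x) * f x \<partial>lborel)"
    by (simp add: nn_integral_density)
  also have "\<dots> = (\<integral>\<^sup>+x. ennreal (std_normal_density (a + x)) * f (a + x) \<partial>lborel)"
    by (subst nn_integral_real_affine[where c=1 and t=a]) auto
  also have "\<dots> = (\<integral>\<^sup>+x. f (x + a) * ennreal (exp (- a * x - a\<^sup>2 / 2)) \<partial>stdN)"
    unfolding d by (simp add: nn_integral_density ennreal_mult mult_ac add.commute)
  finally show ?thesis .
qed

lemma measurable_gauss_shift [measurable]: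
  "(\<lambda>x. \<lambda>i\<in>I. x i + a i) \<in> measurable (gauss I) (gauss I)"
proof -
  have "(\<lambda>x. \<lambda>i\<in>I. x i + a i) \<in> measurable (gauss I) (PiM I (\<lambda>_. borel))"
    by measurable
  then show ?thesis by (simp add: measurable_cong_sets[OF refl sets_gauss])
qed

lemma measurable_gauss_exp:
  "(\<lambda>x. ennreal (exp (\<Sum>i\<in>I. - a i * x i - (a i)\<^sup>2 / 2))) \<in> borel_measurable (gauss I)"
proof -
  have "(\<lambda>x. \<Sum>i\<in>I. - a i * x i - (a i)\<^sup>2 / 2) \<in> borel_measurable (gauss I)"
    by (rule borel_measurable_sum) measurable
  then show ?thesis by simp
qed

text \<open>The finite-dimensional Cameron-Martin formula. With the density explicit, a lower bound
  for it on an event bounds the probability of the translated event from below.\<close>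

lemma nn_integral_gauss_shift:
  assumes "finite I" "f \<in> borel_measurable (gauss I)"
  shows "(\<integral>\<^sup>+x. f x \<partial>gauss I) =
    (\<integral>\<^sup>+x. f (\<lambda>i\<in>I. x i + a i) * ennreal (exp (\<Sum>i\<in>I. - a i * x i - (a i)\<^sup>2 / 2)) \<partial>gauss I)"
  using assms
proof (induction I arbitrary: f rule: finite_induct)
  case empty
  have "restrict y {} = x" if "x \<in> space (gauss {})" for x y :: "'a \<Rightarrow> real"
    using that by (auto simp: space_gauss)
  then show ?case by (intro nn_integral_cong) simp
next
  case (insert i I)
  note f = insert.prems
  have m2: "(\<lambda>y. f (x(i := y))) \<in> borel_measurable borel" if "x \<in> space (gauss I)" for x
    using measurable_compose[OF measurable_compose[OF measurable_Pair1'[OF that] measurable_gauss_upd] f] by (simp add: fun_upd_def)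
  have sum: "(\<Sum>l\<in>I. - a l * (x(i := y)) l - (a l)\<^sup>2 / 2) = (\<Sum>l\<in>I. - a l * x l - (a l)\<^sup>2 / 2)" for x y
    using insert by (intro sum.cong) auto
  have res: "(\<lambda>l\<in>insert i I. (x(i := y)) l + a l) = (\<lambda>l\<in>I. x l + a l)(i := y + a i)" for x :: "'a \<Rightarrow> real" and y :: real
    using insert by auto
  let ?E = "\<lambda>x. ennreal (exp (\<Sum>l\<in>I. - a l * x l - (a l)\<^sup>2 / 2))"
  let ?e = "\<lambda>y. ennreal (exp (- a i * y - (a i)\<^sup>2 / 2))"
  have pt: "f (\<lambda>l\<in>insert i I. (x(i := y)) l + a l) *
      ennreal (exp (\<Sum>l\<in>insert i I. - a l * (x(i := y)) l - (a l)\<^sup>2 / 2)) =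
      f ((\<lambda>l\<in>I. x l + a l)(i := y + a i)) * ?e y * ?E x" for x y
  proof -
    have "(\<Sum>l\<in>insert i I. - a l * (x(i := y)) l - (a l)\<^sup>2 / 2) =
      (- a i * y - (a i)\<^sup>2 / 2) + (\<Sum>l\<in>I. - a l * x l - (a l)\<^sup>2 / 2)"
      unfolding sum[of x y, symmetric] using insert.hyps by simp
    then show ?thesis
      unfolding res by (simp only: exp_add ennreal_mult[OF exp_ge_zero exp_ge_zero] mult.assoc)
  qed
  have "(\<integral>\<^sup>+x. f (\<lambda>l\<in>insert i I. x l + a l) * ennreal (exp (\<Sum>l\<in>insert i I. - a l * x l - (a l)\<^sup>2 / 2)) \<partial>gauss (insert i I))
    = (\<integral>\<^sup>+x. \<integral>\<^sup>+y. f ((\<lambda>l\<in>I. x l + a l)(i := y + a i)) * ?e y * ?E x \<partial>stdN \<partial>gauss I)"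
    by (subst nn_integral_gauss_insert[OF insert.hyps borel_measurable_times_ennreal[OF
          measurable_compose[OF measurable_gauss_shift f] measurable_gauss_exp]]) (intro nn_integral_cong pt)
  also have "\<dots> = (\<integral>\<^sup>+x. (\<integral>\<^sup>+y. f ((\<lambda>l\<in>I. x l + a l)(i := y + a i)) * ?e y \<partial>stdN) * ?E x \<partial>gauss I)"
  proof (intro nn_integral_cong nn_integral_multc)
    fix x assume "x \<in> space (gauss I)"
    note m2[OF measurable_space[OF measurable_gauss_shift this]]
    then have "(\<lambda>y. f ((\<lambda>l\<in>I. x l + a l)(i := y + a i))) \<in> borel_measurable borel"
      by (rule measurable_compose[rotated]) simp
    then show "(\<lambda>y. f ((\<lambda>l\<in>I. x l + a l)(i := y + a i)) * ?e y) \<in> borel_measurable stdN"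
      by (intro borel_measurable_times_ennreal) simp_all
  qed
  also have "\<dots> = (\<integral>\<^sup>+x. (\<integral>\<^sup>+y. f ((\<lambda>l\<in>I. x l + a l)(i := y)) \<partial>stdN) * ?E x \<partial>gauss I)"
    using m2[OF measurable_space[OF measurable_gauss_shift]]
    by (intro nn_integral_cong arg_cong2[where f="(*)"] nn_integral_stdN_shift[symmetric] refl) auto
  also have "\<dots> = (\<integral>\<^sup>+x. (\<integral>\<^sup>+y. f (x(i := y)) \<partial>stdN) \<partial>gauss I)"
  by (rule insert.IH[symmetric, OF borel_measurable_nn_integral_gauss_upd[OF f]])
  also have "\<dots> = (\<integral>\<^sup>+x. f x \<partial>gauss (insert i I))"
    by (rule nn_integral_gauss_insert[symmetric, OF insert.hyps f])
  finally show ?case by (rule sym)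
qed

lemma nn_integral_stdN_square: "(\<integral>\<^sup>+x. ennreal (x\<^sup>2) \<partial>stdN) = 1"
proof -
  have "has_bochner_integral lborel (\<lambda>x. std_normal_density x * x\<^sup>2) 1"
    using std_normal_moment_even[of 1] by simp
  then have "(\<integral>\<^sup>+x. ennreal (std_normal_density x * x\<^sup>2) \<partial>lborel) = ennreal 1"
    by (intro nn_integral_eq_integral[THEN trans]) (auto simp: has_bochner_integral_iff)
  then show ?thesis by (simp add: nn_integral_density ennreal_mult)
qed

section \<open>Projections of Gaussian vectors\<close>

lemma sets_Collect_le_const:
  fixes u :: "'a \<Rightarrow> real"
  assumes "u \<in> borel_measurable M"
  shows "{x \<in> space M. u x \<le> c} \<in> sets M"
  using assms by measurable

lemma sets_Collect_eq_0:
  fixes u :: "'a \<Rightarrow> real"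
  assumes "u \<in> borel_measurable M"
  shows "{x \<in> space M. u x = 0} \<in> sets M"
  using assms by measurable

lemma sets_Collect_ne_0:
  fixes u :: "'a \<Rightarrow> real"
  assumes "u \<in> borel_measurable M"
  shows "{x \<in> space M. u x \<noteq> 0} \<in> sets M"
  using assms by measurable

lemma measurable_ip:
  assumes "\<And>i. i < n \<Longrightarrow> (\<lambda>\<omega>. x \<omega> i) \<in> borel_measurable M"
    "\<And>i. i < n \<Longrightarrow> (\<lambda>\<omega>. y \<omega> i) \<in> borel_measurable M"
  shows "(\<lambda>\<omega>. ip n (x \<omega>) (y \<omega>)) \<in> borel_measurable M"
  unfolding ip_def by (intro borel_measurable_sum borel_measurable_times assms) simp_all

lemma measurable_oproj:
  assumes "\<And>j i. j < k \<Longrightarrow> i < n \<Longrightarrow> (\<lambda>\<omega>. a \<omega> j i) \<in> borel_measurable M"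
    "\<And>i. i < n \<Longrightarrow> (\<lambda>\<omega>. x \<omega> i) \<in> borel_measurable M" "i < n"
  shows "(\<lambda>\<omega>. oproj n (a \<omega>) k (x \<omega>) i) \<in> borel_measurable M"
  using assms
proof (induction k arbitrary: x i)
  case 0
  show ?case unfolding oproj.simps by (rule 0(2)[OF 0(3)])
next
  case (Suc k)
  note a = Suc.prems(1) and x = Suc.prems(2) and i = Suc.prems(3)
  have 1: "(\<lambda>\<omega>. oproj n (a \<omega>) k (x \<omega>) l) \<in> borel_measurable M" if "l < n" for l
    by (rule Suc.IH[OF a x that]) simp_all
  have 2: "(\<lambda>\<omega>. oproj n (a \<omega>) k (a \<omega> k) l) \<in> borel_measurable M" if "l < n" for l
    by (rule Suc.IH[OF a a that]) simp_all
  show ?case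
    unfolding oproj.simps
    by (intro borel_measurable_diff borel_measurable_times borel_measurable_divide measurable_ip 1 2 i)
qed

lemma measurable_gvec: "i < n \<Longrightarrow> (\<lambda>g. g i) \<in> borel_measurable (gauss {..<n})"
  by (rule measurable_gauss_component) simp

lemma measurable_gmat: "i < m \<Longrightarrow> j < n \<Longrightarrow> (\<lambda>A. A (i, j)) \<in> borel_measurable (gauss ({..<m} \<times> {..<n}))"
  by (rule measurable_gauss_component) simp

text \<open>Rotating \<open>g\<close> and \<open>y\<close> together reduces the claim to the second
  moment of a single coordinate, so no cross terms have to be integrated.\<close>

lemma nn_integral_ip_square:
  assumes "2 \<le> n"
  shows "(\<integral>\<^sup>+g. ennreal ((ip n g y)\<^sup>2) \<partial>gauss {..<n}) = ennreal (ip n y y)"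
proof -
  define \<Psi> where "\<Psi> y = (\<integral>\<^sup>+g. ennreal ((ip n g y)\<^sup>2) \<partial>gauss {..<n})" for y
  have m: "(\<lambda>g. ennreal ((ip n g y)\<^sup>2)) \<in> borel_measurable (gauss {..<n})" for y
    by (intro measurable_compose[OF _ measurable_ennreal] borel_measurable_power measurable_ip measurable_gvec) simp_all
  have "\<Psi> y = \<Psi> (\<lambda>i. sqrt (ip n y y) * unit_vec 0 i)"
  proof (rule givens_invariant_imp[OF assms])
    fix j k c s y assume jk: "j \<noteq> k" "j < n" "k < n" and cs: "c\<^sup>2 + s\<^sup>2 = (1::real)"
    have "\<Psi> (givens j k c s y) = (\<integral>\<^sup>+g. ennreal ((ip n (givens j k c s g) (givens j k c s y))\<^sup>2) \<partial>gauss {..<n})"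
      unfolding \<Psi>_def by (rule nn_integral_gauss_givens[OF _ _ _ jk(1) cs m, symmetric]) (use jk in simp_all)
    then show "\<Psi> (givens j k c s y) = \<Psi> y"
      by (simp add: \<Psi>_def ip_givens[OF jk cs])
  next
    fix y y' :: "nat \<Rightarrow> real" assume "\<And>i. i < n \<Longrightarrow> y i = y' i"
    then show "\<Psi> y = \<Psi> y'" unfolding \<Psi>_def by (simp cong: ip_cong)
  qed
  also have "\<dots> = (\<integral>\<^sup>+g. ennreal (ip n y y) * ennreal ((g 0)\<^sup>2) \<partial>gauss {..<n})"
    unfolding \<Psi>_def using assms
    by (simp add: ip_scale_right ip_unit_vec_right power_mult_distrib ennreal_mult)
  also have "\<dots> = ennreal (ip n y y) * (\<integral>\<^sup>+g. ennreal ((g 0)\<^sup>2) \<partial>gauss {..<n})"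
    using measurable_gvec[of 0 n] assms
    by (intro nn_integral_cmult measurable_compose[OF _ measurable_ennreal] borel_measurable_power) auto
  also have "(\<integral>\<^sup>+g. ennreal ((g 0)\<^sup>2) \<partial>gauss {..<n}) = (\<integral>\<^sup>+x. ennreal (x\<^sup>2) \<partial>stdN)"
    using assms by (intro nn_integral_gauss_component[where f="\<lambda>x. ennreal (x\<^sup>2)"]) auto
  finally show ?thesis by (simp add: \<Psi>_def nn_integral_stdN_square)
qed

text \<open>Self-adjointness turns coordinate i of the projection into an inner product of
  \<open>g\<close> with the projected unit vector; its second moment is the i-th diagonal entry, and
  these add up to the trace.\<close>

lemma nn_integral_oproj:
  assumes "2 \<le> n"
  shows "(\<integral>\<^sup>+g. ennreal (ip n (oproj n a k g) (oproj n a k g)) \<partial>gauss {..<n}) =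
    ennreal (\<Sum>i<n. oproj n a k (unit_vec i) i)"
proof -
  have m: "(\<lambda>g. ennreal ((ip n g y)\<^sup>2)) \<in> borel_measurable (gauss {..<n})" for y
    by (intro measurable_compose[OF _ measurable_ennreal] borel_measurable_power measurable_ip measurable_gvec) simp_all
  have "(\<integral>\<^sup>+g. ennreal (ip n (oproj n a k g) (oproj n a k g)) \<partial>gauss {..<n}) =
    (\<integral>\<^sup>+g. (\<Sum>i<n. ennreal ((ip n g (oproj n a k (unit_vec i)))\<^sup>2)) \<partial>gauss {..<n})"
    by (intro nn_integral_cong) (simp add: ip_def[of n "oproj n a k g" "oproj n a k g" for g] oproj_nth
        power2_eq_square)
  also have "\<dots> = (\<Sum>i<n. ennreal (ip n (oproj n a k (unit_vec i)) (oproj n a k (unit_vec i))))"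
    by (subst nn_integral_sum[OF m]) (simp add: nn_integral_ip_square[OF assms])
  also have "\<dots> = ennreal (\<Sum>i<n. ip n (oproj n a k (unit_vec i)) (oproj n a k (unit_vec i)))"
    by (rule sum_ennreal) simp
  also have "\<dots> = ennreal (\<Sum>i<n. oproj n a k (unit_vec i) i)"
    by (simp add: ip_oproj_unit_vec)
  finally show ?thesis .
qed

text \<open>Markov's inequality at four times the mean leaves probability at least 3/4. Besides the
  null space, the case \<open>k = 0\<close> is used to bound the length of a full Gaussian
  vector.\<close>

lemma emeasure_oproj_le:
  assumes "2 \<le> n" "(\<Sum>i<n. oproj n a k (unit_vec i) i) \<le> t" "0 < t"
  shows "ennreal (3/4) \<le> emeasure (gauss {..<n}) {g \<in> space (gauss {..<n}). ip n (oproj n a k g) (oproj n a k g) \<le> 4 * t}"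
proof -
  interpret prob_space "gauss {..<n}" by (rule prob_space_gauss)
  let ?u = "\<lambda>g. ip n (oproj n a k g) (oproj n a k g)"
  have m: "?u \<in> borel_measurable (gauss {..<n})"
    by (intro measurable_ip measurable_oproj measurable_gvec) simp_all
  let ?B = "{g \<in> space (gauss {..<n}). 1 \<le> ennreal (1 / (4 * t)) * ennreal (?u g)}"
  have B: "?B \<in> sets (gauss {..<n})"
    by (intro borel_measurable_le borel_measurable_times_ennreal measurable_compose[OF m measurable_ennreal]) simp_all
  have C: "{g \<in> space (gauss {..<n}). ?u g \<le> 4 * t} \<in> sets (gauss {..<n})"
    by (intro borel_measurable_le m) simp
  have "emeasure (gauss {..<n}) {g \<in> space (gauss {..<n}). 1 \<le> ennreal (1 / (4 * t)) * ennreal (?u g)}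
     \<le> ennreal (1 / (4 * t)) * (\<integral>\<^sup>+g. ennreal (?u g) * indicator (space (gauss {..<n})) g \<partial>gauss {..<n})"
    by (intro nn_integral_Markov_inequality borel_measurable_times_ennreal
        measurable_compose[OF m measurable_ennreal] borel_measurable_indicator sets.top)
  also have "(\<integral>\<^sup>+g. ennreal (?u g) * indicator (space (gauss {..<n})) g \<partial>gauss {..<n}) =
     ennreal (\<Sum>i<n. oproj n a k (unit_vec i) i)"
    unfolding nn_integral_oproj[OF assms(1), symmetric] by (intro nn_integral_cong) simp
  also have "ennreal (1 / (4 * t)) * \<dots> \<le> ennreal (1 / (4 * t)) * ennreal t"
    using assms by (intro mult_left_mono ennreal_leI) auto
  also have "\<dots> = ennreal (1/4)" using assms by (simp add: ennreal_mult'[symmetric])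
  finally have "prob ?B \<le> 1/4"
    by (simp add: emeasure_eq_measure)
  moreover have "space (gauss {..<n}) - {g \<in> space (gauss {..<n}). ?u g \<le> 4 * t} \<subseteq> ?B"
    using assms(3) by (auto simp: ennreal_mult'[symmetric])
  then have "prob (space (gauss {..<n}) - {g \<in> space (gauss {..<n}). ?u g \<le> 4 * t}) \<le> prob ?B"
    by (rule finite_measure_mono[OF _ B])
  ultimately have "3/4 \<le> prob {g \<in> space (gauss {..<n}). ?u g \<le> 4 * t}"
    unfolding prob_compl[OF C] by simp
  then show ?thesis by (simp add: emeasure_eq_measure)
qed

text \<open>Translating \<open>g\<close> by \<open>R * w\<close> moves its projection by exactly
  \<open>R * w\<close>, because \<open>w\<close> is a fixed point. So the event is a translate of
  the one in \<open>emeasure_oproj_le\<close>, and the price is the infimum of the Cameron-Martin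
  density there, which involves only the trace bound \<open>t\<close> and not
  \<open>n\<close>.\<close>

lemma emeasure_oproj_near:
  assumes "2 \<le> n" "(\<Sum>i<n. oproj n a k (unit_vec i) i) \<le> t" "0 < t" "0 \<le> R"
    and w: "oproj n a k w = w" "ip n w w = 1"
  shows "ennreal (3/4 * exp (- (2 * sqrt t * R + R\<^sup>2 / 2))) \<le>
    emeasure (gauss {..<n}) {g \<in> space (gauss {..<n}).
      ip n (\<lambda>i. oproj n a k g i - R * w i) (\<lambda>i. oproj n a k g i - R * w i) \<le> 4 * t}"
    (is "_ \<le> emeasure ?Y ?S")
proof -
  let ?Cen = "{g \<in> space ?Y. ip n (oproj n a k g) (oproj n a k g) \<le> 4 * t}"
  let ?e = "exp (- (2 * sqrt t * R + R\<^sup>2 / 2))"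
  let ?sh = "\<lambda>x. \<lambda>i\<in>{..<n}. x i + R * w i"
  have mm: "(\<lambda>g. oproj n a k g i) \<in> borel_measurable ?Y" if "i < n" for i
    by (intro measurable_oproj measurable_gvec that) simp_all
  have "(\<lambda>g. ip n (\<lambda>i. oproj n a k g i - R * w i) (\<lambda>i. oproj n a k g i - R * w i)) \<in> borel_measurable ?Y"
    by (intro measurable_ip borel_measurable_diff mm) simp_all
  then have S: "?S \<in> sets ?Y" by (rule sets_Collect_le_const)
  have "(\<lambda>g. ip n (oproj n a k g) (oproj n a k g)) \<in> borel_measurable ?Y"
    by (intro measurable_ip mm)
  then have S0: "?Cen \<in> sets ?Y" by (rule sets_Collect_le_const)
  have pt: "ennreal ?e * indicator ?Cen x \<le>
     indicator ?S (?sh x) * ennreal (exp (\<Sum>i<n. - (R * w i) * x i - (R * w i)\<^sup>2 / 2))" if x: "x \<in> space ?Y" for x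
  proof (cases "x \<in> ?Cen")
    case False then show ?thesis by simp
  next
    case True
    \<comment> \<open>The shifted vector is restricted to the index set, hence agreement only below
      \<open>n\<close>; the scalar is \<open>-R\<close> because linearity is available for
      differences.\<close>
    have "oproj n a k (?sh x) i = oproj n a k (\<lambda>i. x i - (-R) * w i) i" if "i < n" for i
      by (rule oproj_cong_lt) (use that in auto)
    then have "oproj n a k (?sh x) i = oproj n a k x i + R * w i" if "i < n" for i
      unfolding \<open>\<And>i. i < n \<Longrightarrow> oproj n a k (?sh x) i = oproj n a k (\<lambda>i. x i - (-R) * w i) i\<close>[OF that] oproj_diff_scale w
      by simp
    then have "ip n (\<lambda>i. oproj n a k (?sh x) i - R * w i) (\<lambda>i. oproj n a k (?sh x) i - R * w i) = ip n (oproj n a k x) (oproj n a k x)"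
      by (intro ip_cong) simp_all
    then have 1: "?sh x \<in> ?S"
      using True measurable_space[OF measurable_gauss_shift x] by simp
    \<comment> \<open>Only the projected part of \<open>x\<close> has a component along
      \<open>w\<close>, so its length, and not that of \<open>x\<close>, controls the
      density.\<close>
    have "ip n w x = ip n w (oproj n a k x)"
      by (metis oproj_self_adjoint w(1))
    also have "\<dots> \<le> sqrt (ip n w w) * sqrt (ip n (oproj n a k x) (oproj n a k x))"
      using ip_le_sqrt[of n w "oproj n a k x"] by simp
    also have "\<dots> \<le> sqrt (4 * t)" using True w by simp
    also have "\<dots> = 2 * sqrt t" by (simp add: real_sqrt_mult)
    finally have "R * ip n w x \<le> R * (2 * sqrt t)" using assms by (intro mult_left_mono)
    moreover have "(\<Sum>i<n. - (R * w i) * x i - (R * w i)\<^sup>2 / 2) = - R * ip n w x - R\<^sup>2 / 2 * ip n w w"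
      by (simp add: ip_def sum_subtractf sum_distrib_left sum_negf power2_eq_square algebra_simps)
    ultimately have "- (2 * sqrt t * R + R\<^sup>2 / 2) \<le> (\<Sum>i<n. - (R * w i) * x i - (R * w i)\<^sup>2 / 2)"
      using w by (simp add: algebra_simps)
    then show ?thesis using 1 True by (auto intro!: ennreal_leI simp: indicator_def)
  qed
  have "ennreal (3/4 * ?e) = ennreal ?e * ennreal (3/4)"
    by (simp add: ennreal_mult'[symmetric] mult.commute)
  also have "\<dots> \<le> ennreal ?e * emeasure ?Y ?Cen"
    by (intro mult_left_mono emeasure_oproj_le assms) auto
  also have "\<dots> = (\<integral>\<^sup>+x. ennreal ?e * indicator ?Cen x \<partial>?Y)"
    by (rule nn_integral_cmult_indicator[OF S0, symmetric])
  also have "\<dots> \<le> (\<integral>\<^sup>+x. indicator ?S (?sh x) * ennreal (exp (\<Sum>i<n. - (R * w i) * x i - (R * w i)\<^sup>2 / 2)) \<partial>?Y)"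
    by (intro nn_integral_mono pt)
  also have "\<dots> = (\<integral>\<^sup>+x. indicator ?S x \<partial>?Y)"
    by (rule nn_integral_gauss_shift[symmetric]) (simp, rule borel_measurable_indicator[OF S])
  also have "\<dots> = emeasure ?Y ?S" by (rule nn_integral_indicator[OF S])
  finally show ?thesis .
qed

section \<open>Almost sure independence of the rows\<close>

lemma emeasure_stdN_singleton: "emeasure stdN {t} = 0"
proof -
  have "AE x in lborel. x \<noteq> t" by (rule AE_lborel_singleton)
  then have "AE x in stdN. x \<noteq> t" by (subst AE_density) auto
  then show ?thesis by (subst (asm) AE_iff_measurable[OF _ refl]) auto
qed

text \<open>The first \<open>k\<close> projection steps ignore row \<open>k\<close>. With every
  other entry frozen, the inner product is affine in the entry (k, i), with slope
  \<open>oproj n (curry A) k (unit_vec i) i\<close>; if that is nonzero, only one value of the entry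
  is forbidden.\<close>

lemma AE_residue_ne_0_aux:
  assumes "k < m" "i < n"
  shows "AE A in gauss ({..<m} \<times> {..<n}).
    oproj n (curry A) k (unit_vec i) i \<noteq> 0 \<longrightarrow> ip n (curry A k) (oproj n (curry A) k (unit_vec i)) \<noteq> 0"
proof -
  let ?X = "gauss ({..<m} \<times> {..<n})"
  let ?y = "\<lambda>A. oproj n (curry A) k (unit_vec i)"
  let ?P = "\<lambda>A. ?y A i \<noteq> 0 \<and> ip n (curry A k) (?y A) = 0"
  let ?N = "{A \<in> space ?X. ?P A}"
  let ?I = "{..<m} \<times> {..<n} - {(k, i)}"
  have I: "insert (k, i) ?I = {..<m} \<times> {..<n}" using assms by auto
  have mc: "(\<lambda>A. curry A j l) \<in> borel_measurable ?X" if "j < m" "l < n" for j l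
    unfolding curry_def by (rule measurable_gmat[OF that])
  have y: "(\<lambda>A. ?y A l) \<in> borel_measurable ?X" if "l < n" for l
    by (rule measurable_oproj[OF _ _ that]) (use assms in \<open>simp_all add: measurable_gmat curry_def\<close>)
  have "(\<lambda>A. ip n (curry A k) (?y A)) \<in> borel_measurable ?X"
    by (intro measurable_ip mc y assms)
  from sets.sets_Collect_conj[OF sets_Collect_eq_0[OF this] sets_Collect_ne_0[OF y[OF assms(2)]]]
  have N: "?N \<in> sets ?X" .
  have "emeasure ?X ?N = (\<integral>\<^sup>+A. indicator ?N A \<partial>?X)" by (rule nn_integral_indicator[OF N, symmetric])
  also have "\<dots> = (\<integral>\<^sup>+A. \<integral>\<^sup>+t. indicator ?N (A((k, i) := t)) \<partial>stdN \<partial>gauss ?I)"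
    by (rule nn_integral_gauss_insert[of ?I "(k,i)", unfolded I])
       (simp, simp, rule borel_measurable_indicator[OF N])
  also have "\<dots> = (\<integral>\<^sup>+A. 0 \<partial>gauss ?I)"
  proof (intro nn_integral_cong)
    fix A
    have y: "?y (A((k, i) := t)) = ?y A" for t
      by (rule oproj_cong) (auto simp: curry_def)
    have ipeq: "ip n (curry (A((k, i) := t)) k) (?y A) = t * ?y A i + (\<Sum>l\<in>{..<n} - {i}. A (k, l) * ?y A l)" for t
      unfolding ip_def using assms by (subst sum.remove[of _ i]) auto
    \<comment> \<open>The only root of the affine function when the slope is nonzero; for slope zero
      the exceptional event is not met at all.\<close>
    define t0 where "t0 = - (\<Sum>l\<in>{..<n} - {i}. A (k, l) * ?y A l) / ?y A i"
    have "(\<integral>\<^sup>+t. indicator ?N (A((k, i) := t)) \<partial>stdN) \<le> (\<integral>\<^sup>+t. indicator {t0} t \<partial>stdN)"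
      by (intro nn_integral_mono) (auto simp: y ipeq t0_def indicator_def field_simps simp del: curry_def)
    also have "\<dots> = 0" by (simp add: emeasure_stdN_singleton)
    finally show "(\<integral>\<^sup>+t. indicator ?N (A((k, i) := t)) \<partial>stdN) = 0" by simp
  qed
  finally have "emeasure ?X ?N = 0" by simp
  then have "AE A in ?X. A \<notin> ?N" by (intro AE_not_in null_setsI N)
  then show ?thesis using AE_space by eventually_elim blast
qed

text \<open>After \<open>k < n\<close> steps the trace is at least n - k, hence some diagonal entry
  is nonzero, and self-adjointness moves the projection from that unit vector to row
  \<open>k\<close>.\<close>

lemma AE_residue_ne_0:
  assumes "k < m" "k < n"
  shows "AE A in gauss ({..<m} \<times> {..<n}).
    ip n (oproj n (curry A) k (curry A k)) (oproj n (curry A) k (curry A k)) \<noteq> 0"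
proof -
  have "AE A in gauss ({..<m} \<times> {..<n}). \<forall>i\<in>{..<n}.
     oproj n (curry A) k (unit_vec i) i \<noteq> 0 \<longrightarrow> ip n (curry A k) (oproj n (curry A) k (unit_vec i)) \<noteq> 0"
    using AE_residue_ne_0_aux[OF assms(1)] by (intro AE_finite_allI) auto
  then show ?thesis
  proof eventually_elim
    case (elim A)
    let ?J = "{j. j < k \<and> ip n (oproj n (curry A) j (curry A j)) (oproj n (curry A) j (curry A j)) \<noteq> 0}"
    have "card ?J \<le> card {..<k}" by (intro card_mono) auto
    then have "0 < (\<Sum>i<n. oproj n (curry A) k (unit_vec i) i)"
      using assms by (simp add: trace_oproj)
    then have "(\<Sum>i<n. oproj n (curry A) k (unit_vec i) i) \<noteq> 0" by simp
    then obtain i where i: "i < n" "oproj n (curry A) k (unit_vec i) i \<noteq> 0"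
      by (elim sum.not_neutral_contains_not_neutral) simp
    with elim have "ip n (oproj n (curry A) k (curry A k)) (unit_vec i) \<noteq> 0"
      by (simp add: oproj_self_adjoint)
    then show ?case by (metis ip_eq_0_if_left)
  qed
qed

section \<open>Comparing the null space with a Gaussian direction\<close>

text \<open>The cosine of the angle is at least 1 - \<eta>, written without a quotient. Zero vectors
  are excluded because the inequality would hold for them trivially.\<close>

definition kern :: "nat \<Rightarrow> real \<Rightarrow> (nat \<Rightarrow> real) \<Rightarrow> (nat \<Rightarrow> real) \<Rightarrow> bool" where
  "kern n \<eta> u h \<longleftrightarrow> 0 < ip n u u \<and> 0 < ip n h h \<and>
     (1 - \<eta>) * sqrt (ip n u u) * sqrt (ip n h h) \<le> ip n u h"

definition kernI :: "nat \<Rightarrow> real \<Rightarrow> (nat \<Rightarrow> real) \<Rightarrow> (nat \<Rightarrow> real) \<Rightarrow> ennreal" where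
  "kernI n \<eta> u h = (if kern n \<eta> u h then 1 else 0)"

text \<open>The factor 4 makes the ball carry at least 3/4 of the Gaussian mass by Markov's
  inequality.\<close>

definition ballI :: "nat \<Rightarrow> (nat \<Rightarrow> real) \<Rightarrow> ennreal" where
  "ballI n h = (if ip n h h \<le> 4 * real n then 1 else 0)"

definition cap :: "nat \<Rightarrow> real \<Rightarrow> (nat \<Rightarrow> real) \<Rightarrow> ennreal" where
  "cap n \<eta> u = (\<integral>\<^sup>+h. kernI n \<eta> u h * ballI n h \<partial>gauss {..<n})"

text \<open>The average over \<open>A\<close> is essential: for a fixed matrix the law of the
  projected vector is confined to one null space, so its directions are not uniform.\<close>

definition unif :: "nat \<Rightarrow> nat \<Rightarrow> real \<Rightarrow> (nat \<Rightarrow> real) \<Rightarrow> ennreal" where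
  "unif m n \<eta> h = (\<integral>\<^sup>+A. \<integral>\<^sup>+g. kernI n \<eta> (oproj n (curry A) m g) h \<partial>gauss {..<n} \<partial>gauss ({..<m} \<times> {..<n}))"

lemma kernI_cong:
  assumes "\<And>i. i < n \<Longrightarrow> u i = u' i" "\<And>i. i < n \<Longrightarrow> h i = h' i"
  shows "kernI n \<eta> u h = kernI n \<eta> u' h'"
proof -
  have "ip n u u = ip n u' u'" "ip n h h = ip n h' h'" "ip n u h = ip n u' h'"
    using assms by (auto intro!: ip_cong)
  then show ?thesis by (simp add: kernI_def kern_def)
qed

lemma kern_commute: "kern n \<eta> u h = kern n \<eta> h u"
  by (auto simp: kern_def ip_commute mult_ac)

lemma kern_scale_left:
  assumes "0 < r"
  shows "kern n \<eta> (\<lambda>i. r * u i) h = kern n \<eta> u h"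
proof -
  have 1: "ip n (\<lambda>i. r * u i) (\<lambda>i. r * u i) = r\<^sup>2 * ip n u u"
    by (simp add: ip_scale_left ip_scale_right power2_eq_square)
  have 2: "sqrt (r\<^sup>2 * ip n u u) = r * sqrt (ip n u u)"
    using assms by (simp add: real_sqrt_mult)
  have 3: "(1 - \<eta>) * (r * sqrt (ip n u u)) * sqrt (ip n h h) \<le> r * ip n u h \<longleftrightarrow>
     (1 - \<eta>) * sqrt (ip n u u) * sqrt (ip n h h) \<le> ip n u h"
  proof -
    have "(1 - \<eta>) * (r * sqrt (ip n u u)) * sqrt (ip n h h) = r * ((1 - \<eta>) * sqrt (ip n u u) * sqrt (ip n h h))"
      by (simp add: mult_ac)
    then show ?thesis using assms by (simp only: mult_le_cancel_left_pos)
  qed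
  show ?thesis
    unfolding kern_def 1 2 ip_scale_left[of n r u h] 3 using assms by (simp add: zero_less_mult_iff)
qed

lemma kern_givens:
  assumes "j \<noteq> k" "j < n" "k < n" "c\<^sup>2 + s\<^sup>2 = 1"
  shows "kern n \<eta> (givens j k c s u) (givens j k c s h) = kern n \<eta> u h"
  by (simp add: kern_def ip_givens[OF assms])

lemma ballI_givens:
  assumes "j \<noteq> k" "j < n" "k < n" "c\<^sup>2 + s\<^sup>2 = 1"
  shows "ballI n (givens j k c s h) = ballI n h"
  by (simp add: ballI_def ip_givens[OF assms])

lemma measurable_kernI_aux:
  fixes a b d :: "'a \<Rightarrow> real"
  assumes "a \<in> borel_measurable M" "b \<in> borel_measurable M" "d \<in> borel_measurable M"
  shows "(\<lambda>\<omega>. if 0 < a \<omega> \<and> 0 < b \<omega> \<and> (1 - \<eta>) * sqrt (a \<omega>) * sqrt (b \<omega>) \<le> d \<omega> then 1 else 0 :: ennreal)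
    \<in> borel_measurable M"
proof -
  have sqrt: "sqrt \<in> borel_measurable borel"
    by (intro borel_measurable_continuous_onI continuous_intros)
  have "{\<omega> \<in> space M. 0 < a \<omega> \<and> 0 < b \<omega> \<and> (1 - \<eta>) * sqrt (a \<omega>) * sqrt (b \<omega>) \<le> d \<omega>} \<in> sets M"
    by (intro sets.sets_Collect_conj borel_measurable_less borel_measurable_le borel_measurable_times
        measurable_compose[OF assms(1) sqrt] measurable_compose[OF assms(2) sqrt] borel_measurable_const assms)
  then show ?thesis by (rule measurable_If[OF borel_measurable_const borel_measurable_const])
qed

lemma measurable_kernI:
  assumes "\<And>i. i < n \<Longrightarrow> (\<lambda>\<omega>. u \<omega> i) \<in> borel_measurable M"
    "\<And>i. i < n \<Longrightarrow> (\<lambda>\<omega>. h \<omega> i) \<in> borel_measurable M"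
  shows "(\<lambda>\<omega>. kernI n \<eta> (u \<omega>) (h \<omega>)) \<in> borel_measurable M"
  unfolding kernI_def kern_def by (intro measurable_kernI_aux measurable_ip assms)

lemma measurable_if_le_const:
  fixes u :: "'a \<Rightarrow> real"
  assumes "u \<in> borel_measurable M"
  shows "(\<lambda>x. if u x \<le> c then 1 else 0 :: ennreal) \<in> borel_measurable M"
  using assms by measurable

lemma measurable_ballI: "ballI n \<in> borel_measurable (gauss {..<n})"
  unfolding ballI_def[abs_def] by (intro measurable_if_le_const measurable_ip measurable_gvec)

lemma cap_const:
  assumes "2 \<le> n" "0 < ip n u u"
  shows "cap n \<eta> u = cap n \<eta> (unit_vec 0)"
proof -
  have m: "(\<lambda>h. kernI n \<eta> y h * ballI n h) \<in> borel_measurable (gauss {..<n})" for y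
    by (intro borel_measurable_times_ennreal measurable_kernI measurable_ballI measurable_gvec borel_measurable_const)
  have "cap n \<eta> u = cap n \<eta> (\<lambda>i. sqrt (ip n u u) * unit_vec 0 i)"
  proof (rule givens_invariant_imp[OF assms(1)])
    fix j k c s y assume jk: "j \<noteq> k" "j < n" "k < n" and cs: "c\<^sup>2 + s\<^sup>2 = (1::real)"
    have "cap n \<eta> (givens j k c s y) = (\<integral>\<^sup>+h. kernI n \<eta> (givens j k c s y) (givens j k c s h) * ballI n (givens j k c s h) \<partial>gauss {..<n})"
      unfolding cap_def by (rule nn_integral_gauss_givens[OF _ _ _ jk(1) cs m, symmetric]) (use jk in simp_all)
    then show "cap n \<eta> (givens j k c s y) = cap n \<eta> y"
      by (simp add: cap_def kernI_def kern_givens[OF jk cs] ballI_givens[OF jk cs])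
  next
    fix y y' :: "nat \<Rightarrow> real" assume "\<And>i. i < n \<Longrightarrow> y i = y' i"
    then show "cap n \<eta> y = cap n \<eta> y'"
      unfolding cap_def by (intro nn_integral_cong arg_cong2[where f="(*)"] kernI_cong refl)
  qed
  also have "\<dots> = cap n \<eta> (unit_vec 0)"
    using assms by (simp add: cap_def kernI_def kern_scale_left)
  finally show ?thesis .
qed

text \<open>Induction on the number of rows already rotated: rotating one more row is a plane
  rotation of the matrix in the coordinates (r, j) and (r, k), and it is absorbed into
  \<open>f\<close>.\<close>

lemma nn_integral_gauss_rows_givens:
  fixes m n r :: nat
  assumes "j \<noteq> k" "j < n" "k < n" and cs: "c\<^sup>2 + s\<^sup>2 = 1" and "r \<le> m"
    and f: "f \<in> borel_measurable (gauss ({..<m} \<times> {..<n}))"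
  shows "(\<integral>\<^sup>+A. f (\<lambda>(i, l). if i < r then givens j k c s (curry A i) l else A (i, l)) \<partial>gauss ({..<m} \<times> {..<n})) =
    (\<integral>\<^sup>+A. f A \<partial>gauss ({..<m} \<times> {..<n}))"
  using \<open>r \<le> m\<close> f
proof (induction r arbitrary: f)
  case 0
  then show ?case by (simp add: case_prod_unfold)
next
  case (Suc r)
  let ?X = "gauss ({..<m} \<times> {..<n})"
  let ?G = "givens (r, j) (r, k) c s"
  have G: "?G \<in> measurable ?X ?X"
    by (rule measurable_givens) (use Suc.prems assms in auto)
  let ?H = "\<lambda>A. (\<lambda>(i, l). if i < r then givens j k c s (curry A i) l else A (i, l))"
  have eq2: "(\<lambda>(i, l). if i < Suc r then givens j k c s (curry A i) l else A (i, l)) = ?G (?H A)" for A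
    using assms(1) by (auto simp: fun_eq_iff givens_def less_Suc_eq)
  have "(\<integral>\<^sup>+A. f (\<lambda>(i, l). if i < Suc r then givens j k c s (curry A i) l else A (i, l)) \<partial>?X) =
    (\<integral>\<^sup>+A. f (?G (?H A)) \<partial>?X)"
    unfolding eq2 ..
  also have "\<dots> = (\<integral>\<^sup>+A. f (?G A) \<partial>?X)"
    by (rule Suc.IH[OF _ measurable_compose[OF G Suc.prems(2)]]) (use Suc.prems in simp)
  also have "\<dots> = (\<integral>\<^sup>+A. f A \<partial>?X)"
    by (rule nn_integral_gauss_givens[OF _ _ _ _ cs Suc.prems(2)]) (use Suc.prems assms in auto)
  finally show ?case .
qed

lemma measurable_kernI_oproj:
  assumes "\<And>i j. i < m \<Longrightarrow> j < n \<Longrightarrow> (\<lambda>\<omega>. A \<omega> (i, j)) \<in> borel_measurable M"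
    "\<And>i. i < n \<Longrightarrow> (\<lambda>\<omega>. g \<omega> i) \<in> borel_measurable M"
    "\<And>i. i < n \<Longrightarrow> (\<lambda>\<omega>. h \<omega> i) \<in> borel_measurable M"
  shows "(\<lambda>\<omega>. kernI n \<eta> (oproj n (curry (A \<omega>)) m (g \<omega>)) (h \<omega>)) \<in> borel_measurable M"
  unfolding curry_def by (intro measurable_kernI measurable_oproj assms)

lemma measurable_nn_integral_kernI:
  "(\<lambda>A. \<integral>\<^sup>+g. kernI n \<eta> (oproj n (curry A) m g) h \<partial>gauss {..<n}) \<in> borel_measurable (gauss ({..<m} \<times> {..<n}))"
proof -
  have "(\<lambda>z. kernI n \<eta> (oproj n (curry (fst z)) m (snd z)) h) \<in> borel_measurable (gauss ({..<m} \<times> {..<n}) \<Otimes>\<^sub>M gauss {..<n})"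
    by (intro measurable_kernI_oproj measurable_compose[OF measurable_fst measurable_gmat]
      measurable_compose[OF measurable_snd measurable_gvec] borel_measurable_const)
  from sigma_finite_measure.borel_measurable_nn_integral_fst[OF sigma_finite_gauss this]
  show ?thesis by simp
qed

text \<open>Rotating \<open>g\<close> and all rows of \<open>A\<close> preserves their joint law and
  rotates the projected vector by \<open>oproj_givens\<close>. The value is thus invariant under
  rotations of \<open>h\<close>, and rescaling removes the dependence on its length.\<close>

lemma unif_const:
  assumes "2 \<le> n" "0 < ip n h h"
  shows "unif m n \<eta> h = unif m n \<eta> (unit_vec 0)"
proof -
  have "unif m n \<eta> h = unif m n \<eta> (\<lambda>i. sqrt (ip n h h) * unit_vec 0 i)"
  proof (rule givens_invariant_imp[OF assms(1)])
    fix j k c s y assume jk: "j \<noteq> k" "j < n" "k < n" and cs: "c\<^sup>2 + s\<^sup>2 = (1::real)"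
    let ?H = "\<lambda>A. (\<lambda>(i, l). if i < m then givens j k c s (curry A i) l else A (i, l))"
    let ?R = "givens j k c s"
    have op: "oproj n (curry (?H A)) m (?R g) = ?R (oproj n (curry A) m g)" for A g
    proof -
      have "oproj n (curry (?H A)) m (?R g) = oproj n (\<lambda>i. ?R (curry A i)) m (?R g)"
        by (rule oproj_cong) (simp add: curry_def)
      then show ?thesis by (simp only: oproj_givens[OF jk cs])
    qed
    have "unif m n \<eta> (?R y) = (\<integral>\<^sup>+A. \<integral>\<^sup>+g. kernI n \<eta> (oproj n (curry (?H A)) m g) (?R y) \<partial>gauss {..<n} \<partial>gauss ({..<m} \<times> {..<n}))"
      unfolding unif_def
      by (rule nn_integral_gauss_rows_givens[OF jk cs order_refl measurable_nn_integral_kernI, symmetric])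
    also have "\<dots> = (\<integral>\<^sup>+A. \<integral>\<^sup>+g. kernI n \<eta> (oproj n (curry (?H A)) m (?R g)) (?R y) \<partial>gauss {..<n} \<partial>gauss ({..<m} \<times> {..<n}))"
    proof (rule nn_integral_cong, rule nn_integral_gauss_givens[OF _ _ _ jk(1) cs, symmetric])
      fix A
      show "(\<lambda>g. kernI n \<eta> (oproj n (curry (?H A)) m g) (?R y)) \<in> borel_measurable (gauss {..<n})"
        by (intro measurable_kernI_oproj measurable_gvec borel_measurable_const)
    qed (use jk in simp_all)
    also have "\<dots> = unif m n \<eta> y"
      unfolding unif_def op by (simp only: kernI_def kern_givens[OF jk cs])
    finally show "unif m n \<eta> (?R y) = unif m n \<eta> y" .
  next
    fix y y' :: "nat \<Rightarrow> real" assume "\<And>i. i < n \<Longrightarrow> y i = y' i"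
    then show "unif m n \<eta> y = unif m n \<eta> y'"
      unfolding unif_def by (intro nn_integral_cong kernI_cong refl)
  qed
  also have "\<dots> = unif m n \<eta> (unit_vec 0)"
  proof -
    have "0 < sqrt (ip n h h)" using assms by simp
    then have "kernI n \<eta> u (\<lambda>i. sqrt (ip n h h) * unit_vec 0 i) = kernI n \<eta> u (unit_vec 0)" for u
      unfolding kernI_def kern_commute[of n \<eta> u] by (simp only: kern_scale_left)
    then show ?thesis by (simp only: unif_def)
  qed
  finally show ?thesis .
qed

lemma unif_eq_0: "ip n h h = 0 \<Longrightarrow> unif m n \<eta> h = 0"
  by (simp add: unif_def kernI_def kern_def)

text \<open>The exchange of order behind the whole comparison. It is used twice: with
  \<open>q\<close> the truncation, to bound \<open>unif\<close> by \<open>cap\<close>, and with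
  \<open>q\<close> the indicator of the test event.\<close>

lemma nn_integral_kernI_swap:
  assumes "q \<in> borel_measurable (gauss {..<n})"
  shows "(\<integral>\<^sup>+A. \<integral>\<^sup>+g. \<integral>\<^sup>+h. kernI n \<eta> (oproj n (curry A) m g) h * q h \<partial>gauss {..<n} \<partial>gauss {..<n} \<partial>gauss ({..<m} \<times> {..<n}))
    = (\<integral>\<^sup>+h. unif m n \<eta> h * q h \<partial>gauss {..<n})"
proof -
  let ?X = "gauss ({..<m} \<times> {..<n})" and ?Y = "gauss {..<n}"
  let ?f = "\<lambda>A g h. kernI n \<eta> (oproj n (curry A) m g) h"
  have g: "(\<lambda>g. ?f A g h) \<in> borel_measurable ?Y" for A h
    by (intro measurable_kernI_oproj measurable_gvec borel_measurable_const)
  have gh: "(\<lambda>z. ?f A (fst z) (snd z) * q (snd z)) \<in> borel_measurable (?Y \<Otimes>\<^sub>M ?Y)" for A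
    by (intro borel_measurable_times_ennreal measurable_kernI_oproj measurable_compose[OF measurable_fst measurable_gvec]
      measurable_compose[OF measurable_snd measurable_gvec] borel_measurable_const measurable_compose[OF measurable_snd assms])
  have "(\<lambda>z. ?f (fst (fst z)) (snd z) (snd (fst z))) \<in> borel_measurable ((?X \<Otimes>\<^sub>M ?Y) \<Otimes>\<^sub>M ?Y)"
    by (intro measurable_kernI_oproj measurable_compose[OF measurable_fst measurable_compose[OF measurable_fst measurable_gmat]]
      measurable_compose[OF measurable_snd measurable_gvec] measurable_compose[OF measurable_fst measurable_compose[OF measurable_snd measurable_gvec]])
  from sigma_finite_measure.borel_measurable_nn_integral_fst[OF sigma_finite_gauss this]
  have Ah': "(\<lambda>z. \<integral>\<^sup>+g. ?f (fst z) g (snd z) \<partial>?Y) \<in> borel_measurable (?X \<Otimes>\<^sub>M ?Y)"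
    by simp
  have Ah: "(\<lambda>z. (\<integral>\<^sup>+g. ?f (fst z) g (snd z) \<partial>?Y) * q (snd z)) \<in> borel_measurable (?X \<Otimes>\<^sub>M ?Y)"
    by (intro borel_measurable_times_ennreal Ah' measurable_compose[OF measurable_snd assms])
  have "(\<integral>\<^sup>+A. \<integral>\<^sup>+g. \<integral>\<^sup>+h. ?f A g h * q h \<partial>?Y \<partial>?Y \<partial>?X) = (\<integral>\<^sup>+A. \<integral>\<^sup>+h. \<integral>\<^sup>+g. ?f A g h * q h \<partial>?Y \<partial>?Y \<partial>?X)"
  proof (rule nn_integral_cong)
    fix A
    show "(\<integral>\<^sup>+g. \<integral>\<^sup>+h. ?f A g h * q h \<partial>?Y \<partial>?Y) = (\<integral>\<^sup>+h. \<integral>\<^sup>+g. ?f A g h * q h \<partial>?Y \<partial>?Y)"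
      using pair_sigma_finite.Fubini[OF pair_sigma_finite_gauss gh[of A]] by simp
  qed
  also have "\<dots> = (\<integral>\<^sup>+A. \<integral>\<^sup>+h. (\<integral>\<^sup>+g. ?f A g h \<partial>?Y) * q h \<partial>?Y \<partial>?X)"
    by (simp only: nn_integral_multc[OF g])
  also have "\<dots> = (\<integral>\<^sup>+h. \<integral>\<^sup>+A. (\<integral>\<^sup>+g. ?f A g h \<partial>?Y) * q h \<partial>?X \<partial>?Y)"
    using pair_sigma_finite.Fubini[OF pair_sigma_finite_gauss Ah] by simp
  also have "\<dots> = (\<integral>\<^sup>+h. unif m n \<eta> h * q h \<partial>?Y)"
    unfolding unif_def by (simp only: nn_integral_multc[OF measurable_nn_integral_kernI])
  finally show ?thesis .
qed

lemma AE_gauss_ip_ne_0: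
  assumes "1 \<le> n"
  shows "AE h in gauss {..<n}. ip n h h \<noteq> 0"
proof -
  let ?Y = "gauss {..<n}"
  let ?N = "{h \<in> space ?Y. h 0 = 0}"
  have N: "?N \<in> sets ?Y"
    by (rule sets_Collect_eq_0[OF measurable_gvec]) (use assms in simp)
  have "emeasure ?Y ?N = (\<integral>\<^sup>+h. indicator ?N h \<partial>?Y)" by (rule nn_integral_indicator[OF N, symmetric])
  also have "\<dots> = (\<integral>\<^sup>+h. indicator {0} (h 0) \<partial>?Y)"
    by (intro nn_integral_cong) (simp add: indicator_def)
  also have "\<dots> = (\<integral>\<^sup>+x. indicator {0} x \<partial>stdN)"
    by (rule nn_integral_gauss_component) (use assms in auto)
  also have "\<dots> = 0" by (simp add: emeasure_stdN_singleton)
  finally have "AE h in ?Y. h \<notin> ?N" by (intro AE_not_in null_setsI N)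
  then show ?thesis using AE_space
  proof eventually_elim
    case (elim h)
    then have "h 0 \<noteq> 0" by simp
    moreover have "0 < n" using assms by simp
    ultimately show ?case unfolding ip_self_eq_0_iff by blast
  qed
qed

lemma nn_integral_ballI_ge:
  assumes "2 \<le> n"
  shows "ennreal (3/4) \<le> (\<integral>\<^sup>+h. ballI n h \<partial>gauss {..<n})"
proof -
  let ?Y = "gauss {..<n}"
  let ?B = "{h \<in> space ?Y. ip n h h \<le> 4 * real n}"
  have B: "?B \<in> sets ?Y" by (intro sets_Collect_le_const measurable_ip measurable_gvec)
  have "ennreal (3/4) \<le> emeasure ?Y ?B"
    using emeasure_oproj_le[of n "\<lambda>_ _. 0" 0 "real n"] assms by (simp add: unit_vec_def)
  also have "\<dots> = (\<integral>\<^sup>+h. indicator ?B h \<partial>?Y)" by (rule nn_integral_indicator[OF B, symmetric])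
  also have "\<dots> = (\<integral>\<^sup>+h. ballI n h \<partial>?Y)"
    by (intro nn_integral_cong) (simp add: indicator_def ballI_def)
  finally show ?thesis .
qed

text \<open>Integrate the truncated angle indicator over \<open>A\<close>, \<open>g\<close> and
  \<open>h\<close>. With \<open>h\<close> outermost it is \<open>unif\<close> times the mass of the
  ball; with \<open>h\<close> innermost it is an average of caps, which are constant or, where the
  projected vector vanishes, zero. That second case is why the result is an inequality.\<close>

lemma unif_le_cap:
  assumes "2 \<le> n"
  shows "ennreal (3/4) * unif m n \<eta> (unit_vec 0) \<le> cap n \<eta> (unit_vec 0)"
proof -
  let ?X = "gauss ({..<m} \<times> {..<n})" and ?Y = "gauss {..<n}"
  have "ennreal (3/4) * unif m n \<eta> (unit_vec 0) \<le> (\<integral>\<^sup>+h. ballI n h \<partial>?Y) * unif m n \<eta> (unit_vec 0)"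
    by (intro mult_right_mono nn_integral_ballI_ge assms) simp
  also have "\<dots> = (\<integral>\<^sup>+h. ballI n h * unif m n \<eta> (unit_vec 0) \<partial>?Y)"
    by (rule nn_integral_multc[OF measurable_ballI, symmetric])
  also have "\<dots> = (\<integral>\<^sup>+h. unif m n \<eta> h * ballI n h \<partial>?Y)"
  proof (rule nn_integral_cong_AE)
    have "AE h in ?Y. ip n h h \<noteq> 0" using assms by (intro AE_gauss_ip_ne_0) simp
    then show "AE h in ?Y. ballI n h * unif m n \<eta> (unit_vec 0) = unif m n \<eta> h * ballI n h"
    proof eventually_elim
      case (elim h)
      then have "unif m n \<eta> h = unif m n \<eta> (unit_vec 0)"
        by (intro unif_const assms) (simp add: ip_self_pos_iff)
      then show ?case by (simp add: mult.commute)
    qed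
  qed
  also have "\<dots> = (\<integral>\<^sup>+A. \<integral>\<^sup>+g. cap n \<eta> (oproj n (curry A) m g) \<partial>?Y \<partial>?X)"
    unfolding cap_def by (rule nn_integral_kernI_swap[OF measurable_ballI, symmetric])
  also have "\<dots> \<le> (\<integral>\<^sup>+A. \<integral>\<^sup>+g. cap n \<eta> (unit_vec 0) \<partial>?Y \<partial>?X)"
  proof (intro nn_integral_mono)
    fix A g
    let ?u = "oproj n (curry A) m g"
    show "cap n \<eta> ?u \<le> cap n \<eta> (unit_vec 0)"
    proof (cases "0 < ip n ?u ?u")
      case True then show ?thesis using cap_const[OF assms] by simp
    next
      case False
      then have "cap n \<eta> ?u = 0" by (simp add: cap_def kernI_def kern_def)
      then show ?thesis by simp
    qed
  qed
  also have "\<dots> = cap n \<eta> (unit_vec 0)" by simp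
  finally show ?thesis .
qed

lemma cap_le_1: "cap n \<eta> u \<le> 1"
proof -
  have "cap n \<eta> u \<le> (\<integral>\<^sup>+h. 1 \<partial>gauss {..<n})"
    unfolding cap_def by (intro nn_integral_mono) (simp add: kernI_def ballI_def)
  then show ?thesis by simp
qed

lemma emeasure_stdN_Icc_pos:
  assumes "a < b"
  shows "0 < emeasure stdN {a..b}"
proof (rule ccontr)
  assume "\<not> ?thesis"
  then have "{a..b} \<in> null_sets stdN" by (auto simp: null_sets_def)
  then have "AE x in lborel. x \<in> {a..b} \<longrightarrow> ennreal (std_normal_density x) = 0"
    by (subst (asm) null_sets_density_iff) auto
  then have "AE x in lborel. x \<notin> {a..b}"
  proof eventually_elim
    case (elim x)
    moreover have "0 < std_normal_density x" by (rule normal_density_pos) simp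
    ultimately show ?case by (auto simp: ennreal_eq_0_iff)
  qed
  then have "emeasure lborel {a..b} = 0"
    by (subst (asm) AE_iff_measurable[of "{a..b}"]) auto
  then show False using assms by simp
qed

text \<open>A box suffices: coordinate 0 in [1, 2], and all others so small that their squares add
  up to at most \<eta>. Then the squared length is at most 5, within the truncation because
  \<open>2 \<le> n\<close>. Only positivity is needed, since the value cancels later.\<close>

lemma cap_pos:
  assumes "2 \<le> n" "0 < \<eta>" "\<eta> \<le> 1"
  shows "0 < cap n \<eta> (unit_vec 0)"
proof -
  let ?Y = "gauss {..<n}"
  define \<delta> where "\<delta> = sqrt (\<eta> / n)"
  have \<delta>: "0 < \<delta>" "\<delta>\<^sup>2 = \<eta> / n" using assms by (auto simp: \<delta>_def)
  define I where "I i = (if i = 0 then {1..2} else {-\<delta>..\<delta>})" for i :: nat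
  let ?B = "PiE {..<n} I"
  have "emeasure ?Y ?B = (\<Prod>i<n. emeasure stdN (I i))"
    unfolding gauss_def by (rule stdN.emeasure_PiM) (auto simp: I_def)
  also have "\<dots> > 0"
  proof -
    have "0 < emeasure stdN (I i)" for i
      using \<delta>(1) by (auto simp: I_def intro!: emeasure_stdN_Icc_pos)
    then show ?thesis by (induction n) (simp_all add: ennreal_zero_less_mult_iff)
  qed
  finally have pos: "0 < emeasure ?Y ?B" .
  have B: "?B \<in> sets ?Y"
    unfolding gauss_def by (rule sets_PiM_I_finite) (auto simp: I_def)
  have "emeasure ?Y ?B = (\<integral>\<^sup>+h. indicator ?B h \<partial>?Y)" by (rule nn_integral_indicator[OF B, symmetric])
  also have "\<dots> \<le> cap n \<eta> (unit_vec 0)"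
    unfolding cap_def
  proof (intro nn_integral_mono)
    fix h assume "h \<in> space ?Y"
    show "indicator ?B h \<le> kernI n \<eta> (unit_vec 0) h * ballI n h"
    proof (cases "h \<in> ?B")
      case False then show ?thesis by simp
    next
      case True
      have n0: "0 < n" using assms by simp
      have h0: "1 \<le> h 0" "h 0 \<le> 2" using True n0 by (auto simp: I_def PiE_iff split: if_splits)
      have hi: "(h i)\<^sup>2 \<le> \<eta> / n" if "i < n" "i \<noteq> 0" for i
      proof -
        have "h i \<in> I i" using True that by (auto simp: PiE_iff)
        then have "\<bar>h i\<bar> \<le> \<delta>" using that by (auto simp: I_def)
        then have "(h i)\<^sup>2 \<le> \<delta>\<^sup>2" using power_mono[of "\<bar>h i\<bar>" \<delta> 2] by simp
        then show ?thesis by (simp add: \<delta>)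
      qed
      have "(\<Sum>i\<in>{..<n} - {0}. (h i)\<^sup>2) \<le> (\<Sum>i\<in>{..<n} - {0}. \<eta> / n)"
        by (intro sum_mono hi) auto
      also have "\<dots> \<le> (\<Sum>i<n. \<eta> / n)" using assms by (intro sum_mono2) auto
      also have "\<dots> = \<eta>" using n0 by simp
      finally have rest: "(\<Sum>i\<in>{..<n} - {0}. (h i)\<^sup>2) \<le> \<eta>" .
      have "ip n h h = (h 0)\<^sup>2 + (\<Sum>i\<in>{..<n} - {0}. (h i)\<^sup>2)"
        unfolding ip_def using n0 by (subst sum.remove[of _ 0]) (auto simp: power2_eq_square)
      then have hh: "ip n h h \<le> (h 0)\<^sup>2 + \<eta>" "(h 0)\<^sup>2 \<le> ip n h h"
        using rest by (auto intro!: sum_nonneg)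
      have sq: "1 \<le> (h 0)\<^sup>2" "(h 0)\<^sup>2 \<le> 4"
        using h0 power_mono[of 1 "h 0" 2] power_mono[of "h 0" 2 2] by auto
      have "ip n h h \<le> 4 * real n" using hh sq assms by simp
      moreover have "kern n \<eta> (unit_vec 0) h"
      proof -
        have "((1 - \<eta>) * sqrt (ip n h h))\<^sup>2 = (1 - \<eta>) * ((1 - \<eta>) * ip n h h)"
          by (simp add: power_mult_distrib power2_eq_square)
        also have "\<dots> \<le> 1 * ((1 - \<eta>) * ip n h h)"
          using assms by (intro mult_right_mono mult_nonneg_nonneg) auto
        also have "\<dots> \<le> (1 - \<eta>) * ((h 0)\<^sup>2 + \<eta>)"
          using assms hh by (simp add: mult_left_mono)
        also have "\<dots> = (h 0)\<^sup>2 - \<eta> * ((h 0)\<^sup>2 - 1) - \<eta>\<^sup>2"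
          by (simp add: algebra_simps power2_eq_square)
        also have "\<dots> \<le> (h 0)\<^sup>2"
        proof -
          have "0 \<le> \<eta> * ((h 0)\<^sup>2 - 1)" using assms sq by (intro mult_nonneg_nonneg) auto
          then show ?thesis using zero_le_power2[of \<eta>] by linarith
        qed
        finally have "(1 - \<eta>) * sqrt (ip n h h) \<le> h 0"
          by (rule power2_le_imp_le) (use h0 in linarith)
        moreover have "ip n (unit_vec 0) h = h 0" "ip n (unit_vec 0) (unit_vec 0) = 1"
          using n0 by (simp_all add: ip_commute[of n "unit_vec 0" h] ip_unit_vec_right) (simp add: unit_vec_def)
        ultimately show ?thesis using hh sq by (simp add: kern_def)
      qed
      ultimately show ?thesis using True by (simp add: kernI_def ballI_def)
    qed
  qed
  finally show ?thesis using pos by simp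
qed

section \<open>From small angles to a bound for the null space\<close>

lemma near_imp_pos:
  assumes "0 < \<eta>" "\<eta> \<le> 1" "ip n w w = 1" "0 < R"
    and u: "sqrt (ip n (\<lambda>i. u i - R * w i) (\<lambda>i. u i - R * w i)) \<le> \<eta> * R / 8"
  shows "\<bar>sqrt (ip n u u) - R\<bar> \<le> \<eta> * R / 8" "R / 2 \<le> sqrt (ip n u u)"
proof -
  let ?N = "\<lambda>x. sqrt (ip n x x)"
  have w1: "?N (\<lambda>i. R * w i) = R" using assms sqrt_ip_scale[of n R w] by simp
  have "?N u \<le> ?N (\<lambda>i. u i - R * w i) + ?N (\<lambda>i. R * w i)"
    using sqrt_ip_triangle[of n "\<lambda>i. u i - R * w i" "\<lambda>i. R * w i"] by simp
  moreover have "?N (\<lambda>i. R * w i) \<le> ?N (\<lambda>i. (-1) * (u i - R * w i)) + ?N u"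
    using sqrt_ip_triangle[of n "\<lambda>i. (-1) * (u i - R * w i)" u] by simp
  moreover have "?N (\<lambda>i. (-1) * (u i - R * w i)) = ?N (\<lambda>i. u i - R * w i)"
    by (subst sqrt_ip_scale) simp
  ultimately show 1: "\<bar>?N u - R\<bar> \<le> \<eta> * R / 8" using u w1 by linarith
  have "\<eta> * R \<le> 1 * R" using assms by (intro mult_right_mono) auto
  then show "R / 2 \<le> ?N u" using 1 by linarith
qed

text \<open>The error \<eta> is split in half. Rescaling \<open>u\<close> from the length
  \<open>R\<close> to its own length doubles \<eta> / 8 to \<eta> / 4, and \<open>R / 2\<close> as a
  lower bound for that length gives \<eta> / 2 for \<open>w\<close>. The cosine deficit
  \<open>\<eta>\<^sup>2 / 8\<close> gives squared distance at most
  \<open>(\<eta> / 2)\<^sup>2\<close> times that of \<open>h\<close>, by expanding the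
  square.\<close>

lemma kern_imp_near:
  assumes \<eta>: "0 < \<eta>" "\<eta> \<le> 1" and w: "ip n w w = 1" and R: "0 < R"
    and u: "sqrt (ip n (\<lambda>i. u i - R * w i) (\<lambda>i. u i - R * w i)) \<le> \<eta> * R / 8"
    and k: "kern n (\<eta>\<^sup>2 / 8) u h"
  shows "sqrt (ip n (\<lambda>i. h i - sqrt (ip n h h) * w i) (\<lambda>i. h i - sqrt (ip n h h) * w i)) \<le> \<eta> * sqrt (ip n h h)"
proof -
  let ?N = "\<lambda>x. sqrt (ip n x x)"
  define a where "a = ?N u"
  define b where "b = ?N h"
  have a: "\<bar>a - R\<bar> \<le> \<eta> * R / 8" "R / 2 \<le> a" "0 < a"
  proof -
    show "\<bar>a - R\<bar> \<le> \<eta> * R / 8" "R / 2 \<le> a"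
      unfolding a_def by (rule near_imp_pos[OF \<eta> w R u])+
    with R show "0 < a" by linarith
  qed
  have b: "0 < b" using k by (simp add: kern_def b_def)
  have aa: "ip n u u = a * a" "ip n h h = b * b" by (simp_all add: a_def b_def)
  have k': "(1 - \<eta>\<^sup>2 / 8) * a * b \<le> ip n u h" using k by (simp add: kern_def a_def b_def)
  have "?N (\<lambda>i. u i - a * w i) \<le> ?N (\<lambda>i. u i - R * w i) + ?N (\<lambda>i. (R - a) * w i)"
    using sqrt_ip_triangle[of n "\<lambda>i. u i - R * w i" "\<lambda>i. (R - a) * w i"] by (simp add: algebra_simps)
  also have "?N (\<lambda>i. (R - a) * w i) = \<bar>a - R\<bar>" using w by (subst sqrt_ip_scale) simp
  also have "?N (\<lambda>i. u i - R * w i) + \<bar>a - R\<bar> \<le> \<eta> * R / 4" using u a by simp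
  also have "\<dots> \<le> \<eta> / 2 * a" using mult_left_mono[OF a(2), of "\<eta> / 2"] \<eta> by simp
  finally have near_w: "?N (\<lambda>i. u i - a * w i) \<le> \<eta> / 2 * a" .
  have "ip n (\<lambda>i. h i - (b / a) * u i) (\<lambda>i. h i - (b / a) * u i) = 2 * b * b - 2 * (b / a) * ip n u h"
    unfolding ip_diff_scale_left ip_diff_scale_right aa ip_commute[of n h u] using a by (simp add: field_simps)
  also have "\<dots> \<le> 2 * b * b - 2 * (b / a) * ((1 - \<eta>\<^sup>2 / 8) * a * b)"
    using k' a b by (intro diff_mono mult_left_mono) auto
  also have "\<dots> = (\<eta> / 2 * b)\<^sup>2"
    using a by (simp add: field_simps power2_eq_square)
  finally have "?N (\<lambda>i. h i - (b / a) * u i) \<le> sqrt ((\<eta> / 2 * b)\<^sup>2)"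
    by (rule real_sqrt_le_mono)
  then have near_u: "?N (\<lambda>i. h i - (b / a) * u i) \<le> \<eta> / 2 * b" using \<eta> b by simp
  have "?N (\<lambda>i. (b / a) * (u i - a * w i)) = b / a * ?N (\<lambda>i. u i - a * w i)"
    using a b by (subst sqrt_ip_scale) simp
  also have "\<dots> \<le> b / a * (\<eta> / 2 * a)" using a b near_w by (intro mult_left_mono) auto
  also have "\<dots> = \<eta> / 2 * b" using a by simp
  finally have 2: "?N (\<lambda>i. (b / a) * (u i - a * w i)) \<le> \<eta> / 2 * b" .
  have "(\<lambda>i. h i - b * w i) = (\<lambda>i. (h i - (b / a) * u i) + (b / a) * (u i - a * w i))"
    using a by (simp add: fun_eq_iff field_simps)
  then have "?N (\<lambda>i. h i - b * w i) \<le> ?N (\<lambda>i. h i - (b / a) * u i) + ?N (\<lambda>i. (b / a) * (u i - a * w i))"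
    by (simp only: sqrt_ip_triangle)
  then show ?thesis using near_u 2 unfolding b_def by simp
qed

text \<open>A matrix with a bad null vector makes \<Phi> at least t * c: with probability
  \<open>t\<close> the projected vector points near the bad one, and then the whole truncated cap
  satisfies \<open>Q\<close>. The mean of \<Phi> is at most 4/3 * c times the probability of
  \<open>Q\<close>, so Markov's inequality finishes and \<open>c\<close> cancels. The event is
  defined through \<Phi>, which makes it measurable although the avoidance property quantifies over
  all \<open>w\<close> and an arbitrary \<open>bad\<close>.\<close>

lemma null_space_avoids_cone:
  fixes n m :: nat and bad Q :: "(nat \<Rightarrow> real) \<Rightarrow> bool"
  assumes n: "2 \<le> n" and m: "m < n" and \<eta>: "0 < \<eta>" "\<eta> \<le> 1"
    and Q: "{h \<in> space (gauss {..<n}). Q h} \<in> sets (gauss {..<n})"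
    and near: "\<And>w h. bad w \<Longrightarrow> ip n w w = 1 \<Longrightarrow> ip n h h \<le> 4 * real n \<Longrightarrow>
      sqrt (ip n (\<lambda>i. h i - sqrt (ip n h h) * w i) (\<lambda>i. h i - sqrt (ip n h h) * w i)) \<le> \<eta> * sqrt (ip n h h)
      \<Longrightarrow> Q h"
  shows "\<exists>E\<in>sets (gauss ({..<m} \<times> {..<n})).
    (\<forall>A\<in>E. \<forall>w. (\<forall>i<m. ip n (curry A i) w = 0) \<and> ip n w w = 1 \<longrightarrow> \<not> bad w) \<and>
    1 - 2 * exp ((32 / \<eta> + 128 / \<eta>\<^sup>2) * (real n - real m)) * measure (gauss {..<n}) {h \<in> space (gauss {..<n}). Q h}
      \<le> measure (gauss ({..<m} \<times> {..<n})) E"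
proof -
  let ?X = "gauss ({..<m} \<times> {..<n})" and ?Y = "gauss {..<n}"
  interpret X: prob_space ?X by (rule prob_space_gauss)
  interpret Y: prob_space ?Y by (rule prob_space_gauss)
  define d where "d = real n - real m"
  have d: "0 < d" using m by (simp add: d_def)
  \<comment> \<open>The projected Gaussian fluctuates by at most 2 * sqrt d; \<open>R\<close> makes
    this the fraction \<eta> / 8 of the shift that \<open>kern_imp_near\<close> tolerates.
    Substitution into the shift cost yields the constants 32 and 128.\<close>
  define R where "R = 16 / \<eta> * sqrt d"
  have R: "0 < R" using d \<eta> by (simp add: R_def)
  have Rd: "2 * sqrt d = \<eta> * R / 8" using \<eta> by (simp add: R_def)
  define \<epsilon> where "\<epsilon> = \<eta>\<^sup>2 / 8"
  have \<eta>2: "\<eta>\<^sup>2 \<le> 1" using \<eta> by (simp add: power_le_one)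
  have \<epsilon>: "0 < \<epsilon>" "\<epsilon> \<le> 1" using \<eta> \<eta>2 by (auto simp: \<epsilon>_def)
  define t where "t = 3/4 * exp (- ((32 / \<eta> + 128 / \<eta>\<^sup>2) * d))"
  have t: "t = 3/4 * exp (- (2 * sqrt d * R + R\<^sup>2 / 2))"
  proof -
    have "2 * sqrt d * R + R\<^sup>2 / 2 = (32 / \<eta> + 128 / \<eta>\<^sup>2) * d"
      using d \<eta> by (simp add: R_def power_mult_distrib power_divide field_simps power2_eq_square)
    then show ?thesis by (simp add: t_def)
  qed
  have t0: "0 < t" by (simp add: t_def)
  define c where "c = cap n \<epsilon> (unit_vec 0)"
  have c: "0 < c" "c \<le> 1" unfolding c_def using cap_pos[OF n \<epsilon>] cap_le_1 by auto
  define q where "q = (indicator {h \<in> space ?Y. Q h} :: _ \<Rightarrow> ennreal)"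
  have q: "q \<in> borel_measurable ?Y" unfolding q_def by (rule borel_measurable_indicator[OF Q])
  define \<Phi> where "\<Phi> A = (\<integral>\<^sup>+g. \<integral>\<^sup>+h. kernI n \<epsilon> (oproj n (curry A) m g) h * q h \<partial>?Y \<partial>?Y)" for A
  have \<Phi>: "\<Phi> \<in> borel_measurable ?X"
  proof -
    have "(\<lambda>z. kernI n \<epsilon> (oproj n (curry (fst (fst z))) m (snd (fst z))) (snd z) * q (snd z)) \<in> borel_measurable ((?X \<Otimes>\<^sub>M ?Y) \<Otimes>\<^sub>M ?Y)"
      by (intro borel_measurable_times_ennreal measurable_kernI_oproj measurable_compose[OF measurable_fst measurable_compose[OF measurable_fst measurable_gmat]]
        measurable_compose[OF measurable_snd measurable_gvec] measurable_compose[OF measurable_fst measurable_compose[OF measurable_snd measurable_gvec]]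
        measurable_compose[OF measurable_snd q])
    from sigma_finite_measure.borel_measurable_nn_integral_fst[OF sigma_finite_gauss
      sigma_finite_measure.borel_measurable_nn_integral_fst[OF sigma_finite_gauss this]]
    show ?thesis unfolding \<Phi>_def[abs_def] by simp
  qed
  let ?b = "\<lambda>A k. oproj n (curry A) k (curry A k)"
  \<comment> \<open>Independent rows make the trace exactly n - m; this event is measurable and has
    full probability.\<close>
  define F where "F = {A \<in> space ?X. \<forall>k\<in>{..<m}. ip n (?b A k) (?b A k) \<noteq> 0}"
  define G where "G = {A \<in> space ?X. \<Phi> A < ennreal t * c}"
  have F: "F \<in> sets ?X"
    unfolding F_def
  proof (intro sets.sets_Collect_finite_All sets_Collect_ne_0 measurable_ip)
    fix k i assume "k \<in> {..<m}" "i < n"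
    then show "(\<lambda>A. ?b A k i) \<in> borel_measurable ?X" "(\<lambda>A. ?b A k i) \<in> borel_measurable ?X"
      unfolding curry_def by (intro measurable_oproj measurable_gmat; simp)+
  qed simp_all
  have G: "G \<in> sets ?X" unfolding G_def by (intro borel_measurable_less \<Phi> borel_measurable_const)
  have avoid: "\<not> bad w" if A: "A \<in> F" "A \<in> G" and w: "\<And>i. i < m \<Longrightarrow> ip n (curry A i) w = 0" "ip n w w = 1" for A w
  proof
    assume bad: "bad w"
    let ?P = "oproj n (curry A) m"
    have "{j. j < m \<and> ip n (?b A j) (?b A j) \<noteq> 0} = {..<m}" using A(1) by (auto simp: F_def)
    then have tr: "(\<Sum>i<n. ?P (unit_vec i) i) \<le> d" by (simp add: trace_oproj d_def)
    let ?S = "{g \<in> space ?Y. ip n (\<lambda>i. ?P g i - R * w i) (\<lambda>i. ?P g i - R * w i) \<le> 4 * d}"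
    have S: "?S \<in> sets ?Y"
      by (intro sets_Collect_le_const measurable_ip borel_measurable_diff measurable_oproj measurable_gvec borel_measurable_const)
    \<comment> \<open>The shift estimate gives \<open>?S\<close> mass at least \<open>t\<close>;
      each \<open>g\<close> in it contributes at least the full cap mass \<open>c\<close> to
      \<Phi>.\<close>
    have "ennreal t * c \<le> emeasure ?Y ?S * c"
      unfolding t using R by (intro mult_right_mono emeasure_oproj_near[OF n tr d _ oproj_fix[OF w(1)] w(2)]) auto
    also have "\<dots> = (\<integral>\<^sup>+g. c * indicator ?S g \<partial>?Y)"
      by (subst nn_integral_cmult_indicator[OF S]) (rule mult.commute)
    also have "\<dots> \<le> \<Phi> A"
      unfolding \<Phi>_def
    proof (intro nn_integral_mono)
      fix g
      show "c * indicator ?S g \<le> (\<integral>\<^sup>+h. kernI n \<epsilon> (?P g) h * q h \<partial>?Y)"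
      proof (cases "g \<in> ?S")
        case False then show ?thesis by simp
      next
        case True
        have "sqrt (ip n (\<lambda>i. ?P g i - R * w i) (\<lambda>i. ?P g i - R * w i)) \<le> sqrt (4 * d)"
          using True by (intro real_sqrt_le_mono) simp
        also have "\<dots> = \<eta> * R / 8" unfolding Rd[symmetric] by (simp add: real_sqrt_mult)
        finally have u: "sqrt (ip n (\<lambda>i. ?P g i - R * w i) (\<lambda>i. ?P g i - R * w i)) \<le> \<eta> * R / 8" .
        have "0 < sqrt (ip n (?P g) (?P g))"
          using near_imp_pos(2)[OF \<eta> w(2) R u] R by linarith
        then have "c = cap n \<epsilon> (?P g)" unfolding c_def by (intro cap_const[OF n, symmetric]) simp
        also have "\<dots> \<le> (\<integral>\<^sup>+h. kernI n \<epsilon> (?P g) h * q h \<partial>?Y)"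
          unfolding cap_def
        proof (intro nn_integral_mono)
          fix h assume h: "h \<in> space ?Y"
          show "kernI n \<epsilon> (?P g) h * ballI n h \<le> kernI n \<epsilon> (?P g) h * q h"
          proof (cases "kern n \<epsilon> (?P g) h \<and> ip n h h \<le> 4 * real n")
            case True
            then have "Q h"
              using near[OF bad w(2)] kern_imp_near[OF \<eta> w(2) R u, of h] by (simp add: \<epsilon>_def)
            then show ?thesis using h by (simp add: q_def ballI_def)
          qed (auto simp: kernI_def ballI_def)
        qed
        finally show ?thesis using True by simp
      qed
    qed
    finally show False using A(2) by (simp add: G_def not_less[symmetric])
  qed
  \<comment> \<open>Markov's inequality over \<open>A\<close>, kept in product form so that nothing
    is divided in \<open>ennreal\<close>.\<close>
  have "ennreal t * c * emeasure ?X (space ?X - G) = (\<integral>\<^sup>+A. ennreal t * c * indicator (space ?X - G) A \<partial>?X)"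
    by (rule nn_integral_cmult_indicator[symmetric]) (rule sets.compl_sets[OF G])
  also have "\<dots> \<le> (\<integral>\<^sup>+A. \<Phi> A \<partial>?X)"
    by (intro nn_integral_mono) (auto simp: G_def indicator_def)
  also have "\<dots> = (\<integral>\<^sup>+h. unif m n \<epsilon> h * q h \<partial>?Y)"
    unfolding \<Phi>_def by (rule nn_integral_kernI_swap[OF q])
  also have "\<dots> \<le> (\<integral>\<^sup>+h. unif m n \<epsilon> (unit_vec 0) * q h \<partial>?Y)"
  proof (intro nn_integral_mono mult_right_mono)
    fix h
    show "unif m n \<epsilon> h \<le> unif m n \<epsilon> (unit_vec 0)"
    proof (cases "ip n h h = 0")
      case True then show ?thesis by (simp add: unif_eq_0)
    next
      case False
      then have "0 < ip n h h" by (simp add: ip_self_pos_iff)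
      then show ?thesis using unif_const[OF n] by simp
    qed
  qed simp
  also have "\<dots> = unif m n \<epsilon> (unit_vec 0) * emeasure ?Y {h \<in> space ?Y. Q h}"
    unfolding q_def by (rule nn_integral_cmult_indicator[OF Q])
  finally have "ennreal (3/4) * (ennreal t * c * emeasure ?X (space ?X - G)) \<le>
     ennreal (3/4) * (unif m n \<epsilon> (unit_vec 0) * emeasure ?Y {h \<in> space ?Y. Q h})"
    by (intro mult_left_mono) auto
  also have "\<dots> \<le> c * emeasure ?Y {h \<in> space ?Y. Q h}"
    unfolding c_def mult.assoc[symmetric] by (intro mult_right_mono unif_le_cap n) simp
  finally have main: "ennreal (3/4) * (ennreal t * c * emeasure ?X (space ?X - G)) \<le> c * emeasure ?Y {h \<in> space ?Y. Q h}" .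
  \<comment> \<open>The cap mass is positive and finite, so it can be cancelled in the
    reals.\<close>
  obtain c' where c': "c = ennreal c'" "0 < c'"
  proof -
    have "c < top" using c by (simp add: order_le_less_trans)
    then show ?thesis using that[of "enn2real c"] c by (auto simp: enn2real_positive_iff)
  qed
  have "3/4 * t * c' * X.prob (space ?X - G) \<le> c' * Y.prob {h \<in> space ?Y. Q h}"
  proof -
    have "ennreal (3/4 * t * c' * X.prob (space ?X - G)) = ennreal (3/4) * (ennreal t * c * emeasure ?X (space ?X - G))"
      using t0 c' by (simp add: X.emeasure_eq_measure ennreal_mult'[symmetric] mult.assoc)
    also have "\<dots> \<le> c * emeasure ?Y {h \<in> space ?Y. Q h}" by (rule main)
    also have "\<dots> = ennreal (c' * Y.prob {h \<in> space ?Y. Q h})"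
      using c' by (simp add: Y.emeasure_eq_measure ennreal_mult'[symmetric])
    finally show ?thesis using c' by (subst (asm) ennreal_le_iff) auto
  qed
  then have "c' * (3/4 * t * X.prob (space ?X - G)) \<le> c' * Y.prob {h \<in> space ?Y. Q h}"
    by (simp add: mult_ac)
  then have pG: "3/4 * t * X.prob (space ?X - G) \<le> Y.prob {h \<in> space ?Y. Q h}"
    using c'(2) by (simp only: mult_le_cancel_left_pos)
  have e: "exp ((32 / \<eta> + 128 / \<eta>\<^sup>2) * d) * t = 3/4" by (simp add: t_def exp_minus)
  have "9/16 * X.prob (space ?X - G) = exp ((32 / \<eta> + 128 / \<eta>\<^sup>2) * d) * (3/4 * t * X.prob (space ?X - G))"
    using e by (simp add: mult_ac)
  also have "\<dots> \<le> exp ((32 / \<eta> + 128 / \<eta>\<^sup>2) * d) * Y.prob {h \<in> space ?Y. Q h}"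
    by (intro mult_left_mono pG) simp
  finally have p1: "9/16 * X.prob (space ?X - G) \<le> exp ((32 / \<eta> + 128 / \<eta>\<^sup>2) * d) * Y.prob {h \<in> space ?Y. Q h}" .
  define z where "z = exp ((32 / \<eta> + 128 / \<eta>\<^sup>2) * d) * Y.prob {h \<in> space ?Y. Q h}"
  have "0 \<le> z" by (simp add: z_def)
  moreover have "9/16 * (1 - X.prob G) \<le> z"
    using p1 unfolding z_def X.prob_compl[OF G] .
  \<comment> \<open>The two factors 3/4, from the shift and from the truncation, give the constant
    16/9, rounded up to 2.\<close>
  ultimately have "1 - 2 * z \<le> X.prob G" by simp
  then have "1 - 2 * exp ((32 / \<eta> + 128 / \<eta>\<^sup>2) * d) * Y.prob {h \<in> space ?Y. Q h} \<le> X.prob G"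
    by (simp only: z_def mult.assoc)
  also have "X.prob G = X.prob (F \<inter> G)"
  proof (rule measure_eq_AE)
    have "AE A in ?X. \<forall>k\<in>{..<m}. ip n (?b A k) (?b A k) \<noteq> 0"
      using m by (intro AE_finite_allI AE_residue_ne_0) auto
    then show "AE A in ?X. A \<in> G \<longleftrightarrow> A \<in> F \<inter> G"
      using AE_space by eventually_elim (auto simp: F_def)
  qed (use F G in \<open>auto intro: sets.Int\<close>)
  finally have "1 - 2 * exp ((32 / \<eta> + 128 / \<eta>\<^sup>2) * d) * Y.prob {h \<in> space ?Y. Q h} \<le> X.prob (F \<inter> G)" .
  then show ?thesis
    using avoid sets.Int[OF F G] unfolding d_def by (intro bexI[of _ "F \<inter> G"]) auto
qed

section \<open>A Chernoff bound for sums over Gaussian coordinates\<close>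

lemma prob_stdN: "measure stdN (space stdN) = 1"
  using prob_space.prob_space[OF prob_space_stdN] .

lemma borel_measurable_stdN: "f \<in> borel_measurable borel \<Longrightarrow> f \<in> borel_measurable stdN"
  by (simp only: measurable_cong_sets[OF sets_density refl] measurable_cong_sets[OF sets_lborel refl])

lemma exp_le_quadratic: "exp y \<le> 1 + y + y\<^sup>2 * exp \<bar>y\<bar>" for y :: real
proof -
  obtain t where t: "\<bar>t\<bar> \<le> \<bar>y\<bar>" "exp y = (\<Sum>m<2. y ^ m / fact m) + exp t / fact 2 * y ^ 2"
    using Maclaurin_exp_le[of y 2] by auto
  have "exp t / 2 * y\<^sup>2 \<le> exp \<bar>y\<bar> * y\<^sup>2"
  proof (rule mult_right_mono)
    have "exp t \<le> exp \<bar>y\<bar>" using t(1) by simp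
    then show "exp t / 2 \<le> exp \<bar>y\<bar>" by (smt (verit) exp_gt_zero field_sum_of_halves)
  qed simp
  then show ?thesis using t(2) by (simp add: numeral_2_eq_2 mult.commute)
qed

text \<open>Dominates the quadratic remainder of exp (- \<theta> * f x), divided by
  \<open>\<theta>\<^sup>2\<close>, for all \<theta> in (0, 1] and all f bounded by 1 +
  \<bar>x\<bar>. One integral thus serves all coordinates, sets and sign patterns.\<close>

definition exp_majorant :: "real \<Rightarrow> real" where
  "exp_majorant x = (1 + \<bar>x\<bar>)\<^sup>2 * exp (1 + \<bar>x\<bar>)"

text \<open>The translation formula for the constant function 1.\<close>

lemma nn_integral_stdN_exp: "(\<integral>\<^sup>+x. ennreal (exp (a * x)) \<partial>stdN) = ennreal (exp (a\<^sup>2 / 2))"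
proof -
  have "1 = (\<integral>\<^sup>+x. 1 \<partial>stdN)"
    using prob_space.emeasure_space_1[OF prob_space_stdN] by simp
  also have "\<dots> = (\<integral>\<^sup>+x. ennreal (exp (- a\<^sup>2 / 2)) * ennreal (exp (a * x)) \<partial>stdN)"
    by (subst nn_integral_stdN_shift[of _ "-a"]) (auto simp: ennreal_mult[symmetric] exp_add[symmetric])
  also have "\<dots> = ennreal (exp (- a\<^sup>2 / 2)) * (\<integral>\<^sup>+x. ennreal (exp (a * x)) \<partial>stdN)"
    by (rule nn_integral_cmult) simp
  finally have "ennreal (exp (a\<^sup>2 / 2)) * 1 = ennreal (exp (a\<^sup>2 / 2)) * (ennreal (exp (- a\<^sup>2 / 2)) * (\<integral>\<^sup>+x. ennreal (exp (a * x)) \<partial>stdN))"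
    by simp
  also have "\<dots> = (ennreal (exp (a\<^sup>2 / 2)) * ennreal (exp (- a\<^sup>2 / 2))) * (\<integral>\<^sup>+x. ennreal (exp (a * x)) \<partial>stdN)"
    by (simp only: mult.assoc)
  also have "ennreal (exp (a\<^sup>2 / 2)) * ennreal (exp (- a\<^sup>2 / 2)) = 1"
    by (simp add: ennreal_mult[symmetric] exp_add[symmetric])
  finally show ?thesis by simp
qed

lemma integrable_exp_majorant: "integrable stdN exp_majorant"
proof (rule integrableI_bounded)
  have "exp_majorant \<in> borel_measurable borel"
    unfolding exp_majorant_def[abs_def] by (intro borel_measurable_continuous_onI continuous_intros)
  then show "exp_majorant \<in> borel_measurable stdN" by (rule borel_measurable_stdN)
  \<comment> \<open>The square of 1 + \<bar>x\<bar> is absorbed into a second exponential, and exp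
    (2 * \<bar>x\<bar>) is at most the sum over both signs.\<close>
  have bd: "exp_majorant x \<le> 2 * exp 2 * (exp (2 * x) + exp (- 2 * x))" for x
  proof -
    let ?s = "1 + \<bar>x\<bar>"
    have "1 + ?s + ?s\<^sup>2 / 2 \<le> exp ?s" by (rule exp_lower_Taylor_quadratic) simp
    then have "?s\<^sup>2 \<le> 2 * exp ?s" by simp
    then have "exp_majorant x \<le> 2 * exp ?s * exp ?s" unfolding exp_majorant_def by (intro mult_right_mono) auto
    also have "\<dots> = 2 * exp 2 * exp (2 * \<bar>x\<bar>)" by (simp add: exp_add[symmetric])
    also have "exp (2 * \<bar>x\<bar>) \<le> exp (2 * x) + exp (- 2 * x)" by (cases "x \<ge> 0") auto
    finally show ?thesis by simp
  qed
  have "(\<integral>\<^sup>+x. ennreal (norm (exp_majorant x)) \<partial>stdN) \<le> (\<integral>\<^sup>+x. ennreal (2 * exp 2) * (ennreal (exp (2 * x)) + ennreal (exp ((-2) * x))) \<partial>stdN)"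
  proof (rule nn_integral_mono)
    fix x
    have "norm (exp_majorant x) = exp_majorant x" by (simp add: exp_majorant_def)
    then show "ennreal (norm (exp_majorant x)) \<le> ennreal (2 * exp 2) * (ennreal (exp (2 * x)) + ennreal (exp ((-2) * x)))"
      using bd[of x] by (simp add: ennreal_mult'[symmetric] ennreal_plus[symmetric] ennreal_leI del: ennreal_plus)
  qed
  also have "\<dots> = ennreal (2 * exp 2) * (ennreal (exp (2\<^sup>2 / 2)) + ennreal (exp ((-2)\<^sup>2 / 2)))"
    by (subst nn_integral_cmult, simp, subst nn_integral_add, simp, simp) (simp only: nn_integral_stdN_exp)
  also have "\<dots> < \<infinity>" by (simp add: ennreal_mult_less_top)
  finally show "(\<integral>\<^sup>+x. ennreal (norm (exp_majorant x)) \<partial>stdN) < \<infinity>" .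
qed

lemma le_exp_majorant: "1 + \<bar>x\<bar> \<le> exp_majorant x"
proof -
  have "1 + \<bar>x\<bar> = (1 + \<bar>x\<bar>) * 1" by simp
  also have "\<dots> \<le> (1 + \<bar>x\<bar>) * (1 + \<bar>x\<bar>)" by (intro mult_left_mono) auto
  also have "\<dots> \<le> (1 + \<bar>x\<bar>) * (1 + \<bar>x\<bar>) * exp (1 + \<bar>x\<bar>)"
    by (rule mult_le_cancel_left1[THEN iffD2]) (auto simp: mult_less_0_iff)
  finally show ?thesis by (simp add: exp_majorant_def power2_eq_square)
qed

lemma integrable_stdN_bounded:
  assumes "f \<in> borel_measurable borel" "\<And>x. \<bar>f x\<bar> \<le> 1 + \<bar>x\<bar>"
  shows "integrable stdN f"
proof (rule Bochner_Integration.integrable_bound[OF integrable_exp_majorant])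
  show "f \<in> borel_measurable stdN" by (rule borel_measurable_stdN[OF assms(1)])
  show "AE x in stdN. norm (f x) \<le> norm (exp_majorant x)"
  proof (rule AE_I2)
    fix x
    have "0 \<le> exp_majorant x" by (simp add: exp_majorant_def)
    then show "norm (f x) \<le> norm (exp_majorant x)" using le_exp_majorant[of x] assms(2)[of x] by simp
  qed
qed

text \<open>A second-order expansion whose linear term is the mean; only a lower bound
  \<open>c\<close> for the mean is used, since the exponent is negative.\<close>

lemma nn_integral_exp_le:
  assumes f: "f \<in> borel_measurable borel" "\<And>x. \<bar>f x\<bar> \<le> 1 + \<bar>x\<bar>" and \<theta>: "0 < \<theta>" "\<theta> \<le> 1"
    and c: "c \<le> (\<integral>x. f x \<partial>stdN)"
  shows "(\<integral>\<^sup>+x. ennreal (exp (- \<theta> * f x)) \<partial>stdN) \<le> ennreal (exp (- \<theta> * c + \<theta>\<^sup>2 * (\<integral>x. exp_majorant x \<partial>stdN)))"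
proof -
  have int: "integrable stdN (\<lambda>x. 1 + - \<theta> * f x + \<theta>\<^sup>2 * exp_majorant x)"
    by (intro Bochner_Integration.integrable_add integrable_mult_right integrable_exp_majorant integrable_stdN_bounded f
        finite_measure.integrable_const[OF prob_space.finite_measure[OF prob_space_stdN]])
  have le: "exp (- \<theta> * f x) \<le> 1 + - \<theta> * f x + \<theta>\<^sup>2 * exp_majorant x" for x
  proof -
    have "\<bar>- \<theta> * f x\<bar> \<le> \<theta> * (1 + \<bar>x\<bar>)"
      using f(2)[of x] \<theta> by (simp add: abs_mult)
    moreover have "\<theta> * (1 + \<bar>x\<bar>) \<le> 1 * (1 + \<bar>x\<bar>)" using \<theta> by (intro mult_right_mono) auto
    ultimately have e: "exp \<bar>- \<theta> * f x\<bar> \<le> exp (1 + \<bar>x\<bar>)" by simp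
    have "(f x)\<^sup>2 \<le> (1 + \<bar>x\<bar>)\<^sup>2" using power_mono[OF f(2)[of x], of 2] by simp
    then have "(- \<theta> * f x)\<^sup>2 \<le> \<theta>\<^sup>2 * (1 + \<bar>x\<bar>)\<^sup>2" by (simp add: power_mult_distrib mult_left_mono)
    then have "(- \<theta> * f x)\<^sup>2 * exp \<bar>- \<theta> * f x\<bar> \<le> \<theta>\<^sup>2 * (1 + \<bar>x\<bar>)\<^sup>2 * exp (1 + \<bar>x\<bar>)"
      using e by (intro mult_mono) auto
    then show ?thesis using exp_le_quadratic[of "- \<theta> * f x"] by (simp add: exp_majorant_def mult.assoc)
  qed
  have "(\<integral>\<^sup>+x. ennreal (exp (- \<theta> * f x)) \<partial>stdN) \<le> (\<integral>\<^sup>+x. ennreal (1 + - \<theta> * f x + \<theta>\<^sup>2 * exp_majorant x) \<partial>stdN)"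
    by (intro nn_integral_mono ennreal_leI le)
  also have "\<dots> = ennreal (\<integral>x. 1 + - \<theta> * f x + \<theta>\<^sup>2 * exp_majorant x \<partial>stdN)"
    by (rule nn_integral_eq_integral[OF int]) (intro AE_I2 order.trans[OF exp_ge_zero le])
  also have "(\<integral>x. 1 + - \<theta> * f x + \<theta>\<^sup>2 * exp_majorant x \<partial>stdN) = 1 - \<theta> * (\<integral>x. f x \<partial>stdN) + \<theta>\<^sup>2 * (\<integral>x. exp_majorant x \<partial>stdN)"
    using integrable_stdN_bounded[OF f] integrable_exp_majorant prob_stdN
      finite_measure.integrable_const[OF prob_space.finite_measure[OF prob_space_stdN], of "1::real"]
    by (subst Bochner_Integration.integral_add) (simp_all add: Bochner_Integration.integral_diff)
  also have "\<dots> \<le> 1 + (- \<theta> * c + \<theta>\<^sup>2 * (\<integral>x. exp_majorant x \<partial>stdN))"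
    using c \<theta> by (simp add: mult_left_mono)
  also have "\<dots> \<le> exp (- \<theta> * c + \<theta>\<^sup>2 * (\<integral>x. exp_majorant x \<partial>stdN))" by (rule exp_ge_add_one_self)
  finally show ?thesis by (simp add: ennreal_leI)
qed

text \<open>The exponential moment factors over independent coordinates. The functions may vary with
  the coordinate because those in \<open>T\<close> and outside it behave differently.\<close>

lemma gauss_sum_chernoff:
  fixes f :: "nat \<Rightarrow> real \<Rightarrow> real"
  assumes f: "\<And>i. f i \<in> borel_measurable borel" "\<And>i x. \<bar>f i x\<bar> \<le> 1 + \<bar>x\<bar>"
    and \<theta>: "0 < \<theta>" "\<theta> \<le> 1" and c: "\<And>i. c i \<le> (\<integral>x. f i x \<partial>stdN)"
  shows "{h \<in> space (gauss {..<n}). (\<Sum>i<n. f i (h i)) \<le> s} \<in> sets (gauss {..<n})" (is ?meas)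
    and "measure (gauss {..<n}) {h \<in> space (gauss {..<n}). (\<Sum>i<n. f i (h i)) \<le> s}
      \<le> exp (\<theta> * s - \<theta> * (\<Sum>i<n. c i) + \<theta>\<^sup>2 * (\<integral>x. exp_majorant x \<partial>stdN) * real n)"
proof -
  let ?Y = "gauss {..<n}"
  let ?S = "{h \<in> space ?Y. (\<Sum>i<n. f i (h i)) \<le> s}"
  let ?C = "\<integral>x. exp_majorant x \<partial>stdN"
  have "(\<lambda>h. \<Sum>i<n. f i (h i)) \<in> borel_measurable ?Y"
    by (intro borel_measurable_sum measurable_compose[OF measurable_gvec f(1)]) simp
  then show S: ?meas by (rule sets_Collect_le_const)
  have "emeasure ?Y ?S = (\<integral>\<^sup>+h. indicator ?S h \<partial>?Y)" by (rule nn_integral_indicator[OF S, symmetric])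
  also have "\<dots> \<le> (\<integral>\<^sup>+h. ennreal (exp (\<theta> * s)) * (\<Prod>i<n. ennreal (exp (- \<theta> * f i (h i)))) \<partial>?Y)"
  proof (intro nn_integral_mono)
    fix h
    have "ennreal (exp (\<theta> * s)) * (\<Prod>i<n. ennreal (exp (- \<theta> * f i (h i)))) = ennreal (exp (\<theta> * s + (\<Sum>i<n. - \<theta> * f i (h i))))"
      by (subst prod_ennreal) (simp_all add: exp_add exp_sum ennreal_mult prod_nonneg)
    also have "(\<Sum>i<n. - \<theta> * f i (h i)) = - \<theta> * (\<Sum>i<n. f i (h i))"
      by (rule sum_distrib_left[symmetric])
    also have "\<theta> * s + - \<theta> * (\<Sum>i<n. f i (h i)) = \<theta> * (s - (\<Sum>i<n. f i (h i)))"
      by (simp add: algebra_simps)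
    finally have eq: "ennreal (exp (\<theta> * s)) * (\<Prod>i<n. ennreal (exp (- \<theta> * f i (h i)))) = ennreal (exp (\<theta> * (s - (\<Sum>i<n. f i (h i)))))" .
    show "indicator ?S h \<le> ennreal (exp (\<theta> * s)) * (\<Prod>i<n. ennreal (exp (- \<theta> * f i (h i))))"
      unfolding eq using \<theta> by (auto simp: indicator_def)
  qed
  also have "\<dots> = ennreal (exp (\<theta> * s)) * (\<integral>\<^sup>+h. (\<Prod>i<n. ennreal (exp (- \<theta> * f i (h i)))) \<partial>?Y)"
  proof (rule nn_integral_cmult, intro borel_measurable_prod_ennreal)
    fix i assume "i \<in> {..<n}"
    then have "(\<lambda>h. f i (h i)) \<in> borel_measurable ?Y"
      by (intro measurable_compose[OF measurable_gvec f(1)]) simp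
    then show "(\<lambda>h. ennreal (exp (- \<theta> * f i (h i)))) \<in> borel_measurable ?Y" by measurable
  qed
  also have "(\<integral>\<^sup>+h. (\<Prod>i<n. ennreal (exp (- \<theta> * f i (h i)))) \<partial>?Y) = (\<Prod>i<n. \<integral>\<^sup>+x. ennreal (exp (- \<theta> * f i x)) \<partial>stdN)"
    unfolding gauss_def
  proof (rule stdN.product_nn_integral_prod)
    fix i
    have "(\<lambda>y. ennreal (exp (- \<theta> * y))) \<in> borel_measurable borel" by measurable
    from measurable_compose[OF borel_measurable_stdN[OF f(1)] this]
    show "(\<lambda>x. ennreal (exp (- \<theta> * f i x))) \<in> borel_measurable stdN" .
  qed simp
  finally have 1: "emeasure ?Y ?S \<le> ennreal (exp (\<theta> * s)) * (\<Prod>i<n. \<integral>\<^sup>+x. ennreal (exp (- \<theta> * f i x)) \<partial>stdN)" .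
  have "(\<Prod>i<n. \<integral>\<^sup>+x. ennreal (exp (- \<theta> * f i x)) \<partial>stdN) \<le> (\<Prod>i<n. ennreal (exp (- \<theta> * c i + \<theta>\<^sup>2 * ?C)))"
    by (intro prod_mono_ennreal nn_integral_exp_le f \<theta> c)
  also have "\<dots> = ennreal (exp (\<Sum>i<n. - \<theta> * c i + \<theta>\<^sup>2 * ?C))"
    by (subst prod_ennreal) (simp_all add: exp_sum)
  also have "(\<Sum>i<n. - \<theta> * c i + \<theta>\<^sup>2 * ?C) = - \<theta> * (\<Sum>i<n. c i) + \<theta>\<^sup>2 * ?C * real n"
    by (simp only: sum.distrib sum_distrib_left[symmetric] sum_constant) simp
  finally have "emeasure ?Y ?S \<le> ennreal (exp (\<theta> * s)) * ennreal (exp (- \<theta> * (\<Sum>i<n. c i) + \<theta>\<^sup>2 * ?C * real n))"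
    by (intro order.trans[OF 1] mult_left_mono) auto
  also have "\<dots> = ennreal (exp (\<theta> * s - \<theta> * (\<Sum>i<n. c i) + \<theta>\<^sup>2 * ?C * real n))"
    by (simp add: ennreal_mult[symmetric] exp_add[symmetric])
  finally show "measure ?Y ?S \<le> exp (\<theta> * s - \<theta> * (\<Sum>i<n. c i) + \<theta>\<^sup>2 * ?C * real n)"
    unfolding finite_measure.emeasure_eq_measure[OF prob_space.finite_measure[OF prob_space_gauss]]
    by (simp only: ennreal_le_iff[OF exp_ge_zero])
qed

section \<open>Symmetry of the normal law and subadditivity of powers\<close>

lemma integral_stdN_eq:
  fixes f :: "real \<Rightarrow> real"
  assumes "f \<in> borel_measurable borel"
  shows "(\<integral>x. f x \<partial>stdN) = (\<integral>x. std_normal_density x * f x \<partial>lborel)"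
proof -
  have f: "f \<in> borel_measurable lborel"
    using assms measurable_cong_sets[OF sets_lborel refl] by blast
  have d: "std_normal_density \<in> borel_measurable lborel"
    using borel_measurable_normal_density measurable_cong_sets[OF sets_lborel refl] by blast
  have "0 \<le> std_normal_density x" for x by (rule normal_density_nonneg)
  from integral_density[OF f d AE_I2[OF this]] show ?thesis
    by (simp only: real_scaleR_def)
qed

lemma integral_stdN_uminus:
  fixes f :: "real \<Rightarrow> real"
  assumes "f \<in> borel_measurable borel"
  shows "(\<integral>x. f (- x) \<partial>stdN) = (\<integral>x. f x \<partial>stdN)"
proof -
  have m: "(\<lambda>x. f (- x)) \<in> borel_measurable borel"
    by (rule measurable_compose[OF borel_measurable_uminus[OF measurable_ident_sets[OF refl]] assms])
  have "(\<integral>x. std_normal_density x * f x \<partial>lborel) = (\<integral>x. std_normal_density (- x) * f (- x) \<partial>lborel)"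
    using lborel_integral_real_affine[of "-1" "\<lambda>x. std_normal_density x * f x" 0] by simp
  then show ?thesis
    unfolding integral_stdN_eq[OF assms] integral_stdN_eq[OF m] by (simp only: std_normal_density_def power2_minus)
qed

text \<open>For a fraction z / s in [0, 1] the power with exponent \<open>p \<le> 1\<close> is at
  least z / s itself; apply this to both shares of the sum. The convention
  \<open>0 powr 0 = 0\<close> keeps \<open>p = 0\<close> valid.\<close>

lemma powr_subadd:
  fixes x y p :: real
  assumes "0 \<le> x" "0 \<le> y" "0 \<le> p" "p \<le> 1"
  shows "(x + y) powr p \<le> x powr p + y powr p"
proof (cases "x + y = 0")
  case True then show ?thesis by simp
next
  case False
  define s where "s = x + y"
  have s: "0 < s" using False assms by (simp add: s_def)
  have le: "z / s * s powr p \<le> z powr p" if "0 \<le> z" "z \<le> s" for z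
  proof -
    have "z / s = (z / s) powr 1" using that s by simp
    also have "\<dots> \<le> (z / s) powr p" using that s assms by (intro powr_mono') auto
    finally have "z / s * s powr p \<le> (z / s) powr p * s powr p" by (intro mult_right_mono) auto
    also have "\<dots> = z powr p" using that s by (simp add: powr_mult[symmetric])
    finally show ?thesis .
  qed
  have "s powr p = x / s * s powr p + y / s * s powr p"
    using s by (simp add: s_def add_divide_distrib[symmetric] distrib_right[symmetric])
  also have "\<dots> \<le> x powr p + y powr p" using assms by (intro add_mono le) (auto simp: s_def)
  finally show ?thesis by (simp add: s_def)
qed

lemma powr_abs_diff_le:
  fixes a b p :: real
  assumes "0 \<le> a" "0 \<le> b" "0 \<le> p" "p \<le> 1"
  shows "\<bar>a powr p - b powr p\<bar> \<le> \<bar>a - b\<bar> powr p"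
proof -
  have *: "\<bar>y powr p - x powr p\<bar> \<le> (y - x) powr p" if "0 \<le> x" "x \<le> y" for x y :: real
  proof -
    have "y powr p \<le> x powr p + (y - x) powr p"
      using powr_subadd[of x "y - x" p] that assms by simp
    moreover have "x powr p \<le> y powr p" using that assms by (intro powr_mono2) auto
    ultimately show ?thesis by simp
  qed
  show ?thesis
    using *[of a b] *[of b a] assms by (cases "a \<le> b") (simp_all add: abs_minus_commute)
qed

section \<open>Test functions and the recovery criterion\<close>

text \<open>
  The functions \<open>\<phi>\<close> and \<open>\<psi>\<close> relax the two sides of the cone inequality. For \<open>p > 0\<close> no loss is needed;
  for \<open>p = 0\<close> the summands \<open>\<bar>x\<bar> powr 0\<close> (which are \<open>0\<close> at \<open>x = 0\<close>) are discontinuous and are replaced by ramps.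
\<close>

definition admissible :: "real \<Rightarrow> (real \<Rightarrow> real) \<Rightarrow> (real \<Rightarrow> real) \<Rightarrow> bool" where
  "admissible p \<phi> \<psi> \<longleftrightarrow> \<phi> \<in> borel_measurable borel \<and> \<psi> \<in> borel_measurable borel \<and>
     (\<forall>x. 0 \<le> \<phi> x \<and> \<phi> x \<le> 1 + \<bar>x\<bar>) \<and> (\<forall>x. 0 \<le> \<psi> x \<and> \<psi> x \<le> 1 + \<bar>x\<bar>) \<and>
     (\<forall>\<zeta>>0. \<exists>C>0. \<forall>s t. \<bar>\<phi> s - \<phi> t\<bar> \<le> \<zeta> + C * (s - t)\<^sup>2 \<and> \<bar>\<psi> s - \<psi> t\<bar> \<le> \<zeta> + C * (s - t)\<^sup>2) \<and>
     (\<forall>x. \<psi> x \<le> \<bar>x\<bar> powr p) \<and> (\<forall>x<0. \<bar>x\<bar> powr p \<le> \<phi> x)"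

text \<open>Below \<open>\<zeta> powr (1 / p)\<close> the power is at most \<zeta>; above it,
  \<open>x powr (p - 2)\<close> is decreasing. The quadratic form is chosen so that summing over
  coordinates produces a squared Euclidean distance.\<close>

lemma powr_le_quadratic:
  fixes p \<zeta> :: real
  assumes "0 < p" "p < 1" "0 < \<zeta>"
  shows "\<exists>C>0. \<forall>x\<ge>0. x powr p \<le> \<zeta> + C * x\<^sup>2" 
proof -
  define x0 where "x0 = \<zeta> powr (1 / p)"
  have x0: "0 < x0" "x0 powr p = \<zeta>" using assms by (simp_all add: x0_def powr_powr)
  have "x powr p \<le> \<zeta> + x0 powr (p - 2) * x\<^sup>2" if "0 \<le> x" for x
  proof (cases "x \<le> x0")
    case True
    then have "x powr p \<le> x0 powr p" using that assms by (intro powr_mono2) auto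
    moreover have "0 \<le> x0 powr (p - 2) * x\<^sup>2" by simp
    ultimately show ?thesis using x0 by linarith
  next
    case False
    then have x: "x0 < x" "0 < x" using x0 by auto
    have "x powr p = x powr (p - 2) * x powr 2" by (simp add: powr_add[symmetric])
    also have "\<dots> \<le> x0 powr (p - 2) * x powr 2"
      using x x0 assms by (intro mult_right_mono powr_mono2') auto
    also have "x powr 2 = x\<^sup>2" using x by simp
    finally show ?thesis using assms by simp
  qed
  then show ?thesis using x0 by (intro exI[of _ "x0 powr (p - 2)"]) auto
qed

lemma powr_le_one_plus: "0 \<le> p \<Longrightarrow> p \<le> 1 \<Longrightarrow> \<bar>x\<bar> powr p \<le> 1 + \<bar>x\<bar>" for x p :: real
proof (cases "\<bar>x\<bar> \<le> 1")
  case True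
  assume "0 \<le> p" "p \<le> 1"
  with True have "\<bar>x\<bar> powr p \<le> 1 powr p" by (intro powr_mono2) auto
  then show ?thesis by simp
next
  case False
  assume "0 \<le> p" "p \<le> 1"
  with False have "\<bar>x\<bar> powr p \<le> \<bar>x\<bar> powr 1" by (intro powr_mono) auto
  then show ?thesis by simp
qed

lemma integral_stdN_pos:
  assumes "f \<in> borel_measurable borel" "\<And>x. 0 \<le> f x" "\<And>x. f x \<le> 1 + \<bar>x\<bar>" "\<And>x. x \<noteq> 0 \<Longrightarrow> 0 < f x"
  shows "0 < (\<integral>x. f x \<partial>stdN)"
proof (rule ccontr)
  assume "\<not> ?thesis"
  moreover have "0 \<le> (\<integral>x. f x \<partial>stdN)" using assms(2) by (intro integral_nonneg_AE) auto
  ultimately have "(\<integral>x. f x \<partial>stdN) = 0" by linarith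
  moreover have "integrable stdN f"
    by (rule integrable_stdN_bounded[OF assms(1)]) (simp add: assms(2,3))
  ultimately have "AE x in stdN. f x = 0"
    using integral_nonneg_eq_0_iff_AE[of stdN f] assms(2) by simp
  moreover have "AE x in stdN. x \<notin> {0}"
    by (rule AE_not_in) (simp add: null_sets_def emeasure_stdN_singleton)
  ultimately have "AE x in stdN. False"
    by eventually_elim (use assms(4) in force)
  then show False using prob_space.AE_False[OF prob_space_stdN] by simp
qed

lemma admissible_pos:
  assumes p: "0 < p" "p < 1" and r: "0 \<le> r" "r < 2/3"
  shows "\<exists>\<phi> \<psi>. admissible p \<phi> \<psi> \<and> r * (\<integral>x. \<phi> x \<partial>stdN) < (1 - r) * (\<integral>x. \<psi> x \<partial>stdN)"
proof -
  define \<phi> where "\<phi> s = (max 0 (- s)) powr p" for s :: real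
  define \<psi> where "\<psi> t = \<bar>t\<bar> powr p" for t :: real
  have m\<phi>: "\<phi> \<in> borel_measurable borel" unfolding \<phi>_def[abs_def] by measurable
  have m\<psi>: "\<psi> \<in> borel_measurable borel" unfolding \<psi>_def[abs_def] by measurable
  have \<phi>\<psi>: "0 \<le> \<phi> x" "\<phi> x \<le> \<psi> x" for x
    using p by (auto simp: \<phi>_def \<psi>_def intro!: powr_mono2)
  have \<psi>1: "\<psi> x \<le> 1 + \<bar>x\<bar>" for x unfolding \<psi>_def using p by (intro powr_le_one_plus) auto
  have mod: "\<exists>C>0. \<forall>s t. \<bar>\<phi> s - \<phi> t\<bar> \<le> \<zeta> + C * (s - t)\<^sup>2 \<and> \<bar>\<psi> s - \<psi> t\<bar> \<le> \<zeta> + C * (s - t)\<^sup>2" if z: "0 < \<zeta>" for \<zeta>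
  proof -
    obtain C where C: "0 < C" "\<And>x. 0 \<le> x \<Longrightarrow> x powr p \<le> \<zeta> + C * x\<^sup>2"
      using powr_le_quadratic[OF p z] by auto
    have *: "\<bar>a powr p - b powr p\<bar> \<le> \<zeta> + C * (s - t)\<^sup>2" if "0 \<le> a" "0 \<le> b" "\<bar>a - b\<bar> \<le> \<bar>s - t\<bar>" for a b s t :: real
    proof -
      have "\<bar>a powr p - b powr p\<bar> \<le> \<bar>a - b\<bar> powr p" using that p by (intro powr_abs_diff_le) auto
      also have "\<dots> \<le> \<bar>s - t\<bar> powr p" using that p by (intro powr_mono2) auto
      also have "\<dots> \<le> \<zeta> + C * (s - t)\<^sup>2" using C(2)[of "\<bar>s - t\<bar>"] by simp
      finally show ?thesis .
    qed
    show ?thesis unfolding \<phi>_def \<psi>_def using C(1) by (intro exI[of _ C] conjI allI *) auto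
  qed
  have adm: "admissible p \<phi> \<psi>"
    unfolding admissible_def
  proof (intro conjI allI impI m\<phi> m\<psi> \<phi>\<psi> \<psi>1 mod order.trans[OF \<phi>\<psi>(2) \<psi>1])
    show "\<psi> x \<le> \<bar>x\<bar> powr p" "0 \<le> \<psi> x" for x by (simp_all add: \<psi>_def)
    show "\<bar>x\<bar> powr p \<le> \<phi> x" if "x < 0" for x using that by (simp add: \<phi>_def)
  qed
  have int: "integrable stdN \<phi>" "integrable stdN (\<lambda>x. \<phi> (- x))"
  proof -
    have b: "\<bar>\<phi> x\<bar> \<le> 1 + \<bar>x\<bar>" for x using \<phi>\<psi>[of x] \<psi>1[of x] by linarith
    show "integrable stdN \<phi>" by (rule integrable_stdN_bounded[OF m\<phi> b])
    show "integrable stdN (\<lambda>x. \<phi> (- x))"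
      using b[of "- x" for x]
      by (intro integrable_stdN_bounded measurable_compose[OF borel_measurable_uminus[OF measurable_ident_sets[OF refl]] m\<phi>]) simp
  qed
  \<comment> \<open>By symmetry the negative half carries half of the mean, so the gap amounts to r
    < 2 * (1 - r), the origin of 2/3.\<close>
  have "\<psi> = (\<lambda>x. \<phi> x + \<phi> (- x))" by (auto simp: \<phi>_def \<psi>_def fun_eq_iff max_def)
  then have "(\<integral>x. \<psi> x \<partial>stdN) = 2 * (\<integral>x. \<phi> x \<partial>stdN)"
    using Bochner_Integration.integral_add[OF int] integral_stdN_uminus[OF m\<phi>] by simp
  moreover have "0 < (\<integral>x. \<psi> x \<partial>stdN)"
    by (rule integral_stdN_pos[OF m\<psi> _ \<psi>1]) (auto simp: \<psi>_def)
  ultimately have "r * (\<integral>x. \<phi> x \<partial>stdN) < (1 - r) * (\<integral>x. \<psi> x \<partial>stdN)"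
    using mult_strict_right_mono[of r "2 * (1 - r)" "\<integral>x. \<phi> x \<partial>stdN"] r by simp
  with adm show ?thesis by blast
qed

lemma measure_stdN_Icc_le:
  assumes "0 \<le> \<delta>"
  shows "measure stdN {-\<delta>..\<delta>} \<le> 2 * \<delta>"
proof -
  have d1: "std_normal_density x \<le> 1" for x
  proof -
    have "1 \<le> sqrt (2 * pi)" using pi_ge_two by simp
    then have "1 / sqrt (2 * pi) * exp (- x\<^sup>2 / 2) \<le> 1 * 1" by (intro mult_mono) auto
    then show ?thesis by (simp add: std_normal_density_def)
  qed
  have "emeasure stdN {-\<delta>..\<delta>} = (\<integral>\<^sup>+x. ennreal (std_normal_density x) * indicator {-\<delta>..\<delta>} x \<partial>lborel)"
    by (subst emeasure_density) auto
  also have "\<dots> \<le> (\<integral>\<^sup>+x. indicator {-\<delta>..\<delta>} x \<partial>lborel)"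
    using d1 by (intro nn_integral_mono) (auto simp: indicator_def)
  also have "\<dots> = ennreal (2 * \<delta>)" using assms by simp
  finally show ?thesis
    unfolding finite_measure.emeasure_eq_measure[OF prob_space.finite_measure[OF prob_space_stdN]]
    using assms by (subst (asm) ennreal_le_iff) auto
qed

lemma admissible_zero:
  assumes r: "0 \<le> r" "r < 2/3"
  shows "\<exists>\<phi> \<psi>. admissible 0 \<phi> \<psi> \<and> r * (\<integral>x. \<phi> x \<partial>stdN) < (1 - r) * (\<integral>x. \<psi> x \<partial>stdN)"
proof -
  \<comment> \<open>The ramp width \<delta> perturbs the means by O(\<delta>); a quarter of the
    slack 1 - 3 * r / 2 is small enough to preserve the gap.\<close>
  define \<delta> where "\<delta> = (1 - 3 * r / 2) / 4"
  have \<delta>: "0 < \<delta>" using r by (simp add: \<delta>_def)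
  define \<phi> where "\<phi> s = max 0 (min 1 (1 - s / \<delta>))" for s :: real
  define \<psi> where "\<psi> t = min 1 (\<bar>t\<bar> / \<delta>)" for t :: real
  have m\<phi>: "\<phi> \<in> borel_measurable borel" unfolding \<phi>_def[abs_def] by measurable
  have m\<psi>: "\<psi> \<in> borel_measurable borel" unfolding \<psi>_def[abs_def] by measurable
  have b\<phi>: "0 \<le> \<phi> x" "\<phi> x \<le> 1" for x by (auto simp: \<phi>_def)
  have b\<psi>: "0 \<le> \<psi> x" "\<psi> x \<le> 1" for x using \<delta> by (auto simp: \<psi>_def)
  have lip: "\<bar>\<phi> s - \<phi> t\<bar> \<le> \<bar>s - t\<bar> / \<delta>" "\<bar>\<psi> s - \<psi> t\<bar> \<le> \<bar>s - t\<bar> / \<delta>" for s t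
  proof -
    have "\<bar>\<phi> s - \<phi> t\<bar> \<le> \<bar>s / \<delta> - t / \<delta>\<bar>" by (auto simp: \<phi>_def max_def min_def)
    also have "s / \<delta> - t / \<delta> = (s - t) / \<delta>" by (simp add: diff_divide_distrib)
    finally show "\<bar>\<phi> s - \<phi> t\<bar> \<le> \<bar>s - t\<bar> / \<delta>" using \<delta> by simp
    have "\<bar>\<psi> s - \<psi> t\<bar> \<le> \<bar>\<bar>s\<bar> / \<delta> - \<bar>t\<bar> / \<delta>\<bar>" by (auto simp: \<psi>_def min_def)
    also have "\<bar>s\<bar> / \<delta> - \<bar>t\<bar> / \<delta> = (\<bar>s\<bar> - \<bar>t\<bar>) / \<delta>" by (simp add: diff_divide_distrib)
    also have "\<bar>(\<bar>s\<bar> - \<bar>t\<bar>) / \<delta>\<bar> = \<bar>\<bar>s\<bar> - \<bar>t\<bar>\<bar> / \<delta>" using \<delta> by simp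
    also have "\<dots> \<le> \<bar>s - t\<bar> / \<delta>" using \<delta> by (intro divide_right_mono) auto
    finally show "\<bar>\<psi> s - \<psi> t\<bar> \<le> \<bar>s - t\<bar> / \<delta>" .
  qed
  have mod: "\<exists>C>0. \<forall>s t. \<bar>\<phi> s - \<phi> t\<bar> \<le> \<zeta> + C * (s - t)\<^sup>2 \<and> \<bar>\<psi> s - \<psi> t\<bar> \<le> \<zeta> + C * (s - t)\<^sup>2" if "0 < \<zeta>" for \<zeta>
  proof -
    \<comment> \<open>The Lipschitz bound becomes quadratic by completing the square.\<close>
    have *: "\<bar>x\<bar> / \<delta> \<le> \<zeta> + 1 / (4 * \<zeta> * \<delta>\<^sup>2) * x\<^sup>2" for x
    proof -
      have "0 \<le> (\<bar>x\<bar> / \<delta> - 2 * \<zeta>)\<^sup>2 / (4 * \<zeta>)" using that by simp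
      also have "\<dots> = \<zeta> + 1 / (4 * \<zeta> * \<delta>\<^sup>2) * x\<^sup>2 - \<bar>x\<bar> / \<delta>"
      proof -
        have "(\<bar>x\<bar> / \<delta> - 2 * \<zeta>)\<^sup>2 = x\<^sup>2 / \<delta>\<^sup>2 - 4 * \<zeta> * (\<bar>x\<bar> / \<delta>) + 4 * \<zeta>\<^sup>2"
          by (simp add: power2_diff power_divide power_mult_distrib)
        then show ?thesis using that \<delta> by (simp add: field_simps power2_eq_square)
      qed
      finally show ?thesis by simp
    qed
    show ?thesis
      using that \<delta> order.trans[OF lip(1) *] order.trans[OF lip(2) *]
      by (intro exI[of _ "1 / (4 * \<zeta> * \<delta>\<^sup>2)"]) simp
  qed
  have b1: "\<phi> x \<le> 1 + \<bar>x\<bar>" "\<psi> x \<le> 1 + \<bar>x\<bar>" for x using b\<phi>(2)[of x] b\<psi>(2)[of x] by auto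
  have \<psi>p: "\<psi> x \<le> \<bar>x\<bar> powr 0" for x using b\<psi>(2)[of x] by (cases "x = 0") (auto simp: \<psi>_def)
  have \<phi>p: "\<bar>x\<bar> powr 0 \<le> \<phi> x" if "x < 0" for x
  proof -
    have "x / \<delta> < 0" using that \<delta> by (simp add: divide_less_0_iff)
    then show ?thesis using that by (simp add: \<phi>_def)
  qed
  have adm: "admissible 0 \<phi> \<psi>"
    unfolding admissible_def by (intro conjI allI impI m\<phi> m\<psi> b\<phi> b\<psi> b1 mod \<psi>p \<phi>p)
  have int: "integrable stdN \<phi>" "integrable stdN (\<lambda>x. \<phi> (- x))" "integrable stdN \<psi>"
  proof -
    have b: "\<bar>\<phi> x\<bar> \<le> 1 + \<bar>x\<bar>" "\<bar>\<psi> x\<bar> \<le> 1 + \<bar>x\<bar>" for x using b\<phi>[of x] b\<psi>[of x] by linarith+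
    show "integrable stdN \<phi>" by (rule integrable_stdN_bounded[OF m\<phi> b(1)])
    show "integrable stdN \<psi>" by (rule integrable_stdN_bounded[OF m\<psi> b(2)])
    show "integrable stdN (\<lambda>x. \<phi> (- x))"
      using b(1)[of "- x" for x]
      by (intro integrable_stdN_bounded measurable_compose[OF borel_measurable_uminus[OF measurable_ident_sets[OF refl]] m\<phi>]) simp
  qed
  have int1: "integrable stdN (\<lambda>x. c :: real)" for c
    by (rule finite_measure.integrable_const[OF prob_space.finite_measure[OF prob_space_stdN]])
  \<comment> \<open>For \<open>0 \<le> x\<close> one has \<phi> (- x) = 1 and \<phi> x = 1 - \<psi>
    x. Unlike for \<open>p > 0\<close>, the two halves of \<phi> do not add up to \<psi>, because
    the ramps overlap near 0.\<close>
  have sym: "\<phi> x + \<phi> (- x) = 2 - \<psi> x" for x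
    using \<delta> by (cases "0 \<le> x") (auto simp: \<phi>_def \<psi>_def max_def min_def divide_le_0_iff zero_le_divide_iff)
  have "2 * (\<integral>x. \<phi> x \<partial>stdN) = (\<integral>x. \<phi> x + \<phi> (- x) \<partial>stdN)"
    using Bochner_Integration.integral_add[OF int(1,2)] integral_stdN_uminus[OF m\<phi>] by simp
  also have "\<dots> = 2 - (\<integral>x. \<psi> x \<partial>stdN)"
    unfolding sym by (subst Bochner_Integration.integral_diff[OF int1 int(3)]) (use prob_stdN in simp)
  finally have \<nu>: "(\<integral>x. \<phi> x \<partial>stdN) = 1 - (\<integral>x. \<psi> x \<partial>stdN) / 2" by simp
  have intI: "integrable stdN (indicator {-\<delta>..\<delta>} :: real \<Rightarrow> real)"
    by (rule integrable_real_indicator)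
       (simp_all add: finite_measure.emeasure_eq_measure[OF prob_space.finite_measure[OF prob_space_stdN]])
  have "1 - 2 * \<delta> \<le> 1 - measure stdN {-\<delta>..\<delta>}" using measure_stdN_Icc_le[of \<delta>] \<delta> by simp
  also have "\<dots> = (\<integral>x. 1 - indicator {-\<delta>..\<delta>} x \<partial>stdN)"
    by (subst Bochner_Integration.integral_diff[OF int1 intI]) (use prob_stdN in simp_all)
  also have "\<dots> \<le> (\<integral>x. \<psi> x \<partial>stdN)"
  proof (rule integral_mono)
    show "integrable stdN (\<lambda>x. 1 - indicator {-\<delta>..\<delta>} x :: real)"
      by (intro Bochner_Integration.integrable_diff int1 intI)
    show "1 - indicator {-\<delta>..\<delta>} x \<le> \<psi> x" for x
      using \<delta> b\<psi>(1)[of x] by (auto simp: indicator_def \<psi>_def min_def field_simps)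
  qed (rule int)
  finally have \<mu>: "1 - 2 * \<delta> \<le> (\<integral>x. \<psi> x \<partial>stdN)" .
  \<comment> \<open>With \<nu> = 1 - \<mu> / 2 the required gap is equivalent to r < \<mu> * (1 - r
    / 2).\<close>
  have "r < (1 - 2 * \<delta>) * (1 - r / 2)"
  proof -
    have "(1 - 2 * \<delta>) * (1 - r / 2) = 1 / 2 + r / 2 - (r / 2) * (3 * r / 4) + 0 * r"
      by (simp add: \<delta>_def field_simps)
    moreover have "(r / 2) * (3 * r / 4) \<le> (r / 2) * (1 / 2)" using r by (intro mult_left_mono) auto
    ultimately show ?thesis using r by simp
  qed
  also have "\<dots> \<le> (\<integral>x. \<psi> x \<partial>stdN) * (1 - r / 2)" using \<mu> r by (intro mult_right_mono) auto
  finally have "r * (\<integral>x. \<phi> x \<partial>stdN) < (1 - r) * (\<integral>x. \<psi> x \<partial>stdN)"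
    unfolding \<nu> by (simp add: field_simps)
  with adm show ?thesis by blast
qed

section \<open>The cone of bad directions and recovery\<close>

text \<open>A necessary condition for a step \<open>w\<close> from a signal not to increase the
  objective. The magnitudes of the signal have dropped out, so one condition serves all signals with
  the given support and signs.\<close>

definition bad :: "real \<Rightarrow> nat \<Rightarrow> nat set \<Rightarrow> (nat \<Rightarrow> real) \<Rightarrow> (nat \<Rightarrow> real) \<Rightarrow> bool" where
  "bad p n T \<sigma> w \<longleftrightarrow> (\<Sum>i\<in>{..<n} - T. \<bar>w i\<bar> powr p) \<le> (\<Sum>i\<in>T. if \<sigma> i * w i < 0 then \<bar>w i\<bar> powr p else 0)"

definition sign_stat :: "nat set \<Rightarrow> (nat \<Rightarrow> real) \<Rightarrow> (real \<Rightarrow> real) \<Rightarrow> (real \<Rightarrow> real) \<Rightarrow> nat \<Rightarrow> real \<Rightarrow> real" where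
  "sign_stat T \<sigma> \<phi> \<psi> i x = (if i \<in> T then - \<phi> (\<sigma> i * x) else \<psi> x)"

lemma bad_scale:
  assumes "0 < r" "bad p n T \<sigma> w"
  shows "bad p n T \<sigma> (\<lambda>i. r * w i)"
proof -
  have 1: "\<bar>r * w i\<bar> powr p = r powr p * \<bar>w i\<bar> powr p" for i
    using assms by (simp add: abs_mult powr_mult)
  have 2: "\<sigma> i * (r * w i) < 0 \<longleftrightarrow> \<sigma> i * w i < 0" for i
    using assms by (simp add: mult.left_commute[of _ r] mult_less_0_iff[of r])
  have "(\<Sum>i\<in>{..<n} - T. \<bar>r * w i\<bar> powr p) = r powr p * (\<Sum>i\<in>{..<n} - T. \<bar>w i\<bar> powr p)"
    unfolding 1 by (rule sum_distrib_left[symmetric])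
  also have "\<dots> \<le> r powr p * (\<Sum>i\<in>T. if \<sigma> i * w i < 0 then \<bar>w i\<bar> powr p else 0)"
    using assms by (intro mult_left_mono) (auto simp: bad_def)
  also have "\<dots> = (\<Sum>i\<in>T. if \<sigma> i * (r * w i) < 0 then \<bar>r * w i\<bar> powr p else 0)"
    unfolding 1 2 by (simp add: sum_distrib_left if_distrib cong: if_cong)
  finally show ?thesis by (simp add: bad_def)
qed

text \<open>\<psi> lies below the power and \<phi> above it on negative arguments, so the statistic
  is at most the homogeneous difference of the two sides. The scale \<open>r\<close> will be the
  length of \<open>h\<close>, and zero is covered by \<open>0 powr p = 0\<close>.\<close>

lemma stat_bad_le_0:
  assumes adm: "admissible p \<phi> \<psi>" and T: "T \<subseteq> {..<n}" "\<forall>i\<in>T. \<sigma> i = -1 \<or> \<sigma> i = 1"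
    and bad: "bad p n T \<sigma> w" and r: "0 \<le> r"
  shows "(\<Sum>i<n. sign_stat T \<sigma> \<phi> \<psi> i (r * w i)) \<le> 0"
proof -
  have 1: "\<bar>r * w i\<bar> powr p = r powr p * \<bar>w i\<bar> powr p" for i
    using r by (simp add: abs_mult powr_mult)
  have \<psi>: "\<psi> (r * w i) \<le> r powr p * \<bar>w i\<bar> powr p" for i
    using adm unfolding admissible_def 1[symmetric] by blast
  have \<phi>: "- \<phi> (\<sigma> i * (r * w i)) \<le> - (r powr p * (if \<sigma> i * w i < 0 then \<bar>w i\<bar> powr p else 0))" if "i \<in> T" for i
  proof (cases "\<sigma> i * w i < 0 \<and> r \<noteq> 0")
    case True
    then have "\<sigma> i * (r * w i) < 0" using r by (simp add: mult.left_commute[of _ r] mult_less_0_iff[of r])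
    then have "\<bar>\<sigma> i * (r * w i)\<bar> powr p \<le> \<phi> (\<sigma> i * (r * w i))" using adm unfolding admissible_def by blast
    moreover have "\<bar>\<sigma> i * (r * w i)\<bar> = \<bar>r * w i\<bar>" using T(2) that by (auto simp: abs_mult)
    ultimately show ?thesis using True 1[of i] by simp
  next
    case False
    moreover have "0 \<le> \<phi> (\<sigma> i * (r * w i))" using adm unfolding admissible_def by blast
    ultimately show ?thesis by auto
  qed
  have fin: "finite T" using T(1) finite_subset by blast
  have "(\<Sum>i<n. sign_stat T \<sigma> \<phi> \<psi> i (r * w i)) = (\<Sum>i\<in>{..<n} - T. \<psi> (r * w i)) + (\<Sum>i\<in>T. - \<phi> (\<sigma> i * (r * w i)))"
    by (subst sum.subset_diff[OF T(1)]) (auto simp: sign_stat_def intro!: arg_cong2[where f="(+)"] sum.cong)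
  also have "\<dots> \<le> (\<Sum>i\<in>{..<n} - T. r powr p * \<bar>w i\<bar> powr p) + (\<Sum>i\<in>T. - (r powr p * (if \<sigma> i * w i < 0 then \<bar>w i\<bar> powr p else 0)))"
    by (intro add_mono sum_mono \<psi> \<phi>)
  also have "\<dots> = r powr p * ((\<Sum>i\<in>{..<n} - T. \<bar>w i\<bar> powr p) - (\<Sum>i\<in>T. if \<sigma> i * w i < 0 then \<bar>w i\<bar> powr p else 0))"
    by (simp only: sum_negf sum_distrib_left[symmetric]) (simp add: algebra_simps)
  also have "\<dots> \<le> 0" using bad by (intro mult_nonneg_nonpos) (auto simp: bad_def)
  finally show ?thesis .
qed

text \<open>Signs do not change squared differences, so the quadratic moduli add up to a squared
  distance. This transfers nonpositivity from the cone to vectors near it.\<close>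

lemma stat_diff_le:
  assumes C: "\<And>s t. \<bar>\<phi> s - \<phi> t\<bar> \<le> \<zeta> + C * (s - t)\<^sup>2" "\<And>s t. \<bar>\<psi> s - \<psi> t\<bar> \<le> \<zeta> + C * (s - t)\<^sup>2"
    and T: "\<forall>i\<in>T. \<sigma> i = -1 \<or> \<sigma> i = 1"
  shows "(\<Sum>i<n. sign_stat T \<sigma> \<phi> \<psi> i (h i)) \<le> (\<Sum>i<n. sign_stat T \<sigma> \<phi> \<psi> i (w i)) + (\<zeta> * n + C * ip n (\<lambda>i. h i - w i) (\<lambda>i. h i - w i))"
proof -
  have "sign_stat T \<sigma> \<phi> \<psi> i (h i) \<le> sign_stat T \<sigma> \<phi> \<psi> i (w i) + (\<zeta> + C * ((h i - w i) * (h i - w i)))" for i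
  proof (cases "i \<in> T")
    case True
    then have "(\<sigma> i * h i - \<sigma> i * w i)\<^sup>2 = (h i - w i) * (h i - w i)"
      using T by (auto simp: power2_eq_square algebra_simps)
    then show ?thesis using C(1)[of "\<sigma> i * h i" "\<sigma> i * w i"] True by (simp add: sign_stat_def)
  next
    case False
    then show ?thesis using C(2)[of "h i" "w i"] by (simp add: sign_stat_def power2_eq_square)
  qed
  then have "(\<Sum>i<n. sign_stat T \<sigma> \<phi> \<psi> i (h i)) \<le> (\<Sum>i<n. sign_stat T \<sigma> \<phi> \<psi> i (w i) + (\<zeta> + C * ((h i - w i) * (h i - w i))))"
    by (intro sum_mono)
  also have "\<dots> = (\<Sum>i<n. sign_stat T \<sigma> \<phi> \<psi> i (w i)) + (\<zeta> * n + C * ip n (\<lambda>i. h i - w i) (\<lambda>i. h i - w i))"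
    by (simp add: sum.distrib sum_distrib_left ip_def)
  finally show ?thesis .
qed

text \<open>Since \<open>x powr 0\<close> is 0 at 0 and 1 elsewhere, \<open>p = 0\<close> needs no
  separate recovery argument.\<close>

lemma lp_obj_eq: "lp_obj p n v = (\<Sum>i<n. \<bar>v i\<bar> powr p)"
proof (cases "p = 0")
  case True
  have "(\<Sum>i<n. \<bar>v i\<bar> powr 0) = (\<Sum>i<n. if v i \<noteq> 0 then 1 else 0)" by (intro sum.cong) auto
  also have "\<dots> = real (card {i \<in> {..<n}. v i \<noteq> 0})" by (simp add: sum.If_cases Int_def)
  finally show ?thesis using True by (simp add: lp_obj_def)
qed (simp add: lp_obj_def)

text \<open>Off \<open>T\<close> the competitor equals \<open>w\<close> and pays its full power sum;
  on \<open>T\<close> it gains at most the other side of the cone inequality. Dividing by the length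
  of \<open>w\<close> meets the normalisation in the hypothesis, since the cone is closed under
  positive scaling.\<close>

lemma unique_min_if_not_bad:
  assumes p: "0 \<le> p" "p \<le> 1" and T: "T \<subseteq> {..<n}"
    and A: "\<And>w. (\<forall>i<m. ip n (curry A i) w = 0) \<Longrightarrow> ip n w w = 1 \<Longrightarrow> \<not> bad p n T \<sigma> w"
    and x: "is_vec n x" "{i. x i \<noteq> 0} = T" "\<forall>i\<in>T. sgn (x i) = \<sigma> i"
  shows "unique_min p m n A x"
  unfolding unique_min_def
proof (intro allI impI, elim conjE)
  fix v assume v: "is_vec n v" "\<forall>i<m. mat_vec n A v i = mat_vec n A x i" "v \<noteq> x"
  define w where "w i = v i - x i" for i
  have "\<exists>i<n. w i \<noteq> 0"
    using v x(1) unfolding w_def is_vec_def by (metis ext eq_iff_diff_eq_0 not_less)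
  then have pos: "0 < ip n w w" by (simp add: ip_self_pos_iff ip_self_eq_0_iff)
  define r where "r = 1 / sqrt (ip n w w)"
  have r: "0 < r" "r * r * ip n w w = 1" using pos by (simp_all add: r_def real_sqrt_mult_self)
  have null: "ip n (curry A i) w = 0" if "i < m" for i
    using v(2) that by (simp add: mat_vec_def ip_def w_def right_diff_distrib sum_subtractf)
  have "\<not> bad p n T \<sigma> (\<lambda>i. r * w i)"
    by (rule A) (use null r in \<open>simp_all add: ip_scale_left ip_scale_right\<close>)
  then have "\<not> bad p n T \<sigma> w" using bad_scale[OF r(1)] by blast
  then have lt: "(\<Sum>i\<in>T. if \<sigma> i * w i < 0 then \<bar>w i\<bar> powr p else 0) < (\<Sum>i\<in>{..<n} - T. \<bar>w i\<bar> powr p)"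
    by (simp add: bad_def)
  \<comment> \<open>Moving against the sign saves at most \<open>\<bar>w i\<bar> powr p\<close> by
    subadditivity; otherwise the entry does not shrink in modulus.\<close>
  have T1: "\<bar>x i\<bar> powr p - (if \<sigma> i * w i < 0 then \<bar>w i\<bar> powr p else 0) \<le> \<bar>v i\<bar> powr p" if "i \<in> T" for i
  proof (cases "\<sigma> i * w i < 0")
    case True
    have "\<bar>x i\<bar> powr p \<le> (\<bar>v i\<bar> + \<bar>w i\<bar>) powr p" using p by (intro powr_mono2) (auto simp: w_def)
    also have "\<dots> \<le> \<bar>v i\<bar> powr p + \<bar>w i\<bar> powr p" using p by (intro powr_subadd) auto
    finally show ?thesis using True by simp
  next
    case False
    have s: "sgn (x i) = \<sigma> i" "x i \<noteq> 0" using x that by auto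
    have "\<not> sgn (x i) * w i < 0" using False s by simp
    then have "\<bar>x i\<bar> \<le> \<bar>v i\<bar>"
      using s(2) unfolding w_def by (cases "0 < x i") (auto simp: sgn_if split: if_splits)
    then show ?thesis using False p by (auto intro: powr_mono2)
  qed
  have "lp_obj p n x = (\<Sum>i\<in>{..<n} - T. \<bar>x i\<bar> powr p) + (\<Sum>i\<in>T. \<bar>x i\<bar> powr p)"
    unfolding lp_obj_eq by (rule sum.subset_diff[OF T]) simp
  also have "(\<Sum>i\<in>{..<n} - T. \<bar>x i\<bar> powr p) = 0" using x(2) by (intro sum.neutral) auto
  also have "0 + (\<Sum>i\<in>T. \<bar>x i\<bar> powr p) = (\<Sum>i\<in>T. if \<sigma> i * w i < 0 then \<bar>w i\<bar> powr p else 0) +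
      (\<Sum>i\<in>T. \<bar>x i\<bar> powr p - (if \<sigma> i * w i < 0 then \<bar>w i\<bar> powr p else 0))"
    by (simp add: sum_subtractf)
  also have "\<dots> < (\<Sum>i\<in>{..<n} - T. \<bar>w i\<bar> powr p) + (\<Sum>i\<in>T. \<bar>v i\<bar> powr p)"
    by (intro add_less_le_mono lt sum_mono T1)
  also have "(\<Sum>i\<in>{..<n} - T. \<bar>w i\<bar> powr p) = (\<Sum>i\<in>{..<n} - T. \<bar>v i\<bar> powr p)"
    using x(2) by (intro sum.cong) (auto simp: w_def)
  also have "\<dots> + (\<Sum>i\<in>T. \<bar>v i\<bar> powr p) = lp_obj p n v"
    unfolding lp_obj_eq by (rule sum.subset_diff[OF T, symmetric]) simp
  finally show "lp_obj p n x < lp_obj p n v" .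
qed

text \<open>Almost surely the first \<open>n\<close> rows exhaust the trace. The diagonal entries
  are squared lengths of projected unit vectors, so all vanish, and a null vector, being its own
  projection, is zero.\<close>

lemma null_space_trivial_event:
  assumes "n \<le> m"
  shows "\<exists>E\<in>sets (gauss ({..<m} \<times> {..<n})).
    (\<forall>A\<in>E. \<forall>w. (\<forall>i<m. ip n (curry A i) w = 0) \<longrightarrow> ip n w w = 0) \<and> measure (gauss ({..<m} \<times> {..<n})) E = 1"
proof -
  let ?X = "gauss ({..<m} \<times> {..<n})"
  let ?b = "\<lambda>A k. oproj n (curry A) k (curry A k)"
  define F where "F = {A \<in> space ?X. \<forall>k\<in>{..<n}. ip n (?b A k) (?b A k) \<noteq> 0}"
  have F: "F \<in> sets ?X"
    unfolding F_def
  proof (intro sets.sets_Collect_finite_All sets_Collect_ne_0 measurable_ip)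
    fix k i assume "k \<in> {..<n}" "i < n"
    with assms show "(\<lambda>A. ?b A k i) \<in> borel_measurable ?X" "(\<lambda>A. ?b A k i) \<in> borel_measurable ?X"
      unfolding curry_def by (intro measurable_oproj measurable_gmat; simp)+
  qed simp_all
  have "AE A in ?X. \<forall>k\<in>{..<n}. ip n (?b A k) (?b A k) \<noteq> 0"
    using assms by (intro AE_finite_allI AE_residue_ne_0) auto
  then have "AE A in ?X. A \<in> F" using AE_space by eventually_elim (auto simp: F_def)
  then have "measure ?X F = 1" using prob_space.prob_eq_1[OF prob_space_gauss F] by simp
  moreover have "ip n w w = 0" if A: "A \<in> F" and w: "\<forall>i<m. ip n (curry A i) w = 0" for A w
  proof -
    let ?P = "oproj n (curry A) n"
    have "{j. j < n \<and> ip n (?b A j) (?b A j) \<noteq> 0} = {..<n}" using A by (auto simp: F_def)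
    then have "(\<Sum>i<n. ?P (unit_vec i) i) = 0" by (simp add: trace_oproj)
    moreover have "0 \<le> ?P (unit_vec i) i" if "i < n" for i
      unfolding ip_oproj_unit_vec[OF that, symmetric] by simp
    ultimately have z: "?P (unit_vec i) i = 0" if "i < n" for i
      using that by (subst (asm) sum_nonneg_eq_0_iff) auto
    have "?P w = w" by (rule oproj_fix) (use w assms in auto)
    then have "w i = 0" if "i < n" for i
      using oproj_nth[OF that, of "curry A" n w] z[OF that]
        ip_eq_0_if_right[of n "?P (unit_vec i)" w] ip_oproj_unit_vec[OF that, of "curry A" n] by simp
    then show ?thesis by (simp add: ip_self_eq_0_iff)
  qed
  ultimately show ?thesis using F by blast
qed

section \<open>Choice of constants and conclusion\<close>

lemma admissible_modulus:
  assumes "admissible p \<phi> \<psi>" "0 < \<zeta>"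
  shows "\<exists>C>0. \<forall>s t. \<bar>\<phi> s - \<phi> t\<bar> \<le> \<zeta> + C * (s - t)\<^sup>2 \<and> \<bar>\<psi> s - \<psi> t\<bar> \<le> \<zeta> + C * (s - t)\<^sup>2"
  using assms unfolding admissible_def by blast

theorem theorem6:
  fixes p \<rho> :: real
  assumes "0 \<le> p" "p < 1" "\<rho> < 2/3"
  shows "\<exists>c7 c8. 0 < c7 \<and> c7 < 1 \<and> 0 < c8 \<and>
    (\<exists>N. \<forall>n m. n \<ge> N \<longrightarrow> real m / real n > c7 \<longrightarrow>
      (\<forall>T \<sigma>. T \<subseteq> {..<n} \<longrightarrow> real (card T) \<le> \<rho> * real m \<longrightarrow>
         (\<forall>i\<in>T. \<sigma> i = -1 \<or> \<sigma> i = (1::real)) \<longrightarrow>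
         (\<exists>E \<in> sets (gauss_mat m n).
            E \<subseteq> {A \<in> space (gauss_mat m n). \<forall>x. is_vec n x \<and> {i. x i \<noteq> 0} = T
                    \<and> (\<forall>i\<in>T. sgn (x i) = \<sigma> i) \<longrightarrow> unique_min p m n A x}
            \<and> measure (gauss_mat m n) E \<ge> 1 - exp (- c8 * real n))))"
proof -
  \<comment> \<open>\<rho> may be negative; raising it to 0 only weakens the bound on the support
    and keeps r < 2/3.\<close>
  define r where "r = max \<rho> 0"
  have r: "0 \<le> r" "r < 2/3" "\<rho> \<le> r" using assms by (auto simp: r_def)
  obtain \<phi> \<psi> where adm: "admissible p \<phi> \<psi>" and gap: "r * (\<integral>x. \<phi> x \<partial>stdN) < (1 - r) * (\<integral>x. \<psi> x \<partial>stdN)"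
    using admissible_pos[of p r] admissible_zero[of r] assms r by (cases "p = 0") auto
  define \<mu> where "\<mu> = (\<integral>x. \<psi> x \<partial>stdN)"
  define \<nu> where "\<nu> = (\<integral>x. \<phi> x \<partial>stdN)"
  have m\<phi>: "\<phi> \<in> borel_measurable borel" and m\<psi>: "\<psi> \<in> borel_measurable borel"
    and b\<phi>: "\<And>x. 0 \<le> \<phi> x" "\<And>x. \<phi> x \<le> 1 + \<bar>x\<bar>" and b\<psi>: "\<And>x. 0 \<le> \<psi> x" "\<And>x. \<psi> x \<le> 1 + \<bar>x\<bar>"
    using adm unfolding admissible_def by blast+
  have \<mu>\<nu>: "0 \<le> \<mu>" "0 \<le> \<nu>"
    unfolding \<mu>_def \<nu>_def by (intro integral_nonneg_AE AE_I2 b\<phi> b\<psi>)+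
  \<comment> \<open>The mean of the statistic is at least 4 * \<tau> * n. One \<tau> is the
    threshold for closeness to the cone, one absorbs the quadratic Chernoff error, and two remain in
    the exponent.\<close>
  define \<tau> where "\<tau> = ((1 - r) * \<mu> - r * \<nu>) / 4"
  have \<tau>: "0 < \<tau>" using gap by (simp add: \<tau>_def \<mu>_def \<nu>_def)
  obtain C where C: "0 < C" "\<And>s t. \<bar>\<phi> s - \<phi> t\<bar> \<le> \<tau> / 2 + C * (s - t)\<^sup>2" "\<And>s t. \<bar>\<psi> s - \<psi> t\<bar> \<le> \<tau> / 2 + C * (s - t)\<^sup>2"
    using admissible_modulus[OF adm, of "\<tau> / 2"] \<tau> half_gt_zero by blast
  \<comment> \<open>The error \<tau> is halved: \<tau> / 2 is the constant in the modulus, and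
    \<eta> makes C times the squared distance at most \<tau> / 2 * n when the squared length of
    \<open>h\<close> is at most 4 * n.\<close>
  define \<eta> where "\<eta> = min 1 (sqrt (\<tau> / (8 * C)))"
  have \<eta>: "0 < \<eta>" "\<eta> \<le> 1" using \<tau> C(1) by (auto simp: \<eta>_def)
  have "\<eta>\<^sup>2 \<le> (sqrt (\<tau> / (8 * C)))\<^sup>2" using \<eta> by (intro power_mono) (auto simp: \<eta>_def)
  also have "\<dots> = \<tau> / (8 * C)" using \<tau> C(1) by simp
  finally have \<eta>2: "C * (\<eta>\<^sup>2 * 4) \<le> \<tau> / 2" using C(1) by (simp add: field_simps)
  define K where "K = (\<integral>x. exp_majorant x \<partial>stdN)"
  have K: "0 \<le> K" unfolding K_def by (intro integral_nonneg_AE AE_I2) (simp add: exp_majorant_def)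
  define \<theta> where "\<theta> = min 1 (\<tau> / (K + 1))"
  have \<theta>: "0 < \<theta>" "\<theta> \<le> 1" using \<tau> K by (auto simp: \<theta>_def)
  have \<theta>K: "\<theta> * K \<le> \<tau>"
  proof -
    have "\<theta> * K \<le> \<theta> * (K + 1)" using \<theta> by simp
    also have "\<dots> \<le> \<tau> / (K + 1) * (K + 1)" using K by (intro mult_right_mono) (auto simp: \<theta>_def)
    finally show ?thesis using K by simp
  qed
  define \<kappa> where "\<kappa> = 32 / \<eta> + 128 / \<eta>\<^sup>2"
  have \<kappa>: "0 < \<kappa>" using \<eta> by (simp add: \<kappa>_def add_pos_pos)
  \<comment> \<open>Of the exponent 2 * \<theta> * \<tau>, one half pays for \<kappa> * (n - m), a
    quarter for the factor 2, and the remaining quarter is \<open>c8\<close>. The bound 1/2 keeps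
    \<open>c7\<close> positive.\<close>
  define c7 where "c7 = 1 - min (1/2) (\<theta> * \<tau> / \<kappa>)"
  define c8 where "c8 = \<theta> * \<tau> / 2"
  have c7: "0 < c7" "c7 < 1" using \<theta> \<tau> \<kappa> by (auto simp: c7_def min_def)
  have c7': "\<kappa> * (1 - c7) \<le> \<theta> * \<tau>"
  proof -
    have "\<kappa> * (1 - c7) \<le> \<kappa> * (\<theta> * \<tau> / \<kappa>)" using \<kappa> by (intro mult_left_mono) (auto simp: c7_def)
    then show ?thesis using \<kappa> by simp
  qed
  have c8: "0 < c8" using \<theta> \<tau> by (simp add: c8_def)
  obtain N0 :: nat where N0: "ln 2 / c8 < N0" using reals_Archimedean2 by blast
  define N where "N = max 2 N0"
  have main: "\<exists>E \<in> sets (gauss_mat m n).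
            E \<subseteq> {A \<in> space (gauss_mat m n). \<forall>x. is_vec n x \<and> {i. x i \<noteq> 0} = T
                    \<and> (\<forall>i\<in>T. sgn (x i) = \<sigma> i) \<longrightarrow> unique_min p m n A x}
            \<and> measure (gauss_mat m n) E \<ge> 1 - exp (- c8 * real n)"
    if n: "n \<ge> N" and mn: "real m / real n > c7" and T: "T \<subseteq> {..<n}" "real (card T) \<le> \<rho> * real m"
      and \<sigma>: "\<forall>i\<in>T. \<sigma> i = -1 \<or> \<sigma> i = (1::real)" for n m T \<sigma>
  proof -
    let ?X = "gauss ({..<m} \<times> {..<n})" and ?Y = "gauss {..<n}"
    have n2: "2 \<le> n" "N0 \<le> n" using n by (auto simp: N_def)
    have "\<exists>E\<in>sets ?X. (\<forall>A\<in>E. \<forall>w. (\<forall>i<m. ip n (curry A i) w = 0) \<and> ip n w w = 1 \<longrightarrow> \<not> bad p n T \<sigma> w) \<and>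
        1 - exp (- c8 * real n) \<le> measure ?X E"
    proof (cases "m < n")
      \<comment> \<open>The ratio m / n has no upper bound, so a trivial null space is treated
        separately.\<close>
      case False
      then obtain E where "E \<in> sets ?X" "\<forall>A\<in>E. \<forall>w. (\<forall>i<m. ip n (curry A i) w = 0) \<longrightarrow> ip n w w = 0" "measure ?X E = 1"
        using null_space_trivial_event[of n m] by auto
      then show ?thesis by (intro bexI[of _ E]) auto
    next
      case True
      let ?f = "sign_stat T \<sigma> \<phi> \<psi>"
      define c where "c i = (if i \<in> T then - \<nu> else \<mu>)" for i
      define Q where "Q h \<longleftrightarrow> (\<Sum>i<n. ?f i (h i)) \<le> \<tau> * n" for h
      have mf: "?f i \<in> borel_measurable borel" for i
      proof (cases "i \<in> T")
        case True
        have "(\<lambda>x. \<sigma> i * x) \<in> borel_measurable borel" by measurable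
        note meas = borel_measurable_uminus[OF measurable_compose[OF this m\<phi>]]
        have "?f i = (\<lambda>x. - \<phi> (\<sigma> i * x))" using True by (simp add: sign_stat_def fun_eq_iff)
        then show ?thesis using meas by (simp only:)
      next
        case False
        then have "?f i = \<psi>" by (simp add: sign_stat_def fun_eq_iff)
        then show ?thesis using m\<psi> by (simp only:)
      qed
      have bf: "\<bar>?f i x\<bar> \<le> 1 + \<bar>x\<bar>" for i x
      proof (cases "i \<in> T")
        case True
        then have "\<bar>\<sigma> i * x\<bar> = \<bar>x\<bar>" using \<sigma> by (auto simp: abs_mult)
        then show ?thesis using True b\<phi>(1)[of "\<sigma> i * x"] b\<phi>(2)[of "\<sigma> i * x"] by (simp add: sign_stat_def)
      next
        case False
        then show ?thesis using b\<psi>(1)[of x] b\<psi>(2)[of x] by (simp add: sign_stat_def)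
      qed
      have cf: "c i \<le> (\<integral>x. ?f i x \<partial>stdN)" for i
      proof (cases "i \<in> T")
        case True
        have "(\<integral>x. \<phi> (\<sigma> i * x) \<partial>stdN) = \<nu>"
          using \<sigma> True integral_stdN_uminus[OF m\<phi>] by (auto simp: \<nu>_def)
        then show ?thesis using True by (simp add: sign_stat_def c_def)
      qed (simp add: sign_stat_def c_def \<mu>_def)
      have "finite T" using T(1) finite_subset by blast
      have cardT: "card T \<le> r * n"
      proof -
        have "real (card T) \<le> r * m" using T(2) r(3) mult_right_mono[OF r(3), of "real m"] by linarith
        also have "\<dots> \<le> r * n" using True r by (intro mult_left_mono) auto
        finally show ?thesis .
      qed
      have sumc: "4 * \<tau> * n \<le> (\<Sum>i<n. c i)"
      proof -
        have "(\<Sum>i<n. c i) = (\<Sum>i\<in>{..<n} - T. \<mu>) + (\<Sum>i\<in>T. - \<nu>)"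
          by (subst sum.subset_diff[OF T(1)]) (auto simp: c_def intro!: arg_cong2[where f="(+)"] sum.cong)
        also have "\<dots> = (real n - card T) * \<mu> - card T * \<nu>"
          using T(1) \<open>finite T\<close> card_mono[OF _ T(1)] by (simp add: card_Diff_subset of_nat_diff)
        also have "\<dots> = n * \<mu> - card T * (\<mu> + \<nu>)" by (simp add: algebra_simps)
        \<comment> \<open>The total mean decreases with the size of \<open>T\<close>, so the largest
          size r * n is the worst case.\<close>
        also have "\<dots> \<ge> n * \<mu> - (r * n) * (\<mu> + \<nu>)"
          using cardT \<mu>\<nu> by (intro diff_left_mono mult_right_mono) auto
        also have "n * \<mu> - (r * n) * (\<mu> + \<nu>) = 4 * \<tau> * n" by (simp add: \<tau>_def algebra_simps)
        finally show ?thesis .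
      qed
      have Qm: "{h \<in> space ?Y. Q h} \<in> sets ?Y"
        unfolding Q_def by (rule gauss_sum_chernoff(1)[OF mf bf \<theta> cf])
      have "measure ?Y {h \<in> space ?Y. Q h} \<le> exp (\<theta> * (\<tau> * n) - \<theta> * (\<Sum>i<n. c i) + \<theta>\<^sup>2 * K * n)"
        unfolding Q_def K_def by (rule gauss_sum_chernoff(2)[OF mf bf \<theta> cf])
      also have "\<dots> \<le> exp (- 2 * (\<theta> * \<tau> * n))"
      proof -
        have "\<theta> * (4 * \<tau> * n) \<le> \<theta> * (\<Sum>i<n. c i)" using sumc \<theta> by (intro mult_left_mono) auto
        moreover have "\<theta> * n * (\<theta> * K) \<le> \<theta> * n * \<tau>" using \<theta>K \<theta> by (intro mult_left_mono) auto
        ultimately show ?thesis by (simp add: power2_eq_square algebra_simps)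
      qed
      finally have PQ: "measure ?Y {h \<in> space ?Y. Q h} \<le> exp (- 2 * (\<theta> * \<tau> * n))" .
      \<comment> \<open>Compare \<open>h\<close> with \<open>w\<close> stretched to the length of
        \<open>h\<close>: on the cone the statistic is at most 0, and the distance adds at most
        \<tau> * n.\<close>
      have near: "Q h" if bad: "bad p n T \<sigma> w" and w: "ip n w w = 1" and h: "ip n h h \<le> 4 * real n"
        and hw: "sqrt (ip n (\<lambda>i. h i - sqrt (ip n h h) * w i) (\<lambda>i. h i - sqrt (ip n h h) * w i)) \<le> \<eta> * sqrt (ip n h h)" for w h
      proof -
        let ?w = "\<lambda>i. sqrt (ip n h h) * w i"
        let ?d = "ip n (\<lambda>i. h i - ?w i) (\<lambda>i. h i - ?w i)"
        have "?d = (sqrt ?d)\<^sup>2" by simp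
        also have "\<dots> \<le> (\<eta> * sqrt (ip n h h))\<^sup>2" by (rule power_mono[OF hw]) simp
        also have "\<dots> = \<eta>\<^sup>2 * ip n h h" by (simp add: power_mult_distrib)
        also have "\<dots> \<le> \<eta>\<^sup>2 * (4 * real n)" using h by (intro mult_left_mono) auto
        finally have "C * ?d \<le> C * (\<eta>\<^sup>2 * (4 * real n))" using C(1) by (intro mult_left_mono) auto
        also have "\<dots> = C * (\<eta>\<^sup>2 * 4) * n" by simp
        also have "\<dots> \<le> \<tau> / 2 * n" using \<eta>2 by (intro mult_right_mono) auto
        finally have d: "C * ?d \<le> \<tau> / 2 * n" .
        have "(\<Sum>i<n. ?f i (h i)) \<le> (\<Sum>i<n. ?f i (?w i)) + (\<tau> / 2 * n + C * ?d)"
          by (rule stat_diff_le[OF C(2,3) \<sigma>])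
        also have "(\<Sum>i<n. ?f i (?w i)) \<le> 0" by (rule stat_bad_le_0[OF adm T(1) \<sigma> bad]) simp
        finally show ?thesis using d unfolding Q_def by (simp add: field_simps)
      qed
      have "\<exists>E\<in>sets ?X. (\<forall>A\<in>E. \<forall>w. (\<forall>i<m. ip n (curry A i) w = 0) \<and> ip n w w = 1 \<longrightarrow> \<not> bad p n T \<sigma> w) \<and>
        1 - 2 * exp (\<kappa> * (real n - real m)) * measure ?Y {h \<in> space ?Y. Q h} \<le> measure ?X E"
        unfolding \<kappa>_def
        by (rule null_space_avoids_cone[OF n2(1) True \<eta> Qm]) (rule near; assumption)
      then obtain E where E: "E \<in> sets ?X" "\<forall>A\<in>E. \<forall>w. (\<forall>i<m. ip n (curry A i) w = 0) \<and> ip n w w = 1 \<longrightarrow> \<not> bad p n T \<sigma> w"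
        "1 - 2 * exp (\<kappa> * (real n - real m)) * measure ?Y {h \<in> space ?Y. Q h} \<le> measure ?X E"
        by (elim bexE conjE)
      \<comment> \<open>The three factors on the right match the three expenses in order: the
        constant 2, absorbed for large n; the passage to the null space; and the Chernoff
        bound.\<close>
      have "2 * exp (\<kappa> * (real n - real m)) * measure ?Y {h \<in> space ?Y. Q h} \<le> exp (c8 * n) * exp (\<theta> * \<tau> * n) * exp (- 2 * (\<theta> * \<tau> * n))"
      proof (intro mult_mono PQ)
        have "ln 2 \<le> c8 * n"
        proof -
          have "ln 2 / c8 \<le> n" using N0 n2 by linarith
          then show ?thesis using c8 by (simp add: field_simps)
        qed
        then have "exp (ln 2) \<le> exp (c8 * n)" by (simp only: exp_le_cancel_iff)
        then show "2 \<le> exp (c8 * n)" by simp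
        have "c7 * n \<le> m" using mn n2 by (simp add: field_simps)
        then have "\<kappa> * (real n - real m) \<le> \<kappa> * (n - c7 * n)" using \<kappa> by (intro mult_left_mono) auto
        also have "\<dots> = \<kappa> * (1 - c7) * n" by (simp add: algebra_simps)
        also have "\<dots> \<le> \<theta> * \<tau> * n" using c7' by (intro mult_right_mono) auto
        finally show "exp (\<kappa> * (real n - real m)) \<le> exp (\<theta> * \<tau> * n)" by simp
      qed simp_all
      also have "\<dots> = exp (- c8 * n)" by (simp add: exp_add[symmetric] c8_def algebra_simps)
      finally show ?thesis using E by (intro bexI[of _ E]) auto
    qed
    then obtain E where E: "E \<in> sets ?X"
      "\<And>A w. A \<in> E \<Longrightarrow> (\<forall>i<m. ip n (curry A i) w = 0) \<Longrightarrow> ip n w w = 1 \<Longrightarrow> \<not> bad p n T \<sigma> w"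
      "1 - exp (- c8 * real n) \<le> measure ?X E"
      by blast
    have "unique_min p m n A x" if "A \<in> E" "is_vec n x" "{i. x i \<noteq> 0} = T" "\<forall>i\<in>T. sgn (x i) = \<sigma> i" for A x
      using assms by (intro unique_min_if_not_bad[OF _ _ T(1) E(2)[OF that(1)] that(2-4)]) auto
    then show ?thesis
      unfolding gauss_mat_eq using E(1,3) sets.sets_into_space[OF E(1)] by (intro bexI[of _ E]) auto
  qed
  show ?thesis
    by (rule exI[of _ c7], rule exI[of _ c8], intro conjI c7 c8 exI[of _ N] allI impI) (rule main; assumption)
qed

end
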